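(* Let $d<\infty$ and let $V,W\subset\mathbb{B}_d$ be analytic discs attached to the unit sphere with embedding maps $f$ and $g$ respectively. If $\mathcal{M}_f$ and $\mathcal{M}_g$ are isomorphic as algebras, then up to a unit disc automorphism $f$ and $g$ have the same self-crossings on the boundary: there exists an automorphism $\mu$ of $\mathbb{D}$ such that for all $\xi,\zeta\in\mathbb{T}$, $f(\xi)=f(\zeta)\iff g(\mu(\xi))=g(\mu(\zeta))$.
   Context: $\mathbb{D}$ is the open unit disc, $\mathbb{T}$ the unit circle, $\mathbb{B}_d$ the open Euclidean unit ball of $\mathbb{C}^d$. The Drury–Arveson space $H^2_d$ is the reproducing kernel Hilbert space on $\mathbb{B}_d$ with kernel $1/(1-\langle z,w\rangle)$, and $\mathcal{M}_d$ denotes its multiplier algebra. A variety is a subset of $\mathbb{B}_d$ which is the common zero set of some family of functions from $\mathcal{M}_d$. An analytic disc attached to the unit sphere is a variety $V\subset\mathbb{B}_d$ ($d<\infty$) for which there is an injective analytic map $f:\mathbb{D}\to\mathbb{B}_d$ with $f'(z)\neq0$ for all $z\in\mathbb{D}$, $V=f(\mathbb{D})$, $f$ extends to a $C^2$ map on $\overline{\mathbb{D}}$, and for $x\in\overline{\mathbb{D}}$, $\|f(x)\|=1$ iff $|x|=1$; such $f$ is called an embedding map of $V$ (maps are evaluated on $\mathbb{T}$ via this extension). $\mathcal{H}_f$ is the reproducing kernel Hilbert space on $\mathbb{D}$ with kernel $k^f(z,w)=1/(1-\langle f(z),f(w)\rangle)$, and $\mathcal{M}_f$ is its multiplier algebra;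 equivalently $\mathcal{M}_f=\{\varphi\circ f:\varphi\in\mathcal{M}_d\}$. *)

theory Defs
  imports "HOL-Analysis.Analysis"
begin

text \<open>Points of C^d are vectors of type complex^'n with 'n a finite index type (d = CARD('n)).
  The norm on complex^'n is the Euclidean norm.\<close>

definition cinner :: "complex ^ 'n::finite \<Rightarrow> complex ^ 'n \<Rightarrow> complex" where
  "cinner z w = (\<Sum>i\<in>UNIV. z $ i * cnj (w $ i))"

definition psd_kernel :: "'a set \<Rightarrow> ('a \<Rightarrow> 'a \<Rightarrow> complex) \<Rightarrow> bool" where
  "psd_kernel X K \<longleftrightarrow>
     (\<forall>(n::nat) (x::nat \<Rightarrow> 'a) (c::nat \<Rightarrow> complex). (\<forall>i<n. x i \<in> X) \<longrightarrow>
        (let s = (\<Sum>i<n. \<Sum>j<n. c i * cnj (c j) * K (x i) (x j)) in Im s = 0 \<and> Re s \<ge> 0))"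

text \<open>Membership in the reproducing kernel Hilbert space H(K) on X (Aronszajn's criterion:
  h \<in> H(K) iff c^2 K(z,w) - h(z) conj(h(w)) is positive semidefinite for some c).\<close>
definition in_rkhs :: "'a set \<Rightarrow> ('a \<Rightarrow> 'a \<Rightarrow> complex) \<Rightarrow> ('a \<Rightarrow> complex) \<Rightarrow> bool" where
  "in_rkhs X K h \<longleftrightarrow>
     (\<exists>c::real. psd_kernel X (\<lambda>z w. complex_of_real (c\<^sup>2) * K z w - h z * cnj (h w)))"

definition mult_alg :: "'a set \<Rightarrow> ('a \<Rightarrow> 'a \<Rightarrow> complex) \<Rightarrow> ('a \<Rightarrow> complex) set" where
  "mult_alg X K = {\<phi>. (\<forall>z. z \<notin> X \<longrightarrow> \<phi> z = 0) \<and>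
       (\<forall>h. in_rkhs X K h \<longrightarrow> in_rkhs X K (\<lambda>z. \<phi> z * h z))}"

definition alg_isomorphic :: "('a \<Rightarrow> complex) set \<Rightarrow> ('b \<Rightarrow> complex) set \<Rightarrow> bool" where
  "alg_isomorphic A B \<longleftrightarrow> (\<exists>\<Phi>. bij_betw \<Phi> A B \<and>
     (\<forall>a\<in>A. \<forall>b\<in>A. \<Phi> (\<lambda>z. a z + b z) = (\<lambda>z. \<Phi> a z + \<Phi> b z)) \<and>
     (\<forall>a\<in>A. \<forall>b\<in>A. \<Phi> (\<lambda>z. a z * b z) = (\<lambda>z. \<Phi> a z * \<Phi> b z)) \<and>
     (\<forall>a\<in>A. \<forall>c::complex. \<Phi> (\<lambda>z. c * a z) = (\<lambda>z. c * \<Phi> a z)))"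

definition DA_kernel :: "complex ^ 'n::finite \<Rightarrow> complex ^ 'n \<Rightarrow> complex" where
  "DA_kernel z w = 1 / (1 - cinner z w)"

definition M_DA :: "(complex ^ 'n::finite \<Rightarrow> complex) set" where
  "M_DA = mult_alg (ball 0 1) DA_kernel"

definition variety :: "(complex ^ 'n::finite) set \<Rightarrow> bool" where
  "variety V \<longleftrightarrow> (\<exists>S \<subseteq> M_DA. V = {z \<in> ball 0 1. \<forall>\<phi>\<in>S. \<phi> z = 0})"

definition C2_on_closed_disc :: "(complex \<Rightarrow> complex ^ 'n::finite) \<Rightarrow> bool" where
  "C2_on_closed_disc f \<longleftrightarrow>
     (\<exists>Df D2f. (\<forall>x\<in>cball 0 1. (f has_derivative blinfun_apply (Df x)) (at x within cball 0 1)) \<and>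
              (\<forall>x\<in>cball 0 1. (Df has_derivative blinfun_apply (D2f x)) (at x within cball 0 1)) \<and>
              continuous_on (cball 0 1) D2f)"

definition embedding_map :: "(complex ^ 'n::finite) set \<Rightarrow> (complex \<Rightarrow> complex ^ 'n) \<Rightarrow> bool" where
  "embedding_map V f \<longleftrightarrow>
     variety V \<and>
     (\<forall>i. (\<lambda>z. f z $ i) holomorphic_on ball 0 1) \<and>
     inj_on f (ball 0 1) \<and>
     (\<forall>z\<in>ball 0 1. \<exists>i. deriv (\<lambda>w. f w $ i) z \<noteq> 0) \<and>
     V = f ` ball 0 1 \<and>
     C2_on_closed_disc f \<and>
     (\<forall>x\<in>cball 0 1. norm (f x) = 1 \<longleftrightarrow> cmod x = 1)"

definition kernel_f :: "(complex \<Rightarrow> complex ^ 'n::finite) \<Rightarrow> complex \<Rightarrow> complex \<Rightarrow> complex" where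
  "kernel_f f z w = 1 / (1 - cinner (f z) (f w))"

definition M_f :: "(complex \<Rightarrow> complex ^ 'n::finite) \<Rightarrow> (complex \<Rightarrow> complex) set" where
  "M_f f = mult_alg (ball 0 1) (kernel_f f)"

text \<open>Automorphism of the disc, together with its (continuous) extension to the closed disc.\<close>
definition disc_automorphism :: "(complex \<Rightarrow> complex) \<Rightarrow> bool" where
  "disc_automorphism \<mu> \<longleftrightarrow> \<mu> holomorphic_on ball 0 1 \<and> bij_betw \<mu> (ball 0 1) (ball 0 1)
      \<and> continuous_on (cball 0 1) \<mu>"

end

theory Submission
  imports Defs "HOL-Complex_Analysis.Complex_Analysis"
begin

text \<open>
  The kernel \<open>1 / (1 - \<langle>f z, f w\<rangle>)\<close> has the complete Pick property, which enters through Leech's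
  theorem. Its consequence is Gleason's identity: for a multiplier \<open>\<phi>\<close> and a point \<open>z\<close>, the function
  \<open>\<phi> - \<phi> z\<close> times the unit \<open>1 - \<langle>f, f z\<rangle>\<close> is \<open>\<Sum> (f\<^sub>i - f\<^sub>i z) \<psi>\<^sub>i\<close> with multipliers \<open>\<psi>\<^sub>i\<close>.
  Hence multipliers are holomorphic. Let a character of the multiplier algebra send the coordinates
  \<open>f\<^sub>i\<close> to a point \<open>\<lambda>\<close> of the open ball. Gleason's identity on the ball at \<open>\<lambda>\<close> shows that every
  multiplier vanishing on the variety vanishes at \<open>\<lambda>\<close>, so \<open>\<lambda> = f z\<close>, and then the identity on the disc
  shows that the character is evaluation at \<open>z\<close>. An algebra isomorphism followed by point evaluations
  gives such characters (the maximum principle excludes the sphere), so it is composition with a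
  biholomorphism of the disc.

  If \<open>f \<xi> = f \<zeta>\<close> on the circle, then along radii travelled at suitable speeds the normalised kernel
  functions at the two points become parallel, because \<open>f\<close> is differentiable up to the boundary and
  meets the sphere transversally (Hopf lemma). So every multiplier that extends continuously to the
  closed disc identifies \<open>\<xi>\<close> and \<open>\<zeta>\<close>. Applying this to the coordinates of \<open>g \<circ> \<mu>\<close>, which are
  multipliers for \<open>f\<close>, and symmetrically, proves the theorem.
\<close>

section \<open>Positive semidefinite kernels\<close>

no_notation fps_nth (infixl "$" 75)

text \<open>Hilbert spaces are never constructed. Membership in the space, multiplier norms and
  projections are read off from finite quadratic forms; a coefficient function \<open>c\<close>
  stands for the combination of kernel functions with coefficients \<open>cnj (c x)\<close>. Three
  obstacles shape the proof. The isomorphism is only algebraic, so characters carry no continuity: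
  Gleason's identity is a finite sum and needs no limit inside a character, and the bound on the
  image of the coordinates comes from the invertibility of \<open>1 - \<phi>\<close>. Secondly,
  \<open>mult_alg\<close> is defined by invariance of the space, so the norm bound behind every
  kernel argument has to be extracted from it. Finally, nothing is known about boundary values of a
  general multiplier; crossings are therefore tested only on the coordinates of the transported
  embeddings, and for this the symbol must be extended continuously to the closed disc.\<close>

definition qf :: "('a \<Rightarrow> 'a \<Rightarrow> complex) \<Rightarrow> 'a set \<Rightarrow> ('a \<Rightarrow> complex) \<Rightarrow> ('a \<Rightarrow> complex) \<Rightarrow> complex" where
  "qf K F c d = (\<Sum>x\<in>F. \<Sum>y\<in>F. c x * cnj (d y) * K x y)"

lemma qf_mono_neutral:
  assumes "finite G" "F \<subseteq> G" "\<And>x. x \<in> G - F \<Longrightarrow> c x = 0" "\<And>x. x \<in> G - F \<Longrightarrow> d x = 0"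
  shows "qf K G c d = qf K F c d"
proof -
  have "qf K G c d = (\<Sum>x\<in>F. \<Sum>y\<in>G. c x * cnj (d y) * K x y)"
    unfolding qf_def by (rule sum.mono_neutral_right) (use assms in auto)
  also have "\<dots> = qf K F c d"
    unfolding qf_def by (intro sum.cong refl sum.mono_neutral_right) (use assms in auto)
  finally show ?thesis .
qed

lemma qf_cong:
  assumes "\<And>x. x \<in> F \<Longrightarrow> c x = c' x" "\<And>x. x \<in> F \<Longrightarrow> d x = d' x"
    "\<And>x y. x \<in> F \<Longrightarrow> y \<in> F \<Longrightarrow> K x y = K' x y"
  shows "qf K F c d = qf K' F c' d'"
  unfolding qf_def by (intro sum.cong refl) (use assms in auto)

lemma qf_add_left: "qf K F (\<lambda>x. c x + c' x) d = qf K F c d + qf K F c' d"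
  and qf_add_right: "qf K F c (\<lambda>x. d x + d' x) = qf K F c d + qf K F c d'"
  and qf_diff_left: "qf K F (\<lambda>x. c x - c' x) d = qf K F c d - qf K F c' d"
  and qf_diff_right: "qf K F c (\<lambda>x. d x - d' x) = qf K F c d - qf K F c d'"
  and qf_scale_left: "qf K F (\<lambda>x. s * c x) d = s * qf K F c d"
  and qf_scale_right: "qf K F c (\<lambda>x. s * d x) = cnj s * qf K F c d"
  unfolding qf_def
  by (simp_all add: algebra_simps sum.distrib sum_subtractf sum_distrib_left)

lemmas qf_linear = qf_add_left qf_add_right qf_diff_left qf_diff_right qf_scale_left qf_scale_right

lemma qf_rank_one:
  "qf (\<lambda>x y. u x * cnj (u y) * K x y) F c d = qf K F (\<lambda>x. u x * c x) (\<lambda>x. u x * d x)"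
  by (simp add: qf_def mult_ac)

lemma qf_kernel_rank_one:
  "qf (\<lambda>x y. u x * cnj (v y)) F c d = (\<Sum>x\<in>F. c x * u x) * cnj (\<Sum>x\<in>F. d x * v x)"
  by (simp add: qf_def sum_product mult_ac)

lemma qf_kernel_add: "qf (\<lambda>x y. K x y + L x y) F c d = qf K F c d + qf L F c d"
  and qf_kernel_diff: "qf (\<lambda>x y. K x y - L x y) F c d = qf K F c d - qf L F c d"
  and qf_kernel_scale: "qf (\<lambda>x y. s * K x y) F c d = s * qf K F c d"
  and qf_kernel_sum: "qf (\<lambda>x y. \<Sum>i\<in>I. M i x y) F c d = (\<Sum>i\<in>I. qf (M i) F c d)"
proof -
  show "qf (\<lambda>x y. \<Sum>i\<in>I. M i x y) F c d = (\<Sum>i\<in>I. qf (M i) F c d)"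
    by (induction I rule: infinite_finite_induct) (simp_all add: qf_def algebra_simps sum.distrib)
qed (simp_all add: qf_def algebra_simps sum.distrib sum_subtractf sum_distrib_left)

text \<open>The definition of \<open>psd_kernel\<close> allows a point to be listed several times.
  Adding the coefficients of equal points turns such a list into a coefficient function on a finite
  set.\<close>

lemma psd_kernel_iff:
  "psd_kernel X K \<longleftrightarrow> (\<forall>F c. finite F \<longrightarrow> F \<subseteq> X \<longrightarrow> qf K F c c \<in> \<real>\<^sub>\<ge>\<^sub>0)"
proof (intro iffI allI impI)
  fix F and c :: "'a \<Rightarrow> complex"
  assume psd: "psd_kernel X K" and F: "finite F" "F \<subseteq> X"
  obtain h where h: "bij_betw h {0..<card F} F"
    using ex_bij_betw_nat_finite[OF F(1)] by blast
  then have h: "bij_betw h {..<card F} F" by (simp add: atLeast0LessThan)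
  have "qf K F c c = (\<Sum>i<card F. \<Sum>j<card F. c (h i) * cnj (c (h j)) * K (h i) (h j))"
    unfolding qf_def by (simp add: sum.reindex_bij_betw[OF h, symmetric])
  then show "qf K F c c \<in> \<real>\<^sub>\<ge>\<^sub>0"
    using psd[unfolded psd_kernel_def, rule_format, of "card F" h "\<lambda>i. c (h i)"] F bij_betwE[OF h]
    by (auto simp: Let_def complex_nonneg_Reals_iff)
next
  assume psd: "\<forall>F c. finite F \<longrightarrow> F \<subseteq> X \<longrightarrow> qf K F c c \<in> \<real>\<^sub>\<ge>\<^sub>0"
  show "psd_kernel X K"
    unfolding psd_kernel_def
  proof (intro allI impI)
    fix n :: nat and x :: "nat \<Rightarrow> 'a" and c :: "nat \<Rightarrow> complex"
    assume x: "\<forall>i<n. x i \<in> X"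
    define F where "F = x ` {..<n}"
    define C where "C v = (\<Sum>i\<in>{i. i \<in> {..<n} \<and> x i = v}. c i)" for v
    have *: "(\<Sum>i<n. c i * g (x i)) = (\<Sum>v\<in>F. C v * g v)" for g
      unfolding F_def C_def sum_distrib_right
      by (subst sum.image_gen[of "{..<n}" _ x]) (auto intro!: sum.cong)
    have **: "(\<Sum>j<n. cnj (c j) * g (x j)) = (\<Sum>v\<in>F. cnj (C v) * g v)" for g
      using arg_cong[OF *[of "\<lambda>v. cnj (g v)"], of cnj] by simp
    have "(\<Sum>i<n. \<Sum>j<n. c i * cnj (c j) * K (x i) (x j))
        = (\<Sum>i<n. c i * (\<Sum>j<n. cnj (c j) * K (x i) (x j)))"
      by (simp add: sum_distrib_left mult_ac)
    also have "\<dots> = (\<Sum>v\<in>F. C v * (\<Sum>w\<in>F. cnj (C w) * K v w))"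
      by (simp only: ** *[of "\<lambda>v. \<Sum>w\<in>F. cnj (C w) * K v w"])
    also have "\<dots> = qf K F C C"
      by (simp add: qf_def sum_distrib_left mult_ac)
    also have "\<dots> \<in> \<real>\<^sub>\<ge>\<^sub>0"
      using psd x by (auto simp: F_def)
    finally show "let s = \<Sum>i<n. \<Sum>j<n. c i * cnj (c j) * K (x i) (x j) in Im s = 0 \<and> 0 \<le> Re s"
      by (simp add: Let_def complex_nonneg_Reals_iff)
  qed
qed

lemma psd_kernelD: "psd_kernel X K \<Longrightarrow> finite F \<Longrightarrow> F \<subseteq> X \<Longrightarrow> qf K F c c \<in> \<real>\<^sub>\<ge>\<^sub>0"
  by (simp add: psd_kernel_iff)

lemma psd_kernel_Re_nonneg: "psd_kernel X K \<Longrightarrow> finite F \<Longrightarrow> F \<subseteq> X \<Longrightarrow> 0 \<le> Re (qf K F c c)"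
  using psd_kernelD[of X K F c] by (simp add: complex_nonneg_Reals_iff)

lemma psd_kernel_Im_zero: "psd_kernel X K \<Longrightarrow> finite F \<Longrightarrow> F \<subseteq> X \<Longrightarrow> Im (qf K F c c) = 0"
  using psd_kernelD[of X K F c] by (simp add: complex_nonneg_Reals_iff)

lemma psd_kernel_subset: "psd_kernel X K \<Longrightarrow> Y \<subseteq> X \<Longrightarrow> psd_kernel Y K"
  by (auto simp: psd_kernel_iff)

lemma psd_kernel_compose:
  "psd_kernel X K \<Longrightarrow> f ` Y \<subseteq> X \<Longrightarrow> psd_kernel Y (\<lambda>x y. K (f x) (f y))"
  unfolding psd_kernel_def
proof (intro allI impI)
  fix n :: nat and x c
  assume K: "\<forall>(n::nat) x c. (\<forall>i<n. x i \<in> X) \<longrightarrow>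
           (let s = \<Sum>i<n. \<Sum>j<n. c i * cnj (c j) * K (x i) (x j) in Im s = 0 \<and> 0 \<le> Re s)"
    and f: "f ` Y \<subseteq> X" and x: "\<forall>i<n::nat. x i \<in> Y"
  show "let s = \<Sum>i<n. \<Sum>j<n. c i * cnj (c j) * K (f (x i)) (f (x j)) in Im s = 0 \<and> 0 \<le> Re s"
    using K[rule_format, of n "\<lambda>i. f (x i)" c] f x by auto
qed

lemma psd_kernel_cong:
  assumes "\<And>x y. x \<in> X \<Longrightarrow> y \<in> X \<Longrightarrow> K x y = L x y"
  shows "psd_kernel X K \<longleftrightarrow> psd_kernel X L"
proof -
  have "qf K F c c = qf L F c c" if "F \<subseteq> X" for F c
    using assms that by (intro qf_cong) auto
  then show ?thesis by (auto simp: psd_kernel_iff)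
qed

lemma psd_kernel_add:
  "psd_kernel X K \<Longrightarrow> psd_kernel X L \<Longrightarrow> psd_kernel X (\<lambda>x y. K x y + L x y)"
  by (simp add: psd_kernel_iff qf_kernel_add)

lemma psd_kernel_zero: "psd_kernel X (\<lambda>x y. 0)"
  by (simp add: psd_kernel_iff qf_def)

lemma psd_kernel_sum:
  "(\<And>i. i \<in> I \<Longrightarrow> psd_kernel X (M i)) \<Longrightarrow> psd_kernel X (\<lambda>x y. \<Sum>i\<in>I. M i x y)"
  by (induction I rule: infinite_finite_induct) (auto intro: psd_kernel_zero psd_kernel_add)

lemma psd_kernel_scale:
  "psd_kernel X K \<Longrightarrow> s \<in> \<real>\<^sub>\<ge>\<^sub>0 \<Longrightarrow> psd_kernel X (\<lambda>x y. s * K x y)"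
  by (simp add: psd_kernel_iff qf_kernel_scale)

lemma psd_kernel_rank_one_mult:
  "psd_kernel X K \<Longrightarrow> psd_kernel X (\<lambda>x y. u x * cnj (u y) * K x y)"
  by (simp add: psd_kernel_iff qf_rank_one)

lemma psd_kernel_rank_one: "psd_kernel X (\<lambda>x y. u x * cnj (u y))"
  unfolding psd_kernel_iff qf_kernel_rank_one complex_norm_square[symmetric] by simp

lemma psd_kernel_limit:
  assumes "\<And>n. psd_kernel X (M n)"
    and "\<And>x y. x \<in> X \<Longrightarrow> y \<in> X \<Longrightarrow> (\<lambda>n. M n x y) \<longlonglongrightarrow> K x y"
  shows "psd_kernel X K"
  unfolding psd_kernel_iff
proof (intro allI impI)
  fix F and c :: "'a \<Rightarrow> complex"
  assume F: "finite F" "F \<subseteq> X"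
  have "(\<lambda>n. qf (M n) F c c) \<longlonglongrightarrow> qf K F c c"
    unfolding qf_def by (intro tendsto_intros assms) (use F in auto)
  then show "qf K F c c \<in> \<real>\<^sub>\<ge>\<^sub>0"
    by (rule closed_sequentially[OF closed_nonneg_Reals_complex, rotated])
      (use psd_kernelD assms F in blast)
qed

lemma psd_kernel_diag: "psd_kernel X K \<Longrightarrow> x \<in> X \<Longrightarrow> K x x \<in> \<real>\<^sub>\<ge>\<^sub>0"
  using psd_kernelD[of X K "{x}" "\<lambda>_. 1"] by (simp add: qf_def)

text \<open>Hermitian symmetry is not part of \<open>psd_kernel\<close>; it follows from the form
  being real at the coefficient vectors \<open>(1, 1)\<close> and \<open>(\<i>, 1)\<close>.\<close>

lemma psd_kernel_herm:
  assumes K: "psd_kernel X K" and x: "x \<in> X" and y: "y \<in> X"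
  shows "K y x = cnj (K x y)"
proof (cases "x = y")
  case True
  then show ?thesis using psd_kernel_diag[OF K x] by (auto simp: complex_nonneg_Reals_iff complex_eq_iff)
next
  case False
  have xy: "finite {x, y}" "{x, y} \<subseteq> X" using x y by auto
  have im: "Im (K x x) = 0" "Im (K y y) = 0"
    using psd_kernel_diag[OF K] x y by (auto simp: complex_nonneg_Reals_iff)
  show ?thesis
    using psd_kernel_Im_zero[OF K xy, of "\<lambda>z. 1"] im False
      psd_kernel_Im_zero[OF K xy, of "\<lambda>z. if z = x then \<i> else 1"]
    by (simp add: qf_def complex_eq_iff)
qed

lemma qf_herm:
  assumes K: "psd_kernel X K" and F: "F \<subseteq> X"
  shows "qf K F d c = cnj (qf K F c d)"
proof -
  have "qf K F d c = (\<Sum>y\<in>F. \<Sum>x\<in>F. d x * cnj (c y) * K x y)"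
    unfolding qf_def by (rule sum.swap)
  also have "\<dots> = cnj (qf K F c d)"
    unfolding qf_def cnj_sum
    by (intro sum.cong refl) (use F psd_kernel_herm[OF K] in auto)
  finally show ?thesis .
qed

section \<open>Polarisation, Cauchy-Schwarz and the triangle inequality\<close>

lemma qf_add:
  assumes K: "psd_kernel X K" and F: "F \<subseteq> X"
  shows "Re (qf K F (\<lambda>x. c x + s * d x) (\<lambda>x. c x + s * d x))
      = Re (qf K F c c) + 2 * Re (cnj s * qf K F c d) + (cmod s)\<^sup>2 * Re (qf K F d d)"
proof -
  have "qf K F (\<lambda>x. c x + s * d x) (\<lambda>x. c x + s * d x)
      = qf K F c c + (cnj s * qf K F c d + cnj (cnj s * qf K F c d)) + (s * cnj s) * qf K F d d"
    by (simp add: qf_linear qf_herm[OF K F, of d c] algebra_simps)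
  then show ?thesis by (simp add: complex_norm_square[symmetric] complex_add_cnj del: of_real_power flip: of_real_power)
qed

lemma qf_cauchy_schwarz:
  assumes K: "psd_kernel X K" and F: "finite F" "F \<subseteq> X"
  shows "(cmod (qf K F c d))\<^sup>2 \<le> Re (qf K F c c) * Re (qf K F d d)"
proof -
  define a b e where "a = Re (qf K F c c)" and "b = Re (qf K F d d)" and "e = qf K F c d"
  have b: "b \<ge> 0" unfolding b_def by (rule psd_kernel_Re_nonneg[OF K F])
  \<comment> \<open>Positivity of the form at \<open>c + s d\<close> with \<open>s = - t e\<close>;
    the factor \<open>e\<close> turns the cross term onto the real axis.\<close>
  have *: "0 \<le> a - 2 * t * (cmod e)\<^sup>2 + t\<^sup>2 * (cmod e)\<^sup>2 * b" for t :: real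
  proof -
    have "0 \<le> a + 2 * Re (cnj (- of_real t * e) * e) + (cmod (- of_real t * e))\<^sup>2 * b"
      unfolding a_def b_def e_def qf_add[OF K F(2), symmetric] by (rule psd_kernel_Re_nonneg[OF K F])
    moreover have "Re (cnj (- of_real t * e) * e) = - t * (cmod e)\<^sup>2"
      unfolding cmod_power2 by (simp add: power2_eq_square algebra_simps)
    ultimately show ?thesis by (simp add: norm_mult power_mult_distrib)
  qed
  show ?thesis
  proof (cases "b = 0")
    case True
    have "(cmod e)\<^sup>2 = 0"
    proof (rule ccontr)
      assume "(cmod e)\<^sup>2 \<noteq> 0"
      \<comment> \<open>For \<open>b = 0\<close> the expression is affine in \<open>t\<close>, and
        at this value it equals \<open>-1\<close>.\<close>
      then show False using *[of "(a + 1) / (2 * (cmod e)\<^sup>2)"] True by (simp add: field_simps)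
    qed
    with True show ?thesis by (simp add: a_def b_def e_def)
  next
    case False
    with b have "b > 0" by simp
    then show ?thesis using *[of "1 / b"] unfolding a_def b_def e_def
      by (simp add: field_simps power2_eq_square)
  qed
qed

lemma qf_triangle:
  assumes K: "psd_kernel X K" and F: "finite F" "F \<subseteq> X"
  shows "sqrt (Re (qf K F (\<lambda>x. c x + d x) (\<lambda>x. c x + d x)))
      \<le> sqrt (Re (qf K F c c)) + sqrt (Re (qf K F d d))"
proof -
  define a b where "a = Re (qf K F c c)" and "b = Re (qf K F d d)"
  have nn: "0 \<le> a" "0 \<le> b" unfolding a_def b_def by (rule psd_kernel_Re_nonneg[OF K F])+
  have "Re (qf K F c d) \<le> cmod (qf K F c d)" by (rule complex_Re_le_cmod)
  also have "\<dots> \<le> sqrt (a * b)"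
    unfolding a_def b_def by (rule real_le_rsqrt[OF qf_cauchy_schwarz[OF K F]])
  finally have "Re (qf K F (\<lambda>x. c x + d x) (\<lambda>x. c x + d x)) \<le> a + 2 * (sqrt a * sqrt b) + b"
    using qf_add[OF K F(2), of c 1 d] by (simp add: a_def b_def real_sqrt_mult)
  also have "\<dots> = (sqrt a + sqrt b)\<^sup>2" using nn by (simp add: power2_sum)
  finally show ?thesis unfolding a_def b_def
    using nn by (intro real_le_lsqrt) (auto simp: a_def b_def)
qed

section \<open>Rank-one domination, multiplier inequalities and Schur complements\<close>

text \<open>The form of a rank-one kernel at \<open>c\<close> is a squared modulus, so domination by
  \<open>P\<close> is boundedness with constant one of a linear functional on coefficient vectors:
  the finite-sum version of \<open>h\<close> lying in the closed unit ball of the space of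
  \<open>P\<close>.\<close>

lemma psd_kernel_minus_rank_one_iff:
  assumes "psd_kernel X P"
  shows "psd_kernel X (\<lambda>x y. P x y - h x * cnj (h y)) \<longleftrightarrow>
    (\<forall>F c. finite F \<longrightarrow> F \<subseteq> X \<longrightarrow> (cmod (\<Sum>x\<in>F. c x * h x))\<^sup>2 \<le> Re (qf P F c c))"
proof -
  have "qf (\<lambda>x y. P x y - h x * cnj (h y)) F c c
      = qf P F c c - complex_of_real ((cmod (\<Sum>x\<in>F. c x * h x))\<^sup>2)" for F c
    unfolding qf_kernel_diff qf_kernel_rank_one complex_norm_square ..
  then show ?thesis
    unfolding psd_kernel_iff complex_nonneg_Reals_iff
    using psd_kernel_Im_zero[OF assms] by (simp del: of_real_power)
qed

text \<open>Passing from \<open>c\<close> to \<open>\<phi> c\<close> is the action of the adjoint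
  multiplication operator on combinations of kernel functions, which are its eigenvectors; the
  inequality bounds its norm by \<open>t\<close>.\<close>

lemma psd_kernel_multiplier_iff:
  assumes "psd_kernel X K"
  shows "psd_kernel X (\<lambda>x y. (complex_of_real (t\<^sup>2) - \<phi> x * cnj (\<phi> y)) * K x y) \<longleftrightarrow>
    (\<forall>F c. finite F \<longrightarrow> F \<subseteq> X \<longrightarrow>
      Re (qf K F (\<lambda>x. \<phi> x * c x) (\<lambda>x. \<phi> x * c x)) \<le> t\<^sup>2 * Re (qf K F c c))"
  using psd_kernel_Im_zero[OF assms]
  by (auto simp: psd_kernel_iff left_diff_distrib qf_kernel_diff qf_rank_one qf_kernel_scale
      complex_nonneg_Reals_iff simp flip: of_real_power)

text \<open>The kernel function at \<open>z\<close> divided by its norm is a unit vector, so its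
  rank-one kernel is dominated by \<open>K\<close>. Concretely this is Cauchy-Schwarz against the
  point mass at \<open>z\<close>, on a point set enlarged by \<open>z\<close>.\<close>

lemma psd_kernel_schur_complement:
  assumes K: "psd_kernel X K" and z: "z \<in> X" "K z z \<noteq> 0"
  shows "psd_kernel X (\<lambda>x y. K x y - K x z * K z y / K z z)"
proof -
  have kz: "Re (K z z) > 0" "K z z = of_real (Re (K z z))"
    using psd_kernel_diag[OF K z(1)] z(2) by (auto simp: complex_nonneg_Reals_iff complex_eq_iff less_le)
  define h where "h x = K x z / of_real (sqrt (Re (K z z)))" for x
  have "psd_kernel X (\<lambda>x y. K x y - h x * cnj (h y))"
    unfolding psd_kernel_minus_rank_one_iff[OF K]
  proof (intro allI impI)
    fix F and c :: "'a \<Rightarrow> complex" assume F: "finite F" "F \<subseteq> X"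
    define G where "G = insert z F"
    define d where "d x = (if x \<in> F then c x else 0)" for x
    define e where "e x = (if x = z then 1 else 0 :: complex)" for x
    have G: "finite G" "G \<subseteq> X" using F z by (auto simp: G_def)
    have "qf K G d d = qf K F d d"
      by (rule qf_mono_neutral) (use F in \<open>auto simp: G_def d_def\<close>)
    also have "\<dots> = qf K F c c" by (rule qf_cong) (auto simp: d_def)
    finally have 1: "qf K G d d = qf K F c c" .
    have "qf K G e e = qf K {z} e e"
      by (rule qf_mono_neutral) (use F in \<open>auto simp: G_def e_def\<close>)
    then have 2: "qf K G e e = K z z" by (simp add: qf_def e_def)
    have "qf K G d e = (\<Sum>x\<in>G. d x * K x z)"
      unfolding qf_def using G by (intro sum.cong refl) (simp add: e_def sum.delta G_def if_distrib if_distribR cong: if_cong)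
    also have "\<dots> = (\<Sum>x\<in>F. d x * K x z)"
      using F by (intro sum.mono_neutral_right) (auto simp: G_def d_def)
    also have "\<dots> = (\<Sum>x\<in>F. c x * K x z)" by (simp add: d_def)
    finally have 3: "qf K G d e = (\<Sum>x\<in>F. c x * K x z)" .
    have "(cmod (\<Sum>x\<in>F. c x * h x))\<^sup>2 = (cmod (qf K G d e))\<^sup>2 / Re (K z z)"
      using kz(1) unfolding 3 h_def
      by (simp add: norm_divide power_divide flip: sum_divide_distrib)
    also have "\<dots> \<le> Re (qf K F c c)"
      using qf_cauchy_schwarz[OF K G, of d e] kz(1) unfolding 1 2 by (simp add: field_simps)
    finally show "(cmod (\<Sum>x\<in>F. c x * h x))\<^sup>2 \<le> Re (qf K F c c)" .
  qed
  moreover have "h x * cnj (h y) = K x z * K z y / K z z" if "x \<in> X" "y \<in> X" for x y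
  proof -
    have "of_real (sqrt (Re (K z z))) * of_real (sqrt (Re (K z z))) = K z z"
      using kz by (metis abs_of_pos of_real_mult real_sqrt_mult_self)
    then show ?thesis
      using psd_kernel_herm[OF K that(2) z(1)] by (simp add: h_def)
  qed
  ultimately show ?thesis
    by (subst psd_kernel_cong[where L = "\<lambda>x y. K x y - h x * cnj (h y)"]) auto
qed

section \<open>Kernels built from the inner product, and one-point extension\<close>

lemma cinner_add_left: "cinner (x + y) z = cinner x z + cinner y z"
  and cinner_add_right: "cinner x (y + z) = cinner x y + cinner x z"
  and cinner_diff_left: "cinner (x - y) z = cinner x z - cinner y z"
  and cinner_diff_right: "cinner x (y - z) = cinner x y - cinner x z"
  and cinner_scale_left: "cinner (c *s x) z = c * cinner x z"
  and cinner_scale_right: "cinner x (c *s z) = cnj c * cinner x z"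
  and cinner_zero_left [simp]: "cinner 0 z = 0"
  by (simp_all add: cinner_def algebra_simps sum.distrib sum_subtractf sum_distrib_left)

lemma cinner_commute: "cinner x y = cnj (cinner y x)"
  by (simp add: cinner_def mult_ac)

lemma cinner_self: "cinner x x = complex_of_real ((norm x)\<^sup>2)"
proof -
  have "cinner x x = of_real (\<Sum>i\<in>UNIV. (norm (x $ i))\<^sup>2)"
    unfolding cinner_def of_real_sum by (intro sum.cong refl) (simp only: complex_norm_square)
  also have "(\<Sum>i\<in>UNIV. (norm (x $ i))\<^sup>2) = (norm x)\<^sup>2"
    by (simp add: norm_vec_def L2_set_def sum_nonneg)
  finally show ?thesis .
qed

lemma cmod_cinner_le: "cmod (cinner x y) \<le> norm x * norm y"
proof -
  have "cmod (cinner x y) \<le> (\<Sum>i\<in>UNIV. \<bar>norm (x $ i)\<bar> * \<bar>norm (y $ i)\<bar>)"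
    unfolding cinner_def by (rule order_trans[OF norm_sum]) (simp add: norm_mult)
  also have "\<dots> \<le> norm x * norm y"
    unfolding norm_vec_def by (rule L2_set_mult_ineq)
  finally show ?thesis .
qed

lemma cmod_cinner_less_1: "norm x < 1 \<Longrightarrow> norm y \<le> 1 \<Longrightarrow> cmod (cinner x y) < 1"
  by (meson cmod_cinner_le le_less_trans mult_left_le norm_ge_zero)

lemma one_minus_cinner_neq_0: "norm x < 1 \<Longrightarrow> norm y \<le> 1 \<Longrightarrow> 1 - cinner x y \<noteq> 0"
  using cmod_cinner_less_1[of x y] by force

lemma psd_kernel_cinner_mult:
  assumes "psd_kernel X K"
  shows "psd_kernel X (\<lambda>x y. cinner (u x) (u y) * K x y)"
  unfolding cinner_def sum_distrib_right
  by (intro psd_kernel_sum psd_kernel_rank_one_mult[OF assms])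

text \<open>Lagrange's identity: the expression is half the sum of the rank-one kernels of the
  two-by-two minors \<open>w i j\<close> of \<open>u x\<close> and \<open>v\<close>.\<close>

lemma psd_kernel_lagrange_mult:
  assumes "psd_kernel X K"
  shows "psd_kernel X (\<lambda>x y. (complex_of_real ((norm v)\<^sup>2) * cinner (u x) (u y)
    - cinner (u x) v * cinner v (u y)) * K x y)"
proof -
  define w where "w i j x = u x $ i * v $ j - u x $ j * v $ i" for i j x
  have eq: "complex_of_real ((norm v)\<^sup>2) * cinner (u x) (u y) - cinner (u x) v * cinner v (u y)
      = of_real (1/2) * (\<Sum>i\<in>UNIV. \<Sum>j\<in>UNIV. w i j x * cnj (w i j y))" for x y
  proof -
    define p q r s where "p i = u x $ i * cnj (u y $ i)" and "q i = v $ i * cnj (v $ i)"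
      and "r i = u x $ i * cnj (v $ i)" and "s i = v $ i * cnj (u y $ i)" for i
    have "w i j x * cnj (w i j y) = p i * q j + q i * p j - r i * s j - s i * r j" for i j
      by (simp add: w_def p_def q_def r_def s_def algebra_simps)
    then have "(\<Sum>i\<in>UNIV. \<Sum>j\<in>UNIV. w i j x * cnj (w i j y))
      = sum p UNIV * sum q UNIV + sum q UNIV * sum p UNIV - sum r UNIV * sum s UNIV - sum s UNIV * sum r UNIV"
      by (simp only: sum.distrib sum_subtractf sum_product)
    also have "\<dots> = 2 * (cinner v v * cinner (u x) (u y) - cinner (u x) v * cinner v (u y))"
      by (simp add: p_def q_def r_def s_def cinner_def)
    finally show ?thesis by (simp add: cinner_self)
  qed
  have "psd_kernel X (\<lambda>x y. of_real (1/2) * (\<Sum>i\<in>UNIV. \<Sum>j\<in>UNIV. w i j x * cnj (w i j y) * K x y))"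
    by (intro psd_kernel_scale psd_kernel_sum psd_kernel_rank_one_mult[OF assms]) simp
  then show ?thesis unfolding eq by (simp only: sum_distrib_right mult.assoc)
qed

text \<open>The Drury-Arveson kernel pulled back along \<open>b\<close>. Taking \<open>b\<close> to
  be an embedding map on the disc or the identity on the ball lets one theory serve both
  spaces.\<close>

definition dk :: "('a \<Rightarrow> complex ^ 'n::finite) \<Rightarrow> 'a \<Rightarrow> 'a \<Rightarrow> complex" where
  "dk b x y = 1 / (1 - cinner (b x) (b y))"

text \<open>The kernel is a geometric series in the inner product, whose powers are positive
  semidefinite.\<close>

lemma psd_kernel_dk:
  assumes b: "\<And>x. x \<in> X \<Longrightarrow> norm (b x) < 1"
  shows "psd_kernel X (dk b)"
proof (rule psd_kernel_limit)
  have pow: "psd_kernel X (\<lambda>x y. cinner (b x) (b y) ^ m)" for m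
    by (induction m) (use psd_kernel_rank_one[of X "\<lambda>_. 1"] psd_kernel_cinner_mult in auto)
  show "psd_kernel X (\<lambda>x y. \<Sum>m<n. cinner (b x) (b y) ^ m)" for n :: nat
    by (intro psd_kernel_sum pow)
  show "(\<lambda>n. \<Sum>m<n. cinner (b x) (b y) ^ m) \<longlonglongrightarrow> dk b x y" if "x \<in> X" "y \<in> X" for x y
    using geometric_sums[of "cinner (b x) (b y)"] cmod_cinner_less_1[of "b x" "b y"] b that
    by (simp add: sums_def dk_def less_imp_le)
qed

lemma dk_neq_0: "norm (b x) < 1 \<Longrightarrow> norm (b y) < 1 \<Longrightarrow> dk b x y \<noteq> 0"
  using one_minus_cinner_neq_0[of "b x" "b y"] by (simp add: dk_def)

text \<open>This is the complete Pick property. Dividing the left side by its first product gives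
  \<open>1 - k(u,l) k(l,v) / (k(u,v) k(l,l))\<close> for the Drury-Arveson kernel \<open>k\<close>;
  the right side shows it as a sum of positive kernels in \<open>u\<close> and
  \<open>v\<close>.\<close>

lemma pick_defect:
  "(1 - cinner u l) * (1 - cinner l v) - of_real (1 - (norm l)\<^sup>2) * (1 - cinner u v)
    = of_real (1 - (norm l)\<^sup>2) * cinner (u - l) (v - l) + cinner (u - l) l * cinner l (v - l)"
  unfolding of_real_diff of_real_1 cinner_self[symmetric]
  by (simp add: cinner_diff_left cinner_diff_right algebra_simps)

lemma psd_kernel_pick_defect_mult:
  assumes K: "psd_kernel X K" and l: "norm l < 1"
  shows "psd_kernel X (\<lambda>x y. ((1 - cinner (u x) l) * (1 - cinner l (u y))
    - of_real (1 - (norm l)\<^sup>2) * (1 - cinner (u x) (u y))) * K x y)"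
proof -
  have "of_real (1 - (norm l)\<^sup>2) \<in> (\<real>\<^sub>\<ge>\<^sub>0 :: complex set)"
    using l unfolding nonneg_Reals_of_real_iff by (simp add: power_le_one)
  then have "psd_kernel X (\<lambda>x y. of_real (1 - (norm l)\<^sup>2) * (cinner (u x - l) (u y - l) * K x y)
      + cinner (u x - l) l * cnj (cinner (u y - l) l) * K x y)"
    by (intro psd_kernel_add psd_kernel_scale psd_kernel_rank_one_mult[OF K]
        psd_kernel_cinner_mult[OF K])
  then show ?thesis
    unfolding pick_defect by (simp add: cinner_commute[of l] algebra_simps)
qed

lemma psd_kernel_zero_extend:
  assumes K: "psd_kernel Q K" and Y: "\<And>x y. x \<in> Q \<Longrightarrow> y \<in> Q \<Longrightarrow> L x y = K x y"
    "\<And>x y. x \<in> Y \<Longrightarrow> y \<in> Y \<Longrightarrow> x \<notin> Q \<or> y \<notin> Q \<Longrightarrow> L x y = 0"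
  shows "psd_kernel Y L"
  unfolding psd_kernel_iff
proof (intro allI impI)
  fix F and c :: "'a \<Rightarrow> complex" assume F: "finite F" "F \<subseteq> Y"
  have zero: "L x y = 0" if "x \<in> F" "y \<in> F" "x \<notin> Q \<or> y \<notin> Q" for x y
    using Y(2) F(2) that by blast
  have "qf L F c c = (\<Sum>x\<in>F \<inter> Q. \<Sum>y\<in>F. c x * cnj (c y) * L x y)"
    unfolding qf_def by (rule sum.mono_neutral_right) (use F zero in \<open>auto intro!: sum.neutral\<close>)
  also have "\<dots> = (\<Sum>x\<in>F \<inter> Q. \<Sum>y\<in>F \<inter> Q. c x * cnj (c y) * L x y)"
    by (intro sum.cong refl sum.mono_neutral_right) (use F zero in auto)
  also have "\<dots> = qf K (F \<inter> Q) c c" unfolding qf_def by (intro sum.cong refl) (use Y in auto)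
  also have "\<dots> \<in> \<real>\<^sub>\<ge>\<^sub>0" using psd_kernelD[OF K, of "F \<inter> Q" c] F by auto
  finally show "qf L F c c \<in> \<real>\<^sub>\<ge>\<^sub>0" .
qed

text \<open>The admissible values at \<open>z\<close> form an intersection of discs whose squared radii \<open>N c\<close> are bounded
  below by \<open>d2\<close>; subtracting \<open>d2\<close> keeps the discs pairwise intersecting and makes radii arbitrarily
  small, so the centres along a minimising sequence converge to a common point.\<close>
lemma rank_one_extension:
  fixes h :: "'a \<Rightarrow> complex"
  assumes P: "psd_kernel (insert z Q) P" and z: "z \<notin> Q"
    and h: "psd_kernel Q (\<lambda>x y. P x y - h x * cnj (h y))"
  shows "\<exists>b. psd_kernel (insert z Q) (\<lambda>x y. P x y - (h(z := b)) x * cnj ((h(z := b)) y))"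
proof -
  have PQ: "psd_kernel Q P" by (rule psd_kernel_subset[OF P]) auto
  \<comment> \<open>With the coefficient at \<open>z\<close> scaled to one, a value \<open>b\<close>
    is admissible exactly when \<open>|L c + b|^2 \<le> N c\<close> for all
    \<open>c \<in> S\<close>. So \<open>- b\<close> has to lie in every disc with centre
    \<open>L c\<close> and squared radius \<open>N c\<close>.\<close>
  define S where "S = {c :: 'a \<Rightarrow> complex. finite {x. c x \<noteq> 0} \<and> {x. c x \<noteq> 0} \<subseteq> Q}"
  define N where "N c = Re (qf P (insert z {x. c x \<noteq> 0}) (c(z := 1)) (c(z := 1)))" for c
  define L where "L c = (\<Sum>x | c x \<noteq> 0. c x * h x)" for c
  have S_I: "c \<in> S" if "finite G" "G \<subseteq> Q" "\<And>x. x \<notin> G \<Longrightarrow> c x = 0" for c G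
    using that by (auto simp: S_def intro: finite_subset[of _ G])
  have N_eq: "N c = Re (qf P (insert z G) (c(z := 1)) (c(z := 1)))"
    if "finite G" "\<And>x. x \<notin> G \<Longrightarrow> c x = 0" for c G
  proof -
    have "qf P (insert z G) (c(z := 1)) (c(z := 1))
        = qf P (insert z {x. c x \<noteq> 0}) (c(z := 1)) (c(z := 1))"
      by (rule qf_mono_neutral) (use that in auto)
    then show ?thesis by (simp add: N_def)
  qed
  have L_eq: "L c = (\<Sum>x\<in>G. c x * h x)" if "finite G" "\<And>x. x \<notin> G \<Longrightarrow> c x = 0" for c G
    unfolding L_def by (rule sum.mono_neutral_left) (use that in auto)
  have N_nonneg: "0 \<le> N c" if "c \<in> S" for c
    unfolding N_def by (rule psd_kernel_Re_nonneg[OF P]) (use that in \<open>auto simp: S_def\<close>)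
  have S0: "(\<lambda>x. 0) \<in> S" by (simp add: S_def)
  \<comment> \<open>The squared distance of the kernel function at \<open>z\<close> from the span of
    those at points of \<open>Q\<close>.\<close>
  define d2 where "d2 = Inf (N ` S)"
  have bdd: "bdd_below (N ` S)" by (rule bdd_belowI[of _ 0]) (use N_nonneg in auto)
  have d2_le: "d2 \<le> N c" if "c \<in> S" for c
    unfolding d2_def by (rule cINF_lower[OF bdd that])
  have d2_nonneg: "0 \<le> d2"
    unfolding d2_def by (rule cINF_greatest) (use S0 N_nonneg in auto)
  define e where "e c = sqrt (N c - d2)" for c
  have e_sq: "(e c)\<^sup>2 = N c - d2" "0 \<le> e c" if "c \<in> S" for c
    using d2_le[OF that] by (auto simp: e_def)
  have key: "cmod (L c - L d) \<le> e c + e d" if c: "c \<in> S" and d: "d \<in> S" for c d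
  proof (rule field_le_epsilon)
    fix \<epsilon> :: real assume \<epsilon>: "\<epsilon> > 0"
    define G where "G = {x. c x \<noteq> 0} \<union> {x. d x \<noteq> 0}"
    have G: "finite G" "G \<subseteq> Q" "finite (insert z G)" "insert z G \<subseteq> insert z Q"
      using c d by (auto simp: S_def G_def)
    have out: "c x = 0" "d x = 0" if "x \<notin> G" for x using that by (auto simp: G_def)
    have zG: "z \<notin> G" using G z by auto
    \<comment> \<open>Adding \<open>\<epsilon> / 2\<close> keeps \<open>a\<close> and
      \<open>b\<close> positive, so that the weight \<open>s\<close> makes sense even where
      \<open>e\<close> vanishes.\<close>
    define a where "a = e c + \<epsilon> / 2"
    define b where "b = e d + \<epsilon> / 2"
    have ab: "a > 0" "b > 0" "N c - d2 \<le> a\<^sup>2" "N d - d2 \<le> b\<^sup>2"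
      unfolding a_def b_def e_sq(1)[OF c, symmetric] e_sq(1)[OF d, symmetric]
      using e_sq(2)[OF c] e_sq(2)[OF d] \<epsilon> by (auto intro!: power_mono add_nonneg_pos)
    \<comment> \<open>With this weight \<open>s a^2 + (1 - s) b^2\<close> equals
      \<open>s (1 - s) (a + b)^2\<close>, which matches the defect term in the parallelogram
      identity for the convex combination \<open>m\<close>.\<close>
    define s where "s = b / (a + b)"
    have s: "1 - s = a / (a + b)" using ab by (simp add: s_def field_simps)
    have s01: "0 \<le> s" "0 \<le> 1 - s" unfolding s using ab by (simp_all add: s_def)
    define u v where "u = c(z := 1)" and "v = d(z := 1)"
    define m where "m x = of_real s * c x + of_real (1 - s) * d x" for x
    define D where "D = Re (qf P G (\<lambda>x. c x - d x) (\<lambda>x. c x - d x))"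
    have mz: "m(z := 1) = (\<lambda>x. of_real s * u x + of_real (1 - s) * v x)"
      by (auto simp: m_def u_def v_def)
    have uv: "qf P (insert z G) (\<lambda>x. u x - v x) (\<lambda>x. u x - v x)
        = qf P G (\<lambda>x. c x - d x) (\<lambda>x. c x - d x)"
    proof -
      have "qf P (insert z G) (\<lambda>x. u x - v x) (\<lambda>x. u x - v x) = qf P G (\<lambda>x. u x - v x) (\<lambda>x. u x - v x)"
        by (rule qf_mono_neutral) (use G in \<open>auto simp: u_def v_def\<close>)
      also have "\<dots> = qf P G (\<lambda>x. c x - d x) (\<lambda>x. c x - d x)"
        by (rule qf_cong) (use zG in \<open>auto simp: u_def v_def\<close>)
      finally show ?thesis .
    qed
    have "m \<in> S" by (rule S_I[OF G(1,2)]) (simp add: m_def out)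
    then have "d2 \<le> N m" by (rule d2_le)
    also have "N m = Re (qf P (insert z G) (m(z := 1)) (m(z := 1)))"
      by (rule N_eq[OF G(1)]) (simp add: m_def out)
    also have "\<dots> = s * N c + (1 - s) * N d - s * (1 - s) * D"
    proof -
      have 1: "N c = Re (qf P (insert z G) u u)" "N d = Re (qf P (insert z G) v v)"
        unfolding u_def v_def by (rule N_eq[OF G(1)], simp add: out)+
      show ?thesis
        unfolding mz 1 D_def uv[symmetric]
        by (simp add: qf_linear algebra_simps)
    qed
    finally have "s * (1 - s) * D \<le> s * (N c - d2) + (1 - s) * (N d - d2)"
      by (simp add: algebra_simps)
    also have "\<dots> \<le> s * a\<^sup>2 + (1 - s) * b\<^sup>2"
      by (intro add_mono mult_left_mono ab s01)
    also have "\<dots> = s * (1 - s) * (a + b)\<^sup>2"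
      unfolding s using ab by (simp add: s_def divide_simps power2_eq_square) (simp add: algebra_simps)
    finally have "s * (1 - s) * D \<le> s * (1 - s) * (a + b)\<^sup>2" .
    moreover have "0 < s * (1 - s)" unfolding s using ab by (simp add: s_def)
    ultimately have "D \<le> (a + b)\<^sup>2" by (simp only: mult_le_cancel_left_pos)
    moreover have "(cmod (\<Sum>x\<in>G. (c x - d x) * h x))\<^sup>2 \<le> D"
      using h G unfolding psd_kernel_minus_rank_one_iff[OF PQ] D_def by auto
    moreover have "(\<Sum>x\<in>G. (c x - d x) * h x) = L c - L d"
      using L_eq[OF G(1) out(1)] L_eq[OF G(1) out(2)] by (simp add: algebra_simps sum_subtractf)
    ultimately have "(cmod (L c - L d))\<^sup>2 \<le> (a + b)\<^sup>2" by simp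
    then have "cmod (L c - L d) \<le> a + b" by (rule power2_le_imp_le) (use ab in auto)
    then show "cmod (L c - L d) \<le> e c + e d + \<epsilon>" by (simp add: a_def b_def)
  qed
  have "\<exists>c\<in>S. N c < d2 + (inverse (real (Suc n)))\<^sup>2" for n
    using cINF_less_iff[OF _ bdd, of "d2 + (inverse (real (Suc n)))\<^sup>2"] S0
    unfolding d2_def[symmetric] by auto
  then obtain cc where cc: "cc n \<in> S" "N (cc n) < d2 + (inverse (real (Suc n)))\<^sup>2" for n
    by metis
  have e_cc: "e (cc n) \<le> inverse (real (Suc n))" for n
    unfolding e_def by (rule real_le_lsqrt) (use cc(2)[of n] in auto)
  have e_lim: "(\<lambda>n. e (cc n)) \<longlonglongrightarrow> 0"
    by (rule tendsto_sandwich[OF _ _ tendsto_const LIMSEQ_inverse_real_of_nat])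
      (use e_cc e_sq(2)[OF cc(1)] in auto)
  have "Cauchy (\<lambda>n. L (cc n))"
  proof (rule metric_CauchyI)
    fix \<epsilon> :: real assume "\<epsilon> > 0"
    then have "\<forall>\<^sub>F n in sequentially. e (cc n) < \<epsilon> / 2"
      using order_tendstoD(2)[OF e_lim, of "\<epsilon> / 2"] by simp
    then obtain M where M: "e (cc n) < \<epsilon> / 2" if "n \<ge> M" for n
      by (auto simp: eventually_sequentially)
    show "\<exists>M. \<forall>m\<ge>M. \<forall>n\<ge>M. dist (L (cc m)) (L (cc n)) < \<epsilon>"
    proof (intro exI allI impI)
      fix m n assume "m \<ge> M" "n \<ge> M"
      then show "dist (L (cc m)) (L (cc n)) < \<epsilon>"
        using key[OF cc(1) cc(1), of m n] M[of m] M[of n] by (simp add: dist_norm)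
    qed
  qed
  then obtain l where l: "(\<lambda>n. L (cc n)) \<longlonglongrightarrow> l"
    using Cauchy_convergent_iff convergent_def by blast
  have bound: "(cmod (L c - l))\<^sup>2 \<le> N c" if c: "c \<in> S" for c
  proof -
    have "(\<lambda>n. cmod (L c - L (cc n))) \<longlonglongrightarrow> cmod (L c - l)" "(\<lambda>n. e c + e (cc n)) \<longlonglongrightarrow> e c + 0"
      by (intro tendsto_intros l e_lim)+
    then have "cmod (L c - l) \<le> e c + 0"
      by (rule lim_mono[of 0, rotated]) (rule key[OF c cc(1)])
    then have "(cmod (L c - l))\<^sup>2 \<le> (e c)\<^sup>2" by (intro power_mono) auto
    with e_sq[OF c] d2_nonneg show ?thesis by simp
  qed
  show ?thesis
  proof (intro exI)
    show "psd_kernel (insert z Q) (\<lambda>x y. P x y - (h(z := - l)) x * cnj ((h(z := - l)) y))"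
      unfolding psd_kernel_minus_rank_one_iff[OF P]
    proof (intro allI impI)
      fix F c assume F: "finite F" "F \<subseteq> insert z Q"
      show "(cmod (\<Sum>x\<in>F. c x * (h(z := - l)) x))\<^sup>2 \<le> Re (qf P F c c)"
      proof (cases "z \<in> F \<and> c z \<noteq> 0")
        case False
        define G where "G = F - {z}"
        have G: "finite G" "G \<subseteq> Q" using F by (auto simp: G_def)
        have "(\<Sum>x\<in>F. c x * (h(z := - l)) x) = (\<Sum>x\<in>G. c x * (h(z := - l)) x)"
          by (rule sum.mono_neutral_right) (use F False in \<open>auto simp: G_def\<close>)
        also have "\<dots> = (\<Sum>x\<in>G. c x * h x)" by (intro sum.cong refl) (auto simp: G_def)
        finally have 1: "(\<Sum>x\<in>F. c x * (h(z := - l)) x) = (\<Sum>x\<in>G. c x * h x)" .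
        have "qf P F c c = qf P G c c"
          by (rule qf_mono_neutral) (use F False in \<open>auto simp: G_def\<close>)
        with 1 h G show ?thesis unfolding psd_kernel_minus_rank_one_iff[OF PQ] by auto
      next
        case True
        define t where "t = c z"
        have t: "t \<noteq> 0" "z \<in> F" using True by (auto simp: t_def)
        define G where "G = F - {z}"
        have G: "finite G" "G \<subseteq> Q" "insert z G = F" using F t by (auto simp: G_def)
        have zG: "z \<notin> G" by (simp add: G_def)
        define d where "d x = (if x \<in> G then c x / t else 0)" for x
        have dS: "d \<in> S" by (rule S_I[OF G(1,2)]) (simp add: d_def)
        have "L d = (\<Sum>x\<in>G. d x * h x)" by (rule L_eq[OF G(1)]) (simp add: d_def)
        also have "\<dots> = (\<Sum>x\<in>G. c x * h x) / t"
          unfolding sum_divide_distrib by (intro sum.cong refl) (simp add: d_def)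
        finally have Ld: "t * L d = (\<Sum>x\<in>G. c x * h x)" using t by simp
        have "(\<Sum>x\<in>F. c x * (h(z := - l)) x) = t * (- l) + (\<Sum>x\<in>G. c x * (h(z := - l)) x)"
          unfolding G(3)[symmetric] using G(1) zG by (simp add: t_def)
        also have "(\<Sum>x\<in>G. c x * (h(z := - l)) x) = (\<Sum>x\<in>G. c x * h x)"
          by (intro sum.cong refl) (use zG in auto)
        finally have 1: "(\<Sum>x\<in>F. c x * (h(z := - l)) x) = t * (L d - l)"
          unfolding Ld[symmetric] by (simp add: algebra_simps)
        define u where "u = d(z := 1)"
        have "N d = Re (qf P F u u)"
          unfolding G(3)[symmetric] u_def by (rule N_eq[OF G(1)]) (simp add: d_def)
        moreover have "qf P F c c = qf P F (\<lambda>x. t * u x) (\<lambda>x. t * u x)"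
          by (rule qf_cong) (use t in \<open>auto simp: u_def d_def t_def G_def\<close>)
        moreover have "\<dots> = of_real ((cmod t)\<^sup>2) * qf P F u u"
          unfolding qf_linear complex_norm_square by (simp add: mult_ac)
        ultimately have "Re (qf P F c c) = (cmod t)\<^sup>2 * N d" by (simp del: of_real_power)
        then show ?thesis
          unfolding 1 norm_mult power_mult_distrib using bound[OF dS] by (simp add: mult_left_mono)
      qed
    qed
  qed
qed

section \<open>Leech's factorisation theorem\<close>

text \<open>A triple \<open>(x, u, p)\<close> records the demand that the unknown column of
  multipliers at \<open>x\<close> pairs with \<open>u\<close> to give \<open>p\<close>. Positivity
  says that the prospective adjoint, sending the kernel function at \<open>x\<close> tensored with
  the conjugate of \<open>u\<close> to \<open>cnj p\<close> times that kernel function, is a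
  contraction.\<close>

definition leech_kernel ::
    "('a \<Rightarrow> complex ^ 'n::finite) \<Rightarrow> 'a \<times> (complex ^ 'm::finite) \<times> complex
      \<Rightarrow> 'a \<times> (complex ^ 'm) \<times> complex \<Rightarrow> complex" where
  "leech_kernel b = (\<lambda>(x, u, p) (y, v, q). (cinner u v - p * cnj q) * dk b x y)"

text \<open>Multiplying by \<open>(1 - \<langle>b y, b x\<rangle>) (1 - \<langle>b x, b y'\<rangle>)\<close> normalises the kernel at \<open>x\<close>. The condition on
  \<open>\<beta>\<close> then has the form ``\<open>P - h h\<^sup>*\<close> is positive semidefinite'' where \<open>P\<close> does not involve \<open>\<beta>\<close>.\<close>
lemma leech_step:
  fixes Q :: "('a \<times> (complex ^ 'm::finite) \<times> complex) set" and b :: "'a \<Rightarrow> complex ^ 'n::finite"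
  assumes b: "\<And>y. y \<in> X \<Longrightarrow> norm (b y) < 1" and Q: "psd_kernel Q (leech_kernel b)"
    and QX: "fst ` Q \<subseteq> X" and x: "x \<in> X"
  shows "\<exists>\<beta>. psd_kernel (insert (x, a, \<beta>) Q) (leech_kernel b)"
proof -
  define l where "l = b x"
  define \<sigma> where "\<sigma> = 1 - (norm l)\<^sup>2"
  have l: "norm l < 1" using b x by (simp add: l_def)
  have \<sigma>: "\<sigma> > 0" using l by (simp add: \<sigma>_def power_less_one_iff)
  \<comment> \<open>Indexing by \<open>option\<close> keeps the index set fixed while
    \<open>\<beta>\<close> is still unknown: \<open>None\<close> is the new triple, with value
    \<open>0\<close> as a placeholder in \<open>B\<close>.\<close>
  define y :: "('a \<times> (complex ^ 'm) \<times> complex) option \<Rightarrow> 'a"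
    where "y o' = (case o' of None \<Rightarrow> x | Some q \<Rightarrow> fst q)" for o'
  define A :: "('a \<times> (complex ^ 'm) \<times> complex) option \<Rightarrow> complex ^ 'm"
    where "A o' = (case o' of None \<Rightarrow> a | Some q \<Rightarrow> fst (snd q))" for o'
  define B :: "('a \<times> (complex ^ 'm) \<times> complex) option \<Rightarrow> complex"
    where "B o' = (case o' of None \<Rightarrow> 0 | Some q \<Rightarrow> snd (snd q))" for o'
  \<comment> \<open>The Pick defect at \<open>l\<close>. It vanishes as soon as one index is
    \<open>None\<close>, so the unknown value disappears from \<open>Kt\<close> and survives only in
    the rank-one term.\<close>
  define num where "num o1 o2 = (1 - cinner (b (y o1)) l) * (1 - cinner l (b (y o2)))
    - of_real (1 - (norm l)\<^sup>2) * (1 - cinner (b (y o1)) (b (y o2)))" for o1 o2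
  define LK where "LK \<beta> o1 o2 = (cinner (A o1) (A o2) - (B(None := \<beta>)) o1 * cnj ((B(None := \<beta>)) o2))
    * dk b (y o1) (y o2)" for \<beta> o1 o2
  define Kt where "Kt o1 o2 = num o1 o2 * LK 0 o1 o2" for o1 o2
  define P where "P o1 o2 = of_real \<sigma> * cinner (A o1) (A o2) + Kt o1 o2" for o1 o2
  define h where "h o1 = of_real (sqrt \<sigma>) * B o1" for o1
  define w where "w o1 = 1 - cinner (b (y o1)) l" for o1
  define I where "I = Some ` Q"
  have None_I: "None \<notin> I" by (auto simp: I_def)
  have yX: "norm (b (y o1)) < 1" if "o1 \<in> insert None I" for o1
    using that b x QX by (auto simp: I_def y_def)
  have yN: "b (y None) = l" by (simp add: y_def l_def)
  have num0: "num o1 o2 = 0" if "o1 = None \<or> o2 = None" for o1 o2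
    using that unfolding num_def of_real_diff of_real_1 cinner_self[symmetric]
    by (auto simp: yN)
  have psd_Q: "psd_kernel I (LK 0)"
  proof -
    have "psd_kernel I (\<lambda>o1 o2. leech_kernel b (the o1) (the o2))"
      by (rule psd_kernel_compose[OF Q]) (auto simp: I_def)
    then show ?thesis
      by (subst psd_kernel_cong[where L = "\<lambda>o1 o2. leech_kernel b (the o1) (the o2)"])
        (auto simp: I_def leech_kernel_def LK_def A_def B_def y_def split_beta)
  qed
  have "psd_kernel I Kt"
    unfolding Kt_def num_def by (rule psd_kernel_pick_defect_mult[OF psd_Q l])
  then have Kt: "psd_kernel (insert None I) Kt"
    by (rule psd_kernel_zero_extend) (use num0 in \<open>auto simp: Kt_def\<close>)
  have one: "psd_kernel Y (\<lambda>x y. 1)" for Y :: "'c set"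
    using psd_kernel_rank_one[of Y "\<lambda>_. 1"] by simp
  have P: "psd_kernel (insert None I) P"
    unfolding P_def
    by (intro psd_kernel_add psd_kernel_scale Kt psd_kernel_cinner_mult[OF one, where u = A, simplified])
      (use \<sigma> in simp)
  have eq: "P o1 o2 - (h(None := of_real (sqrt \<sigma>) * \<beta>)) o1 * cnj ((h(None := of_real (sqrt \<sigma>) * \<beta>)) o2)
      = w o1 * cnj (w o2) * LK \<beta> o1 o2"
    if "o1 \<in> insert None I" "o2 \<in> insert None I" for o1 o2 \<beta>
  proof -
    have sq: "complex_of_real (sqrt \<sigma>) * complex_of_real (sqrt \<sigma>) = of_real \<sigma>"
      using \<sigma> by (metis less_imp_le of_real_mult real_sqrt_mult_self abs_of_nonneg)
    have hh: "(h(None := of_real (sqrt \<sigma>) * \<beta>)) o1 * cnj ((h(None := of_real (sqrt \<sigma>) * \<beta>)) o2)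
        = of_real \<sigma> * ((B(None := \<beta>)) o1 * cnj ((B(None := \<beta>)) o2))"
      unfolding sq[symmetric] by (simp add: h_def)
    have dk1: "(1 - cinner (b (y o1)) (b (y o2))) * dk b (y o1) (y o2) = 1"
      using one_minus_cinner_neq_0[of "b (y o1)" "b (y o2)"] yX that by (simp add: dk_def less_imp_le)
    have gen: "W = n + s * (1 - c) \<Longrightarrow> W * (V * D) = n * (V * D) + s * V * ((1 - c) * D)"
      for W n s c V D :: complex by (erule ssubst) (simp add: algebra_simps)
    have "w o1 * cnj (w o2) = num o1 o2 + of_real \<sigma> * (1 - cinner (b (y o1)) (b (y o2)))"
      by (simp add: w_def num_def \<sigma>_def cinner_commute[of l])
    then have "w o1 * cnj (w o2) * LK \<beta> o1 o2 = num o1 o2 * LK \<beta> o1 o2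
        + of_real \<sigma> * (cinner (A o1) (A o2) - (B(None := \<beta>)) o1 * cnj ((B(None := \<beta>)) o2))
          * ((1 - cinner (b (y o1)) (b (y o2))) * dk b (y o1) (y o2))"
      unfolding LK_def by (rule gen)
    moreover have "num o1 o2 * LK \<beta> o1 o2 = Kt o1 o2"
    proof (cases "o1 = None \<or> o2 = None")
      case True
      then show ?thesis by (simp add: num0 Kt_def)
    next
      case False
      then show ?thesis by (auto simp: Kt_def LK_def)
    qed
    ultimately show ?thesis
      unfolding dk1 hh P_def by (simp add: algebra_simps)
  qed
  have "psd_kernel I (\<lambda>o1 o2. P o1 o2 - h o1 * cnj (h o2))"
  proof -
    have "psd_kernel I (\<lambda>o1 o2. w o1 * cnj (w o2) * LK 0 o1 o2)"
      by (rule psd_kernel_rank_one_mult[OF psd_Q])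
    moreover have "P o1 o2 - h o1 * cnj (h o2) = w o1 * cnj (w o2) * LK 0 o1 o2"
      if "o1 \<in> I" "o2 \<in> I" for o1 o2
    proof -
      have "o1 \<noteq> None" "o2 \<noteq> None" using that by (auto simp: I_def)
      then show ?thesis using eq[of o1 o2 0] that by auto
    qed
    ultimately show ?thesis by (simp cong: psd_kernel_cong)
  qed
  from rank_one_extension[OF P None_I this] obtain b' where
    b': "psd_kernel (insert None I) (\<lambda>o1 o2. P o1 o2 - (h(None := b')) o1 * cnj ((h(None := b')) o2))"
    by blast
  define \<beta> where "\<beta> = b' / of_real (sqrt \<sigma>)"
  have b'_eq: "b' = of_real (sqrt \<sigma>) * \<beta>" using \<sigma> by (simp add: \<beta>_def)
  have w0: "w o1 \<noteq> 0" if "o1 \<in> insert None I" for o1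
    unfolding w_def using one_minus_cinner_neq_0[OF yX[OF that]] l by simp
  have "psd_kernel (insert None I) (LK \<beta>)"
  proof -
    have "psd_kernel (insert None I) (\<lambda>o1 o2. inverse (w o1) * cnj (inverse (w o2)) *
        (P o1 o2 - (h(None := b')) o1 * cnj ((h(None := b')) o2)))"
      by (rule psd_kernel_rank_one_mult[OF b'])
    moreover have "inverse (w o1) * cnj (inverse (w o2)) *
        (P o1 o2 - (h(None := b')) o1 * cnj ((h(None := b')) o2)) = LK \<beta> o1 o2"
      if "o1 \<in> insert None I" "o2 \<in> insert None I" for o1 o2
      unfolding b'_eq eq[OF that] using w0[OF that(1)] w0[OF that(2)] by (simp add: field_simps)
    ultimately show ?thesis by (simp only: cong: psd_kernel_cong)
  qed
  \<comment> \<open>The case distinction also covers a new triple that already belongs to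
    \<open>Q\<close>.\<close>
  then have "psd_kernel (insert (x, a, \<beta>) Q)
      (\<lambda>t t'. LK \<beta> (if t \<in> Q then Some t else None) (if t' \<in> Q then Some t' else None))"
    by (rule psd_kernel_compose) (auto simp: I_def)
  then have "psd_kernel (insert (x, a, \<beta>) Q) (leech_kernel b)"
    by (subst (asm) psd_kernel_cong[where L = "leech_kernel b"])
      (auto simp: I_def leech_kernel_def LK_def A_def B_def y_def split_beta)
  then show ?thesis by blast
qed

text \<open>All triples used lie over the same \<open>x\<close>. With coefficient \<open>1\<close>
  at \<open>(x, a, p)\<close> and \<open>- a $ i\<close> at the basis triples the vector parts
  cancel, and the form is a negative multiple of the squared modulus of
  \<open>p - (\<Sum>i\<in>UNIV. a $ i * q i)\<close>.\<close>

lemma leech_kernel_linear: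
  fixes M :: "('a \<times> (complex ^ 'm::finite) \<times> complex) set" and b :: "'a \<Rightarrow> complex ^ 'n::finite"
  assumes M: "psd_kernel M (leech_kernel b)" and x: "norm (b x) < 1"
    and a: "(x, a, p) \<in> M" and e: "\<And>i. (x, axis i 1, q i) \<in> M"
  shows "p = (\<Sum>i\<in>UNIV. a $ i * q i)"
proof -
  define g where "g o' = (case o' of None \<Rightarrow> (x, a, p) | Some i \<Rightarrow> (x, axis i 1, q i))" for o'
  define A where "A o' = (case o' of None \<Rightarrow> a | Some i \<Rightarrow> axis i 1)" for o'
  define B where "B o' = (case o' of None \<Rightarrow> p | Some i \<Rightarrow> q i)" for o'
  define c where "c o' = (case o' of None \<Rightarrow> 1 | Some i \<Rightarrow> - a $ i)" for o'
  have UN: "(\<Sum>o'\<in>UNIV. F o') = F None + (\<Sum>i\<in>UNIV. F (Some i))" for F :: "'m option \<Rightarrow> complex"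
    by (simp add: UNIV_option_conv sum.reindex)
  have "psd_kernel UNIV (\<lambda>o1 o2. leech_kernel b (g o1) (g o2))"
    by (rule psd_kernel_compose[OF M]) (use a e in \<open>auto simp: g_def split: option.split\<close>)
  then have "psd_kernel UNIV (\<lambda>o1 o2. (cinner (A o1) (A o2) - B o1 * cnj (B o2)) * dk b x x)"
    by (subst psd_kernel_cong[where L = "\<lambda>o1 o2. leech_kernel b (g o1) (g o2)"])
      (auto simp: g_def A_def B_def leech_kernel_def split: option.split)
  then have "qf (\<lambda>o1 o2. (cinner (A o1) (A o2) - B o1 * cnj (B o2)) * dk b x x) UNIV c c \<in> \<real>\<^sub>\<ge>\<^sub>0"
    by (rule psd_kernelD) auto
  also have "qf (\<lambda>o1 o2. (cinner (A o1) (A o2) - B o1 * cnj (B o2)) * dk b x x) UNIV c c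
    = dk b x x * ((\<Sum>i\<in>UNIV. qf (\<lambda>o1 o2. A o1 $ i * cnj (A o2 $ i)) UNIV c c)
      - qf (\<lambda>o1 o2. B o1 * cnj (B o2)) UNIV c c)"
    unfolding cinner_def by (subst mult.commute) (simp only: qf_kernel_scale qf_kernel_diff qf_kernel_sum)
  also have "(\<Sum>i\<in>UNIV. qf (\<lambda>o1 o2. A o1 $ i * cnj (A o2 $ i)) UNIV c c) = 0"
  proof (rule sum.neutral, rule ballI)
    fix i
    have "(\<Sum>o'\<in>UNIV. c o' * A o' $ i) = 0"
      by (simp add: UN c_def A_def axis_def if_distrib sum.delta cong: if_cong)
    then show "qf (\<lambda>o1 o2. A o1 $ i * cnj (A o2 $ i)) UNIV c c = 0"
      by (simp add: qf_kernel_rank_one)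
  qed
  finally have "dk b x x * (0 - of_real ((cmod (\<Sum>o'\<in>UNIV. c o' * B o'))\<^sup>2)) \<in> \<real>\<^sub>\<ge>\<^sub>0"
    unfolding qf_kernel_rank_one complex_norm_square .
  moreover have "dk b x x = of_real (1 / (1 - (norm (b x))\<^sup>2))"
    by (simp add: dk_def cinner_self)
  moreover have "1 - (norm (b x))\<^sup>2 > 0" using x by (simp add: power_less_one_iff)
  ultimately have "(cmod (\<Sum>o'\<in>UNIV. c o' * B o'))\<^sup>2 \<le> 0"
    by (simp add: complex_nonneg_Reals_iff divide_le_0_iff flip: of_real_power)
  then have "(\<Sum>o'\<in>UNIV. c o' * B o') = 0" by simp
  then show ?thesis by (simp add: UN c_def B_def sum_negf)
qed

text \<open>A maximal set of triples \<open>(x, u, \<beta>)\<close> on which \<open>leech_kernel\<close> is positive semidefinite contains one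
  for every \<open>x\<close> and \<open>u\<close>, and positivity forces \<open>\<beta>\<close> to depend linearly on \<open>u\<close>.\<close>
lemma leech:
  fixes A :: "'a \<Rightarrow> complex ^ 'm::finite" and b :: "'a \<Rightarrow> complex ^ 'n::finite"
  assumes b: "\<And>y. y \<in> X \<Longrightarrow> norm (b y) < 1"
    and psd: "psd_kernel X (\<lambda>x y. (cinner (A x) (A y) - a x * cnj (a y)) * dk b x y)"
  shows "\<exists>\<phi>. (\<forall>x\<in>X. a x = (\<Sum>i\<in>UNIV. A x $ i * \<phi> i x)) \<and>
    (\<forall>i. psd_kernel X (\<lambda>x y. (1 - \<phi> i x * cnj (\<phi> i y)) * dk b x y))"
proof -
  \<comment> \<open>The equation to be solved, as data: the column at \<open>x\<close> must pair
    with \<open>A x\<close> to give \<open>a x\<close>.\<close>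
  define Q0 where "Q0 = (\<lambda>x. (x, A x, a x)) ` X"
  define \<Q> where "\<Q> = {Q. Q0 \<subseteq> Q \<and> fst ` Q \<subseteq> X \<and> psd_kernel Q (leech_kernel b)}"
  have "psd_kernel Q0 (leech_kernel b)"
  proof -
    have "psd_kernel Q0 (\<lambda>t t'. (cinner (A (fst t)) (A (fst t')) - a (fst t) * cnj (a (fst t')))
        * dk b (fst t) (fst t'))"
      by (rule psd_kernel_compose[OF psd]) (auto simp: Q0_def)
    then show ?thesis
      by (subst (asm) psd_kernel_cong[where L = "leech_kernel b"]) (auto simp: Q0_def leech_kernel_def)
  qed
  then have "Q0 \<in> \<Q>" by (auto simp: \<Q>_def Q0_def)
  have "\<exists>M\<in>\<Q>. \<forall>Q\<in>\<Q>. M \<subseteq> Q \<longrightarrow> Q = M"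
  proof (rule subset_Zorn_nonempty)
    show "\<Q> \<noteq> {}" using \<open>Q0 \<in> \<Q>\<close> by auto
    fix C assume C: "C \<noteq> {}" "subset.chain \<Q> C"
    then have CQ: "C \<subseteq> \<Q>" by (simp add: subset_chain_def)
    have "psd_kernel (\<Union>C) (leech_kernel b)"
      unfolding psd_kernel_iff
    proof (intro allI impI)
      fix F and c :: "'a \<times> (complex ^ 'm) \<times> complex \<Rightarrow> complex"
      assume F: "finite F" "F \<subseteq> \<Union>C"
      then obtain Q where "Q \<in> C" "F \<subseteq> Q"
        using finite_subset_Union_chain[OF F C] by blast
      then show "qf (leech_kernel b) F c c \<in> \<real>\<^sub>\<ge>\<^sub>0"
        using CQ F by (auto simp: \<Q>_def intro: psd_kernelD)
    qed
    moreover have "Q0 \<subseteq> \<Union>C" using CQ C(1) by (auto simp only: \<Q>_def)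
    ultimately show "\<Union>C \<in> \<Q>" using CQ by (auto simp: \<Q>_def)
  qed
  then obtain M where M: "M \<in> \<Q>" and max: "\<And>Q. Q \<in> \<Q> \<Longrightarrow> M \<subseteq> Q \<Longrightarrow> Q = M" by blast
  have ex: "\<exists>\<beta>. (x, u, \<beta>) \<in> M" if x: "x \<in> X" for x u
  proof -
    have "\<exists>\<beta>. psd_kernel (insert (x, u, \<beta>) M) (leech_kernel b)"
      by (rule leech_step[where X = X]) (use b M x in \<open>auto simp: \<Q>_def\<close>)
    then obtain \<beta> where "psd_kernel (insert (x, u, \<beta>) M) (leech_kernel b)" by blast
    then have "insert (x, u, \<beta>) M \<in> \<Q>" using M x by (auto simp: \<Q>_def)
    from max[OF this] show ?thesis by blast
  qed
  define \<phi> where "\<phi> i x = (SOME \<beta>. (x, axis i 1, \<beta>) \<in> M)" for i x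
  have \<phi>: "(x, axis i 1, \<phi> i x) \<in> M" if "x \<in> X" for i x
    unfolding \<phi>_def by (rule someI_ex[OF ex[OF that]])
  have M_psd: "psd_kernel M (leech_kernel b)" using M by (simp add: \<Q>_def)
  show ?thesis
  proof (intro exI conjI ballI allI)
    fix x assume x: "x \<in> X"
    show "a x = (\<Sum>i\<in>UNIV. A x $ i * \<phi> i x)"
      by (rule leech_kernel_linear[OF M_psd b[OF x] _ \<phi>[OF x]])
        (use M x in \<open>auto simp: \<Q>_def Q0_def\<close>)
  next
    fix i :: 'm
    have *: "cinner (axis i 1) (axis i 1 :: complex ^ 'm) = 1"
      by (simp add: cinner_def axis_def if_distrib sum.delta cong: if_cong)
    have "psd_kernel X (\<lambda>x y. leech_kernel b (x, axis i 1, \<phi> i x) (y, axis i 1, \<phi> i y))"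
      by (rule psd_kernel_compose[OF M_psd]) (use \<phi> in auto)
    then show "psd_kernel X (\<lambda>x y. (1 - \<phi> i x * cnj (\<phi> i y)) * dk b x y)"
      by (simp add: leech_kernel_def *)
  qed
qed

section \<open>Multipliers and Gleason's problem\<close>

definition qnorm :: "('a \<Rightarrow> 'a \<Rightarrow> complex) \<Rightarrow> 'a set \<Rightarrow> ('a \<Rightarrow> complex) \<Rightarrow> real" where
  "qnorm K F c = sqrt (Re (qf K F c c))"

lemma qnorm_nonneg: "psd_kernel X K \<Longrightarrow> finite F \<Longrightarrow> F \<subseteq> X \<Longrightarrow> 0 \<le> qnorm K F c"
  unfolding qnorm_def using psd_kernel_Re_nonneg by simp

lemma qnorm_triangle:
  "psd_kernel X K \<Longrightarrow> finite F \<Longrightarrow> F \<subseteq> X \<Longrightarrow> qnorm K F (\<lambda>x. c x + d x) \<le> qnorm K F c + qnorm K F d"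
  unfolding qnorm_def by (rule qf_triangle)

lemma qnorm_scale: "qnorm K F (\<lambda>x. s * c x) = cmod s * qnorm K F c"
proof -
  have "qf K F (\<lambda>x. s * c x) (\<lambda>x. s * c x) = of_real ((cmod s)\<^sup>2) * qf K F c c"
    unfolding qf_linear complex_norm_square by (simp add: mult_ac)
  then have "Re (qf K F (\<lambda>x. s * c x) (\<lambda>x. s * c x)) = (cmod s)\<^sup>2 * Re (qf K F c c)"
    by (simp del: of_real_power)
  then show ?thesis by (simp add: qnorm_def real_sqrt_mult)
qed

lemma qnorm_cong: "(\<And>x. x \<in> F \<Longrightarrow> c x = d x) \<Longrightarrow> qnorm K F c = qnorm K F d"
  unfolding qnorm_def by (metis qf_cong)

definition mult_bound :: "'a set \<Rightarrow> ('a \<Rightarrow> 'a \<Rightarrow> complex) \<Rightarrow> real \<Rightarrow> ('a \<Rightarrow> complex) \<Rightarrow> bool" where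
  "mult_bound X K t \<phi> \<longleftrightarrow>
    psd_kernel X (\<lambda>x y. (complex_of_real (t\<^sup>2) - \<phi> x * cnj (\<phi> y)) * K x y)"

text \<open>A norm bound takes the place of the invariance of the space used in
  \<open>mult_alg\<close>. Values outside \<open>X\<close> are left free, so coordinates and
  constants qualify without truncation.\<close>

definition multiplier :: "'a set \<Rightarrow> ('a \<Rightarrow> 'a \<Rightarrow> complex) \<Rightarrow> ('a \<Rightarrow> complex) \<Rightarrow> bool" where
  "multiplier X K \<phi> \<longleftrightarrow> (\<exists>t\<ge>0. mult_bound X K t \<phi>)"

lemma mult_bound_iff:
  assumes K: "psd_kernel X K" and t: "t \<ge> 0"
  shows "mult_bound X K t \<phi> \<longleftrightarrow>
    (\<forall>F c. finite F \<longrightarrow> F \<subseteq> X \<longrightarrow> qnorm K F (\<lambda>x. \<phi> x * c x) \<le> t * qnorm K F c)"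
proof -
  have "qnorm K F (\<lambda>x. \<phi> x * c x) \<le> t * qnorm K F c \<longleftrightarrow>
      Re (qf K F (\<lambda>x. \<phi> x * c x) (\<lambda>x. \<phi> x * c x)) \<le> t\<^sup>2 * Re (qf K F c c)" for F c
  proof -
    have "t * qnorm K F c = sqrt (t\<^sup>2 * Re (qf K F c c))"
      using t by (simp add: qnorm_def real_sqrt_mult)
    then show ?thesis by (simp add: qnorm_def)
  qed
  then show ?thesis
    unfolding mult_bound_def psd_kernel_multiplier_iff[OF K] by simp
qed

lemma mult_boundD:
  "psd_kernel X K \<Longrightarrow> t \<ge> 0 \<Longrightarrow> mult_bound X K t \<phi> \<Longrightarrow> finite F \<Longrightarrow> F \<subseteq> X \<Longrightarrow>
    qnorm K F (\<lambda>x. \<phi> x * c x) \<le> t * qnorm K F c"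
  by (simp add: mult_bound_iff)

lemma mult_bound_mono:
  assumes K: "psd_kernel X K" and "0 \<le> s" "s \<le> t" "mult_bound X K s \<phi>"
  shows "mult_bound X K t \<phi>"
proof -
  have "qnorm K F (\<lambda>x. \<phi> x * c x) \<le> t * qnorm K F c" if "finite F" "F \<subseteq> X" for F c
    using mult_boundD[OF K \<open>0 \<le> s\<close> assms(4) that, of c] qnorm_nonneg[OF K that, of c] \<open>s \<le> t\<close>
    by (meson mult_right_mono order_trans)
  then show ?thesis using assms by (subst mult_bound_iff) auto
qed

lemma mult_bound_cong:
  "(\<And>x. x \<in> X \<Longrightarrow> \<phi> x = \<psi> x) \<Longrightarrow> mult_bound X K t \<phi> \<longleftrightarrow> mult_bound X K t \<psi>"
  unfolding mult_bound_def by (rule psd_kernel_cong) (simp only:)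

lemma multiplier_cong:
  assumes "\<And>x. x \<in> X \<Longrightarrow> \<phi> x = \<psi> x"
  shows "multiplier X K \<phi> \<longleftrightarrow> multiplier X K \<psi>"
proof -
  have "mult_bound X K t \<phi> = mult_bound X K t \<psi>" for t
    by (rule mult_bound_cong) (rule assms)
  then show ?thesis by (simp only: multiplier_def)
qed

lemma mult_bound_compose:
  "mult_bound X K t \<phi> \<Longrightarrow> f ` Y \<subseteq> X \<Longrightarrow> mult_bound Y (\<lambda>x y. K (f x) (f y)) t (\<lambda>x. \<phi> (f x))"
  unfolding mult_bound_def
  by (drule psd_kernel_compose[of X _ f Y]) auto

lemma multiplier_compose:
  "multiplier X K \<phi> \<Longrightarrow> f ` Y \<subseteq> X \<Longrightarrow> multiplier Y (\<lambda>x y. K (f x) (f y)) (\<lambda>x. \<phi> (f x))"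
  unfolding multiplier_def by (elim exE conjE, intro exI conjI, assumption, rule mult_bound_compose)

section \<open>The algebra of multipliers\<close>

lemma mult_bound_const: "psd_kernel X K \<Longrightarrow> mult_bound X K (cmod s) (\<lambda>x. s)"
  by (simp add: mult_bound_iff qnorm_scale)

lemma mult_bound_add:
  assumes K: "psd_kernel X K" and st: "0 \<le> s" "0 \<le> t"
    and \<phi>: "mult_bound X K s \<phi>" and \<psi>: "mult_bound X K t \<psi>"
  shows "mult_bound X K (s + t) (\<lambda>x. \<phi> x + \<psi> x)"
proof -
  have "qnorm K F (\<lambda>x. (\<phi> x + \<psi> x) * c x) \<le> (s + t) * qnorm K F c" if F: "finite F" "F \<subseteq> X" for F c
  proof -
    have "qnorm K F (\<lambda>x. \<phi> x * c x + \<psi> x * c x) \<le> s * qnorm K F c + t * qnorm K F c"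
      using qnorm_triangle[OF K F, of "\<lambda>x. \<phi> x * c x" "\<lambda>x. \<psi> x * c x"]
        mult_boundD[OF K st(1) \<phi> F, of c] mult_boundD[OF K st(2) \<psi> F, of c] by linarith
    then show ?thesis by (simp add: distrib_right)
  qed
  then show ?thesis using st by (simp add: mult_bound_iff[OF K])
qed

lemma mult_bound_mult:
  assumes K: "psd_kernel X K" and st: "0 \<le> s" "0 \<le> t"
    and \<phi>: "mult_bound X K s \<phi>" and \<psi>: "mult_bound X K t \<psi>"
  shows "mult_bound X K (s * t) (\<lambda>x. \<phi> x * \<psi> x)"
proof -
  have "qnorm K F (\<lambda>x. \<phi> x * \<psi> x * c x) \<le> s * t * qnorm K F c" if F: "finite F" "F \<subseteq> X" for F c
    using mult_boundD[OF K st(1) \<phi> F, of "\<lambda>x. \<psi> x * c x"]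
      mult_left_mono[OF mult_boundD[OF K st(2) \<psi> F, of c] st(1)] by (simp add: mult.assoc)
  then show ?thesis using st by (simp add: mult_bound_iff[OF K])
qed

lemma multiplier_const: "psd_kernel X K \<Longrightarrow> multiplier X K (\<lambda>x. s)"
  unfolding multiplier_def by (intro exI[of _ "cmod s"] conjI mult_bound_const norm_ge_zero)

lemma multiplier_add:
  "psd_kernel X K \<Longrightarrow> multiplier X K \<phi> \<Longrightarrow> multiplier X K \<psi> \<Longrightarrow> multiplier X K (\<lambda>x. \<phi> x + \<psi> x)"
  unfolding multiplier_def
  by (elim exE conjE, intro exI conjI, rule add_nonneg_nonneg, assumption, assumption, rule mult_bound_add)

lemma multiplier_mult:
  "psd_kernel X K \<Longrightarrow> multiplier X K \<phi> \<Longrightarrow> multiplier X K \<psi> \<Longrightarrow> multiplier X K (\<lambda>x. \<phi> x * \<psi> x)"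
  unfolding multiplier_def
  by (elim exE conjE, intro exI conjI, rule mult_nonneg_nonneg, assumption, assumption, rule mult_bound_mult)

lemma multiplier_diff:
  assumes "psd_kernel X K" "multiplier X K \<phi>" "multiplier X K \<psi>"
  shows "multiplier X K (\<lambda>x. \<phi> x - \<psi> x)"
  using multiplier_add[OF assms(1,2) multiplier_mult[OF assms(1) multiplier_const[OF assms(1)] assms(3)], of "-1"]
  by simp

lemma multiplier_sum:
  assumes "psd_kernel X K"
  shows "(\<And>i. i \<in> I \<Longrightarrow> multiplier X K (\<phi> i)) \<Longrightarrow> multiplier X K (\<lambda>x. \<Sum>i\<in>I. \<phi> i x)"
  by (induction I rule: infinite_finite_induct) (auto intro: multiplier_const multiplier_add assms)

text \<open>The vector \<open>d = c / (1 - \<phi>)\<close> solves \<open>d = c + \<phi> d\<close>,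
  whence its norm is at most that of \<open>c\<close> plus \<open>t\<close> times its own. No
  Neumann series is summed.\<close>

lemma multiplier_resolvent:
  assumes K: "psd_kernel X K" and t: "0 \<le> t" "t < 1" and \<phi>: "mult_bound X K t \<phi>"
    and nz: "\<And>x. x \<in> X \<Longrightarrow> \<phi> x \<noteq> 1"
  shows "multiplier X K (\<lambda>x. 1 / (1 - \<phi> x))"
proof -
  have "qnorm K F (\<lambda>x. 1 / (1 - \<phi> x) * c x) \<le> 1 / (1 - t) * qnorm K F c"
    if F: "finite F" "F \<subseteq> X" for F c
  proof -
    define d where "d x = 1 / (1 - \<phi> x) * c x" for x
    have "qnorm K F d = qnorm K F (\<lambda>x. c x + \<phi> x * d x)"
    proof (rule qnorm_cong)
      fix x assume "x \<in> F"
      then have "1 - \<phi> x \<noteq> 0" using nz F by auto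
      then show "d x = c x + \<phi> x * d x" by (simp add: d_def field_simps)
    qed
    also have "\<dots> \<le> qnorm K F c + t * qnorm K F d"
      using qnorm_triangle[OF K F, of c "\<lambda>x. \<phi> x * d x"] mult_boundD[OF K t(1) \<phi> F, of d] by linarith
    finally have "(1 - t) * qnorm K F d \<le> qnorm K F c" by (simp add: algebra_simps)
    then have "qnorm K F d \<le> 1 / (1 - t) * qnorm K F c" using t by (simp add: field_simps)
    then show ?thesis unfolding d_def .
  qed
  then have "mult_bound X K (1 / (1 - t)) (\<lambda>x. 1 / (1 - \<phi> x))"
    using t by (subst mult_bound_iff[OF K]) auto
  then show ?thesis using t unfolding multiplier_def by (intro exI[of _ "1 / (1 - t)"]) auto
qed

text \<open>Since \<open>1 - \<langle>b x, b y\<rangle>\<close> times \<open>dk b x y\<close> is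
  one, the kernel in question is the constant \<open>(norm v)^2\<close> plus the Lagrange
  kernel.\<close>

lemma mult_bound_cinner:
  assumes b: "\<And>x. x \<in> X \<Longrightarrow> norm (b x) < 1"
  shows "mult_bound X (dk b) (norm v) (\<lambda>x. cinner (b x) v)"
proof -
  have "psd_kernel X (\<lambda>x y. of_real ((norm v)\<^sup>2) * 1 + (of_real ((norm v)\<^sup>2) * cinner (b x) (b y)
      - cinner (b x) v * cinner v (b y)) * dk b x y)"
    by (intro psd_kernel_add psd_kernel_scale psd_kernel_lagrange_mult psd_kernel_dk b
        psd_kernel_rank_one[of X "\<lambda>_. 1", simplified]) (simp_all del: of_real_power)
  moreover have "of_real ((norm v)\<^sup>2) * 1 + (of_real ((norm v)\<^sup>2) * cinner (b x) (b y)
      - cinner (b x) v * cinner v (b y)) * dk b x y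
    = (of_real ((norm v)\<^sup>2) - cinner (b x) v * cnj (cinner (b y) v)) * dk b x y"
    if "x \<in> X" "y \<in> X" for x y
  proof -
    have "1 - cinner (b x) (b y) \<noteq> 0"
      using one_minus_cinner_neq_0[of "b x" "b y"] b that by (simp add: less_imp_le)
    then show ?thesis by (simp add: dk_def cinner_commute[of v] field_simps)
  qed
  ultimately show ?thesis unfolding mult_bound_def by (simp only: cong: psd_kernel_cong)
qed

lemma multiplier_cinner:
  "(\<And>x. x \<in> X \<Longrightarrow> norm (b x) < 1) \<Longrightarrow> multiplier X (dk b) (\<lambda>x. cinner (b x) v)"
  unfolding multiplier_def by (intro exI[of _ "norm v"] conjI mult_bound_cinner norm_ge_zero)

lemma cinner_axis_right: "cinner z (axis i 1) = z $ i"
  by (simp add: cinner_def axis_def if_distrib sum.delta cong: if_cong)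

lemma multiplier_coordinate:
  "(\<And>x. x \<in> X \<Longrightarrow> norm (b x) < 1) \<Longrightarrow> multiplier X (dk b) (\<lambda>x. b x $ i)"
  using multiplier_cinner[of X b "axis i 1"] by (simp add: cinner_axis_right)

text \<open>As \<open>\<phi> - \<phi> z\<close> vanishes at \<open>z\<close>, the Schur complement
  at \<open>z\<close> of its multiplier inequality subtracts only a multiple of the rank-one kernel
  of the kernel function at \<open>z\<close>. Multiplying by \<open>w x * cnj (w y)\<close> clears
  that kernel function and leaves the Pick defect; this is the origin of the factor
  \<open>1 - cinner (b x) (b z)\<close>.\<close>

lemma multiplier_gleason:
  fixes b :: "'a \<Rightarrow> complex ^ 'n::finite"
  assumes b: "\<And>x. x \<in> X \<Longrightarrow> norm (b x) < 1" and z: "z \<in> X"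
    and \<phi>: "multiplier X (dk b) \<phi>"
  shows "\<exists>\<psi>. (\<forall>x\<in>X. (\<phi> x - \<phi> z) * (1 - cinner (b x) (b z)) = (\<Sum>i\<in>UNIV. (b x $ i - b z $ i) * \<psi> i x)) \<and>
    (\<forall>i. multiplier X (dk b) (\<psi> i))"
proof -
  define l where "l = b z"
  have l: "norm l < 1" using b z by (simp add: l_def)
  have K: "psd_kernel X (dk b)" by (rule psd_kernel_dk[OF b])
  define \<phi>0 where "\<phi>0 x = \<phi> x - \<phi> z" for x
  define w where "w x = 1 - cinner (b x) l" for x
  define a where "a x = \<phi>0 x * w x" for x
  obtain s where s: "s \<ge> 0" "mult_bound X (dk b) s \<phi>0"
    using multiplier_diff[OF K \<phi> multiplier_const[OF K]] unfolding multiplier_def \<phi>0_def by blast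
  \<comment> \<open>Strict positivity of \<open>t\<close> makes the corner entry
    \<open>t^2 * dk b z z\<close> of the Schur complement nonzero.\<close>
  define t where "t = s + 1"
  have t: "t > 0" "t \<ge> 0" using s by (auto simp: t_def)
  have "mult_bound X (dk b) t \<phi>0" by (rule mult_bound_mono[OF K s(1) _ s(2)]) (simp add: t_def)
  then have 1: "psd_kernel X (\<lambda>x y. (complex_of_real (t\<^sup>2) - \<phi>0 x * cnj (\<phi>0 y)) * dk b x y)"
    by (simp only: mult_bound_def)
  have z0: "\<phi>0 z = 0" by (simp add: \<phi>0_def)
  have kz: "dk b z z \<noteq> 0" using b z by (intro dk_neq_0) auto
  define num where "num x y = (1 - cinner (b x) l) * (1 - cinner l (b y))
    - of_real (1 - (norm l)\<^sup>2) * (1 - cinner (b x) (b y))" for x y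
  define P where "P x y = (complex_of_real (t\<^sup>2) - \<phi>0 x * cnj (\<phi>0 y)) * dk b x y
    - dk b x z * (of_real (t\<^sup>2) * dk b z y) / dk b z z" for x y
  have "psd_kernel X P"
    using psd_kernel_schur_complement[OF 1 z] kz t by (simp add: z0 P_def[abs_def])
  then have 2: "psd_kernel X (\<lambda>x y. w x * cnj (w y) * P x y)" by (rule psd_kernel_rank_one_mult)
  have eq: "w x * cnj (w y) * P x y = (of_real (t\<^sup>2) * num x y - a x * cnj (a y)) * dk b x y"
    if "x \<in> X" "y \<in> X" for x y
  proof -
    have w: "w x \<noteq> 0" "cnj (w y) \<noteq> 0"
      unfolding w_def using one_minus_cinner_neq_0[OF b less_imp_le[OF l]] that by simp_all
    have 3: "1 - cinner (b x) (b y) \<noteq> 0" using one_minus_cinner_neq_0[of "b x" "b y"] b that by (simp add: less_imp_le)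
    have k: "dk b x z = 1 / w x" "dk b z y = 1 / cnj (w y)"
      by (simp_all add: dk_def w_def l_def[symmetric] cinner_commute[of l])
    have kzz: "1 / dk b z z = of_real (1 - (norm l)\<^sup>2)"
      by (simp add: dk_def l_def[symmetric] cinner_self)
    have "w x * cnj (w y) * P x y = (of_real (t\<^sup>2) * (w x * cnj (w y)) - a x * cnj (a y)) * dk b x y
        - of_real (t\<^sup>2) * (1 / dk b z z) * (w x * dk b x z) * (cnj (w y) * dk b z y)"
      by (simp add: P_def a_def algebra_simps)
    also have "\<dots> = (of_real (t\<^sup>2) * (w x * cnj (w y)) - a x * cnj (a y)) * dk b x y
        - of_real (t\<^sup>2) * of_real (1 - (norm l)\<^sup>2) * ((1 - cinner (b x) (b y)) * dk b x y)"
    proof -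
      have "w x * dk b x z = 1" "cnj (w y) * dk b z y = 1" "(1 - cinner (b x) (b y)) * dk b x y = 1"
        unfolding k using w 3 by (simp_all add: dk_def)
      then show ?thesis unfolding kzz by (simp only: mult_1_right)
    qed
    also have "\<dots> = (of_real (t\<^sup>2) * num x y - a x * cnj (a y)) * dk b x y"
      by (simp add: num_def w_def cinner_commute[of l] algebra_simps)
    finally show ?thesis .
  qed
  from 2 have 3: "psd_kernel X (\<lambda>x y. (of_real (t\<^sup>2) * num x y - a x * cnj (a y)) * dk b x y)"
    by (simp only: eq cong: psd_kernel_cong)
  define A where "A x = complex_of_real t *s (b x - l)" for x
  have AA: "cinner (A x) (A y) = of_real (t\<^sup>2) * cinner (b x - l) (b y - l)" for x y
    unfolding A_def cinner_scale_left cinner_scale_right by (simp add: power2_eq_square)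
  \<comment> \<open>The Lagrange kernel is exactly what the Pick defect lacks to become
    \<open>cinner (b x - l) (b y - l)\<close>, the form required for Leech factorisation through
    \<open>A\<close>.\<close>
  have "psd_kernel X (\<lambda>x y. (of_real (t\<^sup>2) * num x y - a x * cnj (a y)) * dk b x y
    + of_real (t\<^sup>2) * ((of_real ((norm l)\<^sup>2) * cinner (b x - l) (b y - l)
      - cinner (b x - l) l * cinner l (b y - l)) * dk b x y))"
    by (intro psd_kernel_add 3 psd_kernel_scale psd_kernel_lagrange_mult K) (simp del: of_real_power)
  also have "(\<lambda>x y. (of_real (t\<^sup>2) * num x y - a x * cnj (a y)) * dk b x y
    + of_real (t\<^sup>2) * ((of_real ((norm l)\<^sup>2) * cinner (b x - l) (b y - l)
      - cinner (b x - l) l * cinner l (b y - l)) * dk b x y))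
    = (\<lambda>x y. (cinner (A x) (A y) - a x * cnj (a y)) * dk b x y)"
    unfolding num_def pick_defect AA by (intro ext) (simp add: algebra_simps)
  finally obtain \<psi> where \<psi>: "\<And>x. x \<in> X \<Longrightarrow> a x = (\<Sum>i\<in>UNIV. A x $ i * \<psi> i x)"
    "\<And>i. psd_kernel X (\<lambda>x y. (1 - \<psi> i x * cnj (\<psi> i y)) * dk b x y)"
    using leech[where X = X and b = b and A = A and a = a] b by blast
  have "mult_bound X (dk b) 1 (\<psi> i)" for i using \<psi>(2)[of i] by (simp add: mult_bound_def)
  then have m\<psi>: "multiplier X (dk b) (\<psi> i)" for i
    unfolding multiplier_def by (intro exI[of _ 1]) simp
  show ?thesis
  proof (intro exI[of _ "\<lambda>i x. of_real t * \<psi> i x"] conjI ballI allI)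
    show "multiplier X (dk b) (\<lambda>x. of_real t * \<psi> i x)" for i
      by (intro multiplier_mult multiplier_const K m\<psi>)
    show "(\<phi> x - \<phi> z) * (1 - cinner (b x) (b z)) = (\<Sum>i\<in>UNIV. (b x $ i - b z $ i) * (of_real t * \<psi> i x))"
      if "x \<in> X" for x
      using \<psi>(1)[OF that] by (simp add: a_def \<phi>0_def w_def l_def A_def mult_ac right_diff_distrib)
  qed
qed

section \<open>Multiplication operators are bounded\<close>

lemma in_rkhs_iff:
  assumes K: "psd_kernel X K"
  shows "in_rkhs X K h \<longleftrightarrow>
    (\<exists>t\<ge>0. \<forall>F c. finite F \<longrightarrow> F \<subseteq> X \<longrightarrow> cmod (\<Sum>x\<in>F. c x * h x) \<le> t * qnorm K F c)"
proof -
  \<comment> \<open>The constant in \<open>in_rkhs\<close> may be negative, hence the absolute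
    value.\<close>
  have *: "psd_kernel X (\<lambda>z w. complex_of_real (t\<^sup>2) * K z w - h z * cnj (h w)) \<longleftrightarrow>
      (\<forall>F c. finite F \<longrightarrow> F \<subseteq> X \<longrightarrow> cmod (\<Sum>x\<in>F. c x * h x) \<le> \<bar>t\<bar> * qnorm K F c)" for t
  proof -
    have P: "psd_kernel X (\<lambda>z w. complex_of_real (t\<^sup>2) * K z w)"
      by (intro psd_kernel_scale K) (simp del: of_real_power)
    have "(cmod (\<Sum>x\<in>F. c x * h x))\<^sup>2 \<le> Re (qf (\<lambda>z w. complex_of_real (t\<^sup>2) * K z w) F c c) \<longleftrightarrow>
        cmod (\<Sum>x\<in>F. c x * h x) \<le> \<bar>t\<bar> * qnorm K F c" if F: "finite F" "F \<subseteq> X" for F c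
    proof -
      have nn: "0 \<le> \<bar>t\<bar> * qnorm K F c" using qnorm_nonneg[OF K F] by simp
      have "Re (qf (\<lambda>z w. complex_of_real (t\<^sup>2) * K z w) F c c) = (\<bar>t\<bar> * qnorm K F c)\<^sup>2"
        using psd_kernel_Re_nonneg[OF K F, of c]
        by (simp add: qf_kernel_scale qnorm_def power_mult_distrib del: of_real_power)
      then show ?thesis using nn by (simp add: power_mono_iff)
    qed
    then show ?thesis unfolding psd_kernel_minus_rank_one_iff[OF P] by blast
  qed
  show ?thesis
    unfolding in_rkhs_def *
  proof
    assume "\<exists>t. \<forall>F c. finite F \<longrightarrow> F \<subseteq> X \<longrightarrow> cmod (\<Sum>x\<in>F. c x * h x) \<le> \<bar>t\<bar> * qnorm K F c"
    then obtain t where "\<forall>F c. finite F \<longrightarrow> F \<subseteq> X \<longrightarrow> cmod (\<Sum>x\<in>F. c x * h x) \<le> \<bar>t\<bar> * qnorm K F c" ..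
    then show "\<exists>t\<ge>0. \<forall>F c. finite F \<longrightarrow> F \<subseteq> X \<longrightarrow> cmod (\<Sum>x\<in>F. c x * h x) \<le> t * qnorm K F c"
      by (intro exI[of _ "\<bar>t\<bar>"]) simp
  next
    assume "\<exists>t\<ge>0. \<forall>F c. finite F \<longrightarrow> F \<subseteq> X \<longrightarrow> cmod (\<Sum>x\<in>F. c x * h x) \<le> t * qnorm K F c"
    then obtain t where "t \<ge> 0"
      "\<forall>F c. finite F \<longrightarrow> F \<subseteq> X \<longrightarrow> cmod (\<Sum>x\<in>F. c x * h x) \<le> t * qnorm K F c" by blast
    then show "\<exists>t. \<forall>F c. finite F \<longrightarrow> F \<subseteq> X \<longrightarrow> cmod (\<Sum>x\<in>F. c x * h x) \<le> \<bar>t\<bar> * qnorm K F c"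
      by (intro exI[of _ t]) simp
  qed
qed

text \<open>Ratio \<open>1/3\<close> makes the tail after the term of index \<open>n\<close> at most
  half of the bound on that term, so in a gliding hump the current term outweighs all later
  ones.\<close>

lemma geometric_tail_bound:
  fixes f :: "nat \<Rightarrow> complex"
  assumes f: "\<And>k. norm (f k) \<le> (1/3) ^ k * B"
  shows "summable f" and "norm (suminf f - (\<Sum>k<n. f k)) \<le> (1/3) ^ n * B * (3/2)"
proof -
  have g: "(\<lambda>k. (1/3) ^ k * B) sums (3/2 * B)"
    using sums_mult2[OF geometric_sums[of "1/3::real"], of B] by simp
  show sf: "summable f"
    by (rule summable_comparison_test'[OF sums_summable[OF g]]) (use f in auto)
  have g': "(\<lambda>k. (1/3) ^ n * ((1/3) ^ k * B)) sums ((1/3) ^ n * (3/2 * B))"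
    by (rule sums_mult[OF g])
  have "norm (\<Sum>k. f (k + n)) \<le> (\<Sum>k. (1/3) ^ n * ((1/3) ^ k * B))"
    by (rule norm_suminf_le[OF _ sums_summable[OF g']])
      (use f[of "_ + n"] in \<open>simp add: power_add mult_ac\<close>)
  then show "norm (suminf f - (\<Sum>k<n. f k)) \<le> (1/3) ^ n * B * (3/2)"
    using suminf_minus_initial_segment[OF sf, of n] sums_unique[OF g'] by simp
qed

text \<open>Cauchy-Schwarz for vectors supported on different point sets, both extended by zero to
  the union. It says that a combination of kernel functions is an element of the space of norm at
  most \<open>qnorm K G d\<close>.\<close>

lemma kernel_combination_bound:
  assumes K: "psd_kernel X K" and F: "finite F" "F \<subseteq> X" and G: "finite G" "G \<subseteq> X"
  shows "cmod (\<Sum>x\<in>F. c x * (\<Sum>y\<in>G. cnj (d y) * K x y)) \<le> qnorm K F c * qnorm K G d"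
proof -
  define H where "H = F \<union> G"
  define c' where "c' x = (if x \<in> F then c x else 0)" for x
  define d' where "d' x = (if x \<in> G then d x else 0)" for x
  have H: "finite H" "H \<subseteq> X" using F G by (auto simp: H_def)
  have c: "qf K H c' c' = qf K F c c"
  proof -
    have "qf K H c' c' = qf K F c' c'"
      by (rule qf_mono_neutral) (use H in \<open>auto simp: H_def c'_def\<close>)
    also have "\<dots> = qf K F c c" by (rule qf_cong) (auto simp: c'_def)
    finally show ?thesis .
  qed
  have d: "qf K H d' d' = qf K G d d"
  proof -
    have "qf K H d' d' = qf K G d' d'"
      by (rule qf_mono_neutral) (use H in \<open>auto simp: H_def d'_def\<close>)
    also have "\<dots> = qf K G d d" by (rule qf_cong) (auto simp: d'_def)
    finally show ?thesis .
  qed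
  have "qf K H c' d' = (\<Sum>x\<in>F. \<Sum>y\<in>H. c' x * cnj (d' y) * K x y)"
    unfolding qf_def by (rule sum.mono_neutral_right) (use H in \<open>auto simp: H_def c'_def\<close>)
  also have "\<dots> = (\<Sum>x\<in>F. \<Sum>y\<in>G. c' x * cnj (d' y) * K x y)"
    by (intro sum.cong refl sum.mono_neutral_right) (use H in \<open>auto simp: H_def d'_def\<close>)
  also have "\<dots> = (\<Sum>x\<in>F. c x * (\<Sum>y\<in>G. cnj (d y) * K x y))"
    by (simp add: c'_def d'_def sum_distrib_left mult.assoc)
  finally have e: "(\<Sum>x\<in>F. c x * (\<Sum>y\<in>G. cnj (d y) * K x y)) = qf K H c' d'" ..
  show ?thesis unfolding e qnorm_def real_sqrt_mult[symmetric]
    using qf_cauchy_schwarz[OF K H, of c' d'] unfolding c d by (intro real_le_rsqrt)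
qed

text \<open>Uniform boundedness by a gliding hump: if \<open>\<phi>\<close> has no multiplier bound, a signed series
  \<open>\<Sum> \<plusminus>3\<^sup>-\<^sup>n r\<^sub>n\<close> of unit vectors is an element \<open>h\<close> of the space with \<open>\<phi> h\<close> outside it.\<close>
lemma mult_alg_multiplier:
  assumes K: "psd_kernel X K" and \<phi>: "\<phi> \<in> mult_alg X K"
  shows "multiplier X K \<phi>"
proof (rule ccontr)
  assume not: "\<not> multiplier X K \<phi>"
  have "\<exists>F c. finite F \<and> F \<subseteq> X \<and> qnorm K F (\<lambda>x. \<phi> x * c x) > 2 * real (Suc n) * 3 ^ n * qnorm K F c" for n
  proof (rule ccontr)
    assume "\<not> ?thesis"
    then have "mult_bound X K (2 * real (Suc n) * 3 ^ n) \<phi>"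
      by (subst mult_bound_iff[OF K]) (auto simp: not_less)
    moreover have "0 \<le> 2 * real (Suc n) * 3 ^ n" by simp
    ultimately show False using not unfolding multiplier_def by blast
  qed
  then obtain F c where F: "finite (F n)" "F n \<subseteq> X"
    and big: "qnorm K (F n) (\<lambda>x. \<phi> x * c n x) > 2 * real (Suc n) * 3 ^ n * qnorm K (F n) (c n)" for n
    by metis
  define d where "d n x = \<phi> x * c n x" for n x
  define m where "m n = qnorm K (F n) (d n)" for n
  define a where "a n = qnorm K (F n) (c n)" for n
  have a: "a n \<ge> 0" for n unfolding a_def by (rule qnorm_nonneg[OF K F])
  have ma: "m n > 2 * real (Suc n) * 3 ^ n * a n" for n
    using big[of n] by (simp add: m_def a_def d_def[abs_def])
  have m: "m n > 0" for n
    by (rule le_less_trans[OF _ ma]) (use a in simp)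
  \<comment> \<open>A normalised vector on which pairing with \<open>d n\<close> attains its norm
    \<open>m n\<close>.\<close>
  define r where "r n x = (\<Sum>y\<in>F n. cnj (d n y) * K x y) / of_real (m n)" for n x
  have r_bound: "cmod (\<Sum>x\<in>G. e x * r n x) \<le> qnorm K G e" if G: "finite G" "G \<subseteq> X" for G e n
  proof -
    have "(\<Sum>x\<in>G. e x * r n x) = (\<Sum>x\<in>G. e x * (\<Sum>y\<in>F n. cnj (d n y) * K x y)) / of_real (m n)"
      by (simp add: r_def sum_divide_distrib[where A = G])
    moreover have "cmod (\<Sum>x\<in>G. e x * (\<Sum>y\<in>F n. cnj (d n y) * K x y)) \<le> qnorm K G e * m n"
      unfolding m_def by (rule kernel_combination_bound[OF K G F])
    ultimately show ?thesis using m[of n] by (simp add: norm_divide divide_le_eq)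
  qed
  have r_diag: "(\<Sum>x\<in>F n. d n x * r n x) = of_real (m n)" for n
  proof -
    have "qf K (F n) (d n) (d n) = of_real ((m n)\<^sup>2)"
      using psd_kernel_Im_zero[OF K F] psd_kernel_Re_nonneg[OF K F]
      by (simp add: complex_eq_iff m_def qnorm_def del: of_real_power)
    moreover have "(\<Sum>x\<in>F n. d n x * r n x) = qf K (F n) (d n) (d n) / of_real (m n)"
      by (simp add: r_def qf_def sum_divide_distrib sum_distrib_left mult_ac)
    ultimately show ?thesis using m[of n] by (simp add: power2_eq_square)
  qed
  \<comment> \<open>The two candidates \<open>L s + (1/3)^n m\<close> and
    \<open>L s - (1/3)^n m\<close>, with \<open>L\<close> the pairing with \<open>d n\<close>, are
    \<open>2 (1/3)^n m\<close> apart, so one of them has modulus at least \<open>(1/3)^n m\<close>;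
    the sign selects it.\<close>
  define \<epsilon> where "\<epsilon> n s = (if cmod ((\<Sum>x\<in>F n. d n x * s x) + of_real ((1/3) ^ n * m n)) \<ge> (1/3) ^ n * m n
    then 1 else - 1 :: complex)" for n s
  define S where "S = rec_nat (\<lambda>_. 0) (\<lambda>n s x. s x + \<epsilon> n s * (1/3) ^ n * r n x)"
  define u where "u n x = \<epsilon> n (S n) * (1/3) ^ n * r n x" for n x
  have \<epsilon>: "cmod (\<epsilon> n s) = 1" for n s by (simp add: \<epsilon>_def)
  have S_Suc: "S (Suc n) x = S n x + \<epsilon> n (S n) * (1/3) ^ n * r n x" for n x
    by (simp add: S_def)
  have S_sum: "S n x = (\<Sum>k<n. u k x)" for n x
    by (induction n) (simp_all add: S_def u_def)
  have u_bound: "cmod (\<Sum>x\<in>G. e x * u n x) \<le> (1/3) ^ n * qnorm K G e" if G: "finite G" "G \<subseteq> X" for G e n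
  proof -
    have "(\<Sum>x\<in>G. e x * u n x) = \<epsilon> n (S n) * (1/3) ^ n * (\<Sum>x\<in>G. e x * r n x)"
      by (simp add: u_def sum_distrib_left mult_ac)
    then show ?thesis using r_bound[OF G, of e n] by (simp add: norm_mult \<epsilon> norm_power norm_divide)
  qed
  have u_summable: "summable (\<lambda>n. u n x)" if "x \<in> X" for x
    by (rule geometric_tail_bound[of _ "qnorm K {x} (\<lambda>_. 1)"])
      (use u_bound[of "{x}" "\<lambda>_. 1"] that in simp)
  define h where "h x = (\<Sum>n. u n x)" for x
  have tail: "cmod ((\<Sum>x\<in>G. e x * h x) - (\<Sum>x\<in>G. e x * S n x)) \<le> (1/3) ^ n * qnorm K G e * (3/2)"
    if G: "finite G" "G \<subseteq> X" for G e n
  proof -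
    have "(\<lambda>n. \<Sum>x\<in>G. e x * u n x) sums (\<Sum>x\<in>G. e x * h x)"
      unfolding h_def by (intro sums_sum sums_mult summable_sums u_summable) (use G in auto)
    then have "(\<Sum>x\<in>G. e x * h x) = (\<Sum>n. \<Sum>x\<in>G. e x * u n x)" by (rule sums_unique)
    moreover have "(\<Sum>x\<in>G. e x * S n x) = (\<Sum>k<n. \<Sum>x\<in>G. e x * u k x)"
      unfolding S_sum sum_distrib_left by (rule sum.swap)
    ultimately show ?thesis
      using geometric_tail_bound(2)[of "\<lambda>n. \<Sum>x\<in>G. e x * u n x" "qnorm K G e" n] u_bound[OF G] by simp
  qed
  have "in_rkhs X K h"
    unfolding in_rkhs_iff[OF K]
    by (rule exI[of _ "3/2"]) (use tail[where n = 0] in \<open>auto simp: S_def mult.commute\<close>)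
  then have "in_rkhs X K (\<lambda>x. \<phi> x * h x)" using \<phi> by (simp add: mult_alg_def)
  then obtain t where t: "\<And>G e. finite G \<Longrightarrow> G \<subseteq> X \<Longrightarrow> cmod (\<Sum>x\<in>G. e x * (\<phi> x * h x)) \<le> t * qnorm K G e"
    unfolding in_rkhs_iff[OF K] by blast
  obtain n where n: "t < real n" using reals_Archimedean2 by blast
  define L where "L s = (\<Sum>x\<in>F n. d n x * s x)" for s
  have "L (S (Suc n)) = L (S n) + \<epsilon> n (S n) * of_real ((1/3) ^ n * m n)"
  proof -
    have "L (S (Suc n)) = L (S n) + \<epsilon> n (S n) * (1/3) ^ n * (\<Sum>x\<in>F n. d n x * r n x)"
      unfolding L_def S_Suc sum_distrib_left by (simp add: distrib_left sum.distrib mult_ac)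
    then show ?thesis by (simp add: r_diag)
  qed
  then have "cmod (L (S (Suc n))) \<ge> (1/3) ^ n * m n"
  proof (cases "cmod (L (S n) + of_real ((1/3) ^ n * m n)) \<ge> (1/3) ^ n * m n")
    case False
    have "2 * of_real ((1/3) ^ n * m n) = (L (S n) + of_real ((1/3) ^ n * m n))
        - (L (S n) + (-1) * of_real ((1/3) ^ n * m n))" by simp
    then have "2 * ((1/3) ^ n * m n) \<le> cmod (L (S n) + of_real ((1/3) ^ n * m n))
        + cmod (L (S n) + (-1) * of_real ((1/3) ^ n * m n))"
      using norm_triangle_ineq4[of "L (S n) + of_real ((1/3) ^ n * m n)"
          "L (S n) + (-1) * of_real ((1/3) ^ n * m n)"] m[of n]
      by (metis abs_of_pos mult_pos_pos norm_mult norm_numeral norm_of_real zero_less_divide_1_iff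
          zero_less_numeral zero_less_power)
    moreover assume "L (S (Suc n)) = L (S n) + \<epsilon> n (S n) * of_real ((1/3) ^ n * m n)"
    ultimately show ?thesis using False unfolding \<epsilon>_def L_def[symmetric] by simp
  qed (simp add: \<epsilon>_def L_def)
  moreover have "cmod (L h - L (S (Suc n))) \<le> (1/3) ^ Suc n * m n * (3/2)"
    unfolding L_def m_def by (rule tail[OF F])
  moreover have "cmod (L (S (Suc n))) \<le> cmod (L h) + cmod (L h - L (S (Suc n)))"
    by (metis norm_minus_commute norm_triangle_sub)
  ultimately have "(1/3) ^ n * m n / 2 \<le> cmod (L h)" by simp
  \<comment> \<open>The factor \<open>\<phi>\<close> inside \<open>d n\<close> moves over to
    \<open>h\<close>. So the hump, still at least half its size, is bounded by the norm of
    \<open>\<phi> h\<close> times \<open>a n\<close>; the constant in the choice of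
    \<open>c n\<close> was made to contradict this.\<close>
  also have "L h = (\<Sum>x\<in>F n. c n x * (\<phi> x * h x))" by (simp add: L_def d_def mult_ac)
  also have "cmod \<dots> \<le> t * a n" unfolding a_def by (rule t[OF F])
  also have "\<dots> \<le> real (Suc n) * a n" using n a[of n] by (intro mult_right_mono) auto
  finally have "m n \<le> 2 * real (Suc n) * 3 ^ n * a n" by (simp add: field_simps)
  with ma[of n] show False by simp
qed

lemma mult_alg_iff:
  assumes K: "psd_kernel X K"
  shows "\<phi> \<in> mult_alg X K \<longleftrightarrow> (\<forall>z. z \<notin> X \<longrightarrow> \<phi> z = 0) \<and> multiplier X K \<phi>"
proof (intro iffI conjI)
  assume "(\<forall>z. z \<notin> X \<longrightarrow> \<phi> z = 0) \<and> multiplier X K \<phi>"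
  then obtain t where \<phi>0: "\<forall>z. z \<notin> X \<longrightarrow> \<phi> z = 0" and t: "t \<ge> 0" "mult_bound X K t \<phi>"
    by (auto simp: multiplier_def)
  have "in_rkhs X K (\<lambda>z. \<phi> z * h z)" if "in_rkhs X K h" for h
  proof -
    obtain s where s: "s \<ge> 0"
      "\<And>F c. finite F \<Longrightarrow> F \<subseteq> X \<Longrightarrow> cmod (\<Sum>x\<in>F. c x * h x) \<le> s * qnorm K F c"
      using \<open>in_rkhs X K h\<close> unfolding in_rkhs_iff[OF K] by blast
    have "cmod (\<Sum>x\<in>F. c x * (\<phi> x * h x)) \<le> s * t * qnorm K F c" if F: "finite F" "F \<subseteq> X" for F c
    proof -
      have "cmod (\<Sum>x\<in>F. \<phi> x * c x * h x) \<le> s * qnorm K F (\<lambda>x. \<phi> x * c x)" by (rule s(2)[OF F])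
      also have "\<dots> \<le> s * (t * qnorm K F c)" by (intro mult_left_mono mult_boundD[OF K t F] s(1))
      finally show ?thesis by (simp add: mult_ac)
    qed
    then show ?thesis
      unfolding in_rkhs_iff[OF K] by (intro exI[of _ "s * t"]) (use s(1) t(1) in auto)
  qed
  with \<phi>0 show "\<phi> \<in> mult_alg X K" by (simp add: mult_alg_def)
qed (use mult_alg_multiplier[OF K] in \<open>auto simp: mult_alg_def\<close>)

section \<open>Characters of the multiplier algebra\<close>

definition restrict0 :: "'a set \<Rightarrow> ('a \<Rightarrow> complex) \<Rightarrow> 'a \<Rightarrow> complex" where
  "restrict0 X \<phi> = (\<lambda>x. if x \<in> X then \<phi> x else 0)"

lemma restrict0_in_mult_alg:
  assumes "psd_kernel X K" "multiplier X K \<phi>"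
  shows "restrict0 X \<phi> \<in> mult_alg X K"
proof -
  have "multiplier X K (restrict0 X \<phi>) \<longleftrightarrow> multiplier X K \<phi>"
    by (rule multiplier_cong) (simp add: restrict0_def)
  then show ?thesis using assms by (simp add: mult_alg_iff restrict0_def)
qed

lemma restrict0_id: "\<phi> \<in> mult_alg X K \<Longrightarrow> restrict0 X \<phi> = \<phi>"
  by (auto simp: mult_alg_def restrict0_def)

text \<open>The algebraic laws are imposed only at multipliers, and the last clause lets functions
  be replaced by others with the same values on \<open>X\<close>. Continuity is not
  demanded.\<close>

definition character :: "'a set \<Rightarrow> ('a \<Rightarrow> 'a \<Rightarrow> complex) \<Rightarrow> (('a \<Rightarrow> complex) \<Rightarrow> complex) \<Rightarrow> bool" where
  "character X K \<rho> \<longleftrightarrow>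
    (\<forall>\<phi> \<psi>. multiplier X K \<phi> \<longrightarrow> multiplier X K \<psi> \<longrightarrow> \<rho> (\<lambda>x. \<phi> x + \<psi> x) = \<rho> \<phi> + \<rho> \<psi>) \<and>
    (\<forall>\<phi> \<psi>. multiplier X K \<phi> \<longrightarrow> multiplier X K \<psi> \<longrightarrow> \<rho> (\<lambda>x. \<phi> x * \<psi> x) = \<rho> \<phi> * \<rho> \<psi>) \<and>
    (\<forall>s. \<rho> (\<lambda>x. s) = s) \<and>
    (\<forall>\<phi> \<psi>. (\<forall>x\<in>X. \<phi> x = \<psi> x) \<longrightarrow> \<rho> \<phi> = \<rho> \<psi>)"

context
  fixes X :: "'a set" and K \<rho>
  assumes K: "psd_kernel X K" and \<rho>: "character X K \<rho>"
begin

lemma character_add: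
  "multiplier X K \<phi> \<Longrightarrow> multiplier X K \<psi> \<Longrightarrow> \<rho> (\<lambda>x. \<phi> x + \<psi> x) = \<rho> \<phi> + \<rho> \<psi>"
  and character_mult:
  "multiplier X K \<phi> \<Longrightarrow> multiplier X K \<psi> \<Longrightarrow> \<rho> (\<lambda>x. \<phi> x * \<psi> x) = \<rho> \<phi> * \<rho> \<psi>"
  and character_const: "\<rho> (\<lambda>x. s) = s"
  and character_cong: "(\<And>x. x \<in> X \<Longrightarrow> \<phi> x = \<psi> x) \<Longrightarrow> \<rho> \<phi> = \<rho> \<psi>"
  using \<rho> by (simp_all add: character_def)

lemma character_diff:
  assumes "multiplier X K \<phi>" "multiplier X K \<psi>"
  shows "\<rho> (\<lambda>x. \<phi> x - \<psi> x) = \<rho> \<phi> - \<rho> \<psi>"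
proof -
  have 1: "multiplier X K (\<lambda>x. - 1 * \<psi> x)"
    by (intro multiplier_mult multiplier_const K assms)
  have "\<rho> (\<lambda>x. \<phi> x - \<psi> x) = \<rho> (\<lambda>x. \<phi> x + - 1 * \<psi> x)" by simp
  also have "\<dots> = \<rho> \<phi> + \<rho> (\<lambda>x. - 1 * \<psi> x)" by (rule character_add[OF assms(1) 1])
  also have "\<rho> (\<lambda>x. - 1 * \<psi> x) = - 1 * \<rho> \<psi>"
    by (subst character_mult[OF multiplier_const[OF K] assms(2)]) (simp only: character_const)
  finally show ?thesis by simp
qed

lemma character_sum:
  "(\<And>i. i \<in> I \<Longrightarrow> multiplier X K (\<phi> i)) \<Longrightarrow> \<rho> (\<lambda>x. \<Sum>i\<in>I. \<phi> i x) = (\<Sum>i\<in>I. \<rho> (\<phi> i))"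
  by (induction I rule: infinite_finite_induct)
    (auto simp: character_const character_add multiplier_sum[OF K])

end

lemma character_cinner:
  fixes b :: "'a \<Rightarrow> complex ^ 'n::finite"
  assumes b: "\<And>x. x \<in> X \<Longrightarrow> norm (b x) < 1" and \<rho>: "character X (dk b) \<rho>"
  shows "\<rho> (\<lambda>x. cinner (b x) v) = cinner (\<chi> i. \<rho> (\<lambda>x. b x $ i)) v"
proof -
  have K: "psd_kernel X (dk b)" by (rule psd_kernel_dk[OF b])
  have m: "multiplier X (dk b) (\<lambda>x. b x $ i)" for i by (rule multiplier_coordinate[OF b])
  have "\<rho> (\<lambda>x. cinner (b x) v) = (\<Sum>i\<in>UNIV. \<rho> (\<lambda>x. b x $ i * cnj (v $ i)))"
    unfolding cinner_def by (rule character_sum[OF K \<rho>]) (intro multiplier_mult multiplier_const K m)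
  also have "\<dots> = (\<Sum>i\<in>UNIV. \<rho> (\<lambda>x. b x $ i) * cnj (v $ i))"
    by (simp add: character_mult[OF K \<rho> m multiplier_const[OF K]] character_const[OF K \<rho>])
  finally show ?thesis by (simp add: cinner_def)
qed

text \<open>A spectral argument in place of continuity. If the point \<open>l\<close> were outside
  the closed ball, \<open>v = l / (norm l)^2\<close> would give a multiplier
  \<open>cinner (b x) v\<close> of norm below one on which the character is \<open>1\<close>; yet
  \<open>1\<close> minus it is invertible in the algebra.\<close>

lemma character_norm_le_1:
  fixes b :: "'a \<Rightarrow> complex ^ 'n::finite"
  assumes b: "\<And>x. x \<in> X \<Longrightarrow> norm (b x) < 1" and \<rho>: "character X (dk b) \<rho>"
  shows "norm (\<chi> i. \<rho> (\<lambda>x. b x $ i)) \<le> 1"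
proof (rule ccontr)
  have K: "psd_kernel X (dk b)" by (rule psd_kernel_dk[OF b])
  define l :: "complex ^ 'n" where "l = (\<chi> i. \<rho> (\<lambda>x. b x $ i))"
  assume "\<not> norm (\<chi> i. \<rho> (\<lambda>x. b x $ i)) \<le> 1"
  then have l: "norm l > 1" by (simp add: l_def)
  define s where "s = 1 / (norm l)\<^sup>2"
  define v where "v = complex_of_real s *s l"
  have l2: "(norm l)\<^sup>2 \<noteq> 0" using l by auto
  have "cinner v v = of_real (s * s * (norm l)\<^sup>2)"
    unfolding v_def cinner_scale_left cinner_scale_right cinner_self[of l] by simp
  then have "(norm v)\<^sup>2 = s * s * (norm l)\<^sup>2" unfolding cinner_self of_real_eq_iff .
  also have "\<dots> = (1 / norm l)\<^sup>2" using l2 by (simp add: s_def power2_eq_square)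
  finally have "norm v = 1 / norm l" using l by (simp add: power2_eq_iff_nonneg)
  moreover have "norm l > 0" using l by linarith
  ultimately have v: "norm v < 1" using l by (simp add: divide_less_eq)
  have lv: "cinner l v = 1"
    unfolding v_def cinner_scale_right cinner_self using l2 by (simp add: s_def del: of_real_power)
  define \<phi> where "\<phi> x = cinner (b x) v" for x
  have m\<phi>: "multiplier X (dk b) \<phi>" unfolding \<phi>_def by (rule multiplier_cinner[OF b])
  have nz: "1 - \<phi> x \<noteq> 0" if "x \<in> X" for x
    unfolding \<phi>_def using one_minus_cinner_neq_0[of "b x" v] b that v by simp
  have m1: "multiplier X (dk b) (\<lambda>x. 1 / (1 - \<phi> x))"
    by (rule multiplier_resolvent[OF K norm_ge_zero v])
      (use mult_bound_cinner[of X b v, OF b] nz in \<open>auto simp: \<phi>_def[abs_def]\<close>)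
  have m2: "multiplier X (dk b) (\<lambda>x. 1 - \<phi> x)"
    by (intro multiplier_diff multiplier_const K m\<phi>)
  have "1 = \<rho> (\<lambda>x. 1)" by (simp only: character_const[OF K \<rho>])
  also have "\<dots> = \<rho> (\<lambda>x. (1 - \<phi> x) * (1 / (1 - \<phi> x)))"
    by (rule character_cong[OF K \<rho>]) (use nz in simp)
  also have "\<dots> = \<rho> (\<lambda>x. 1 - \<phi> x) * \<rho> (\<lambda>x. 1 / (1 - \<phi> x))"
    by (rule character_mult[OF K \<rho> m2 m1])
  also have "\<rho> (\<lambda>x. 1 - \<phi> x) = 1 - \<rho> \<phi>"
    by (subst character_diff[OF K \<rho> multiplier_const[OF K] m\<phi>]) (simp only: character_const[OF K \<rho>])
  also have "\<rho> \<phi> = 1"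
    using character_cinner[of X b \<rho> v, OF b \<rho>] by (simp add: \<phi>_def[abs_def] lv l_def[symmetric])
  finally show False by simp
qed

text \<open>Gleason's identity puts \<open>\<phi> - \<phi> z\<close>, up to a unit, into the ideal generated by the functions
  \<open>b\<^sub>i - b\<^sub>i z\<close>, on which the character vanishes.\<close>
lemma character_point_evaluation:
  fixes b :: "'a \<Rightarrow> complex ^ 'n::finite"
  assumes b: "\<And>x. x \<in> X \<Longrightarrow> norm (b x) < 1" and \<rho>: "character X (dk b) \<rho>"
    and b': "\<And>y. y \<in> Y \<Longrightarrow> norm (b' y) < 1" and h: "\<And>x. x \<in> X \<Longrightarrow> h x \<in> Y \<and> b' (h x) = b x"
    and z: "z \<in> Y" "b' z = (\<chi> i. \<rho> (\<lambda>x. b x $ i))" and \<phi>: "multiplier Y (dk b') \<phi>"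
  shows "\<rho> (\<lambda>x. \<phi> (h x)) = \<phi> z"
proof -
  have K: "psd_kernel X (dk b)" by (rule psd_kernel_dk[OF b])
  define l where "l = b' z"
  have l: "norm l < 1" "l = (\<chi> i. \<rho> (\<lambda>x. b x $ i))"
    using z(2) b'[OF z(1)] by (simp_all only: l_def)
  obtain \<psi> where \<psi>: "\<And>y. y \<in> Y \<Longrightarrow>
        (\<phi> y - \<phi> z) * (1 - cinner (b' y) l) = (\<Sum>i\<in>UNIV. (b' y $ i - l $ i) * \<psi> i y)"
      "\<And>i. multiplier Y (dk b') (\<psi> i)"
    using multiplier_gleason[of Y b' z \<phi>] b' z(1) \<phi> unfolding l_def by blast
  \<comment> \<open>Because \<open>b' (h x) = b x\<close>, pulling back along \<open>h\<close>
    carries one kernel to the other, so Gleason's identity on \<open>Y\<close> becomes an identity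
    between multipliers on \<open>X\<close>.\<close>
  have pull: "multiplier X (dk b) (\<lambda>x. \<theta> (h x))" if "multiplier Y (dk b') \<theta>" for \<theta>
  proof -
    have "multiplier X (\<lambda>x y. dk b' (h x) (h y)) (\<lambda>x. \<theta> (h x))"
      by (rule multiplier_compose[OF that]) (use h in auto)
    moreover have "(complex_of_real (t\<^sup>2) - \<theta> (h x) * cnj (\<theta> (h y))) * dk b' (h x) (h y)
      = (complex_of_real (t\<^sup>2) - \<theta> (h x) * cnj (\<theta> (h y))) * dk b x y" if "x \<in> X" "y \<in> X" for x y t
      using h that by (simp add: dk_def)
    ultimately show ?thesis unfolding multiplier_def mult_bound_def by (simp only: cong: psd_kernel_cong)
  qed
  have "multiplier X (dk b) (\<lambda>x. b x $ i)" "multiplier X (dk b) (\<lambda>x. cinner (b x) v)" for i v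
    by (rule multiplier_coordinate[OF b] multiplier_cinner[OF b], assumption)+
  note m = pull[OF \<phi>] pull[OF \<psi>(2)] this
  note ms = multiplier_diff multiplier_mult multiplier_const
  have "\<rho> (\<lambda>x. (\<phi> (h x) - \<phi> z) * (1 - cinner (b x) l))
      = \<rho> (\<lambda>x. \<Sum>i\<in>UNIV. (b x $ i - l $ i) * \<psi> i (h x))"
  proof (rule character_cong[OF K \<rho>])
    fix x assume "x \<in> X"
    with h have "h x \<in> Y" "b' (h x) = b x" by auto
    with \<psi>(1)[of "h x"] show "(\<phi> (h x) - \<phi> z) * (1 - cinner (b x) l) = (\<Sum>i\<in>UNIV. (b x $ i - l $ i) * \<psi> i (h x))"
      by simp
  qed
  also have "\<dots> = (\<Sum>i\<in>UNIV. \<rho> (\<lambda>x. (b x $ i - l $ i) * \<psi> i (h x)))"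
    by (rule character_sum[OF K \<rho>]) (intro ms K m)
  also have "\<dots> = (\<Sum>i\<in>UNIV. (\<rho> (\<lambda>x. b x $ i) - l $ i) * \<rho> (\<lambda>x. \<psi> i (h x)))"
    by (simp add: character_mult[OF K \<rho>] character_diff[OF K \<rho>] character_const[OF K \<rho>] ms K m)
  also have "\<dots> = 0" by (simp add: l(2))
  also have "\<rho> (\<lambda>x. (\<phi> (h x) - \<phi> z) * (1 - cinner (b x) l))
      = (\<rho> (\<lambda>x. \<phi> (h x)) - \<phi> z) * (1 - \<rho> (\<lambda>x. cinner (b x) l))"
    by (simp add: character_mult[OF K \<rho>] character_diff[OF K \<rho>] character_const[OF K \<rho>] ms K m)
  also have "\<rho> (\<lambda>x. cinner (b x) l) = cinner l l"
    by (subst character_cinner[OF b \<rho>]) (simp_all add: l(2))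
  finally show ?thesis
    using one_minus_cinner_neq_0[of l l] l(1) by simp
qed

section \<open>Boundedness and holomorphy of multipliers\<close>

lemma mult_bound_cmod_le:
  assumes t: "mult_bound X K t \<phi>" "t \<ge> 0" and x: "x \<in> X" and K: "psd_kernel X K" "K x x \<noteq> 0"
  shows "cmod (\<phi> x) \<le> t"
proof -
  have "Re (K x x) > 0"
    using psd_kernel_diag[OF K(1) x] K(2) by (auto simp: complex_nonneg_Reals_iff complex_eq_iff less_le)
  moreover have "qnorm K {x} (\<lambda>y. \<phi> y * 1) \<le> t * qnorm K {x} (\<lambda>_. 1)"
    by (rule mult_boundD[OF K(1) t(2,1)]) (use x in auto)
  moreover have "qnorm K {x} (\<lambda>y. \<phi> y * 1) = cmod (\<phi> x) * qnorm K {x} (\<lambda>_. 1)"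
    unfolding qnorm_scale[symmetric] by (rule qnorm_cong) simp
  ultimately show ?thesis by (simp add: qnorm_def qf_def)
qed

lemma multiplier_bounded:
  assumes b: "\<And>x. x \<in> X \<Longrightarrow> norm (b x) < 1" and \<phi>: "multiplier X (dk b) \<phi>"
  obtains t where "\<And>x. x \<in> X \<Longrightarrow> cmod (\<phi> x) \<le> t"
proof -
  obtain t where t: "mult_bound X (dk b) t \<phi>" "t \<ge> 0" using \<phi> by (auto simp: multiplier_def)
  then show thesis
    using mult_bound_cmod_le[OF t _ psd_kernel_dk dk_neq_0] b that by metis
qed

text \<open>Gleason's identity writes the difference quotient of \<open>\<phi>\<close> through those
  of the coordinates. Boundedness of the cofactors yields continuity of every multiplier; the
  cofactors are multipliers too, so they are continuous at \<open>z\<close> and the quotient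
  converges.\<close>

lemma multiplier_holomorphic:
  fixes f :: "complex \<Rightarrow> complex ^ 'n::finite"
  assumes f: "\<And>x. x \<in> X \<Longrightarrow> norm (f x) < 1" and X: "open X"
    and hol: "\<And>i. (\<lambda>z. f z $ i) holomorphic_on X" and \<phi>: "multiplier X (dk f) \<phi>"
  shows "\<phi> holomorphic_on X"
proof -
  have lim_f: "((\<lambda>x. f x $ i) \<longlongrightarrow> f z $ i) (at z)" if "z \<in> X" for z i
    using continuous_on_eq_continuous_at[OF X] holomorphic_on_imp_continuous_on[OF hol] that
    by (metis isContD)
  have lim_c: "((\<lambda>x. 1 - cinner (f x) (f z)) \<longlongrightarrow> 1 - cinner (f z) (f z)) (at z)" if "z \<in> X" for z
    unfolding cinner_def by (intro tendsto_intros lim_f that)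
  have ev: "\<forall>\<^sub>F x in at z. x \<in> X" if "z \<in> X" for z
    using eventually_at_in_open'[OF X that] .
  have nz: "1 - cinner (f x) (f z) \<noteq> 0" if "x \<in> X" "z \<in> X" for x z
    using one_minus_cinner_neq_0[of "f x" "f z"] f that by (simp add: less_imp_le)
  have cont: "(\<psi> \<longlongrightarrow> \<psi> z) (at z)" if \<psi>: "multiplier X (dk f) \<psi>" and z: "z \<in> X" for \<psi> z
  proof -
    obtain \<theta> where \<theta>: "\<And>x. x \<in> X \<Longrightarrow>
        (\<psi> x - \<psi> z) * (1 - cinner (f x) (f z)) = (\<Sum>i\<in>UNIV. (f x $ i - f z $ i) * \<theta> i x)"
      "\<And>i. multiplier X (dk f) (\<theta> i)"
      using multiplier_gleason[of X f z \<psi>] f z \<psi> by blast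
    have "((\<lambda>x. \<Sum>i\<in>UNIV. (f x $ i - f z $ i) * \<theta> i x) \<longlongrightarrow> (\<Sum>i\<in>(UNIV :: 'n set). 0)) (at z)"
    proof (rule tendsto_sum)
      fix i :: 'n
      obtain t where t: "\<And>x. x \<in> X \<Longrightarrow> cmod (\<theta> i x) \<le> t"
        using multiplier_bounded[OF f \<theta>(2)] by metis
      show "((\<lambda>x. (f x $ i - f z $ i) * \<theta> i x) \<longlongrightarrow> 0) (at z)"
      proof (rule Lim_null_comparison)
        show "\<forall>\<^sub>F x in at z. norm ((f x $ i - f z $ i) * \<theta> i x) \<le> cmod (f x $ i - f z $ i) * t"
          using ev[OF z] by eventually_elim (simp add: norm_mult t mult_left_mono)
        show "((\<lambda>x. cmod (f x $ i - f z $ i) * t) \<longlongrightarrow> 0) (at z)"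
          by (rule tendsto_eq_intros lim_f z refl | simp)+
      qed
    qed
    then have "((\<lambda>x. (\<Sum>i\<in>UNIV. (f x $ i - f z $ i) * \<theta> i x) / (1 - cinner (f x) (f z)) + \<psi> z) \<longlongrightarrow>
        0 / (1 - cinner (f z) (f z)) + \<psi> z) (at z)"
      by (intro tendsto_intros lim_c nz z) simp
    then have "((\<lambda>x. (\<Sum>i\<in>UNIV. (f x $ i - f z $ i) * \<theta> i x) / (1 - cinner (f x) (f z)) + \<psi> z) \<longlongrightarrow> \<psi> z) (at z)"
      by simp
    then show ?thesis
    proof (rule Lim_transform_eventually)
      show "\<forall>\<^sub>F x in at z. (\<Sum>i\<in>UNIV. (f x $ i - f z $ i) * \<theta> i x) / (1 - cinner (f x) (f z)) + \<psi> z = \<psi> x"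
        using ev[OF z]
      proof eventually_elim
        case (elim x)
        then show ?case using \<theta>(1)[OF elim] nz[OF elim z] by (simp add: field_simps)
      qed
    qed
  qed
  have "\<exists>D. (\<phi> has_field_derivative D) (at z)" if z: "z \<in> X" for z
  proof -
    obtain \<theta> where \<theta>: "\<And>x. x \<in> X \<Longrightarrow>
        (\<phi> x - \<phi> z) * (1 - cinner (f x) (f z)) = (\<Sum>i\<in>UNIV. (f x $ i - f z $ i) * \<theta> i x)"
      "\<And>i. multiplier X (dk f) (\<theta> i)"
      using multiplier_gleason[of X f z \<phi>] f z \<phi> by blast
    have der: "((\<lambda>x. (f x $ i - f z $ i) / (x - z)) \<longlongrightarrow> deriv (\<lambda>x. f x $ i) z) (at z)" for i
      using holomorphic_derivI[OF hol X z] by (simp add: has_field_derivative_iff)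
    have "((\<lambda>x. (\<Sum>i\<in>UNIV. (f x $ i - f z $ i) / (x - z) * \<theta> i x) / (1 - cinner (f x) (f z))) \<longlongrightarrow>
        (\<Sum>i\<in>UNIV. deriv (\<lambda>x. f x $ i) z * \<theta> i z) / (1 - cinner (f z) (f z))) (at z)" (is "(_ \<longlongrightarrow> ?D) _")
      by (intro tendsto_intros lim_c nz z der cont \<theta>)
    then have "((\<lambda>x. (\<phi> x - \<phi> z) / (x - z)) \<longlongrightarrow> ?D) (at z)"
    proof (rule Lim_transform_eventually)
      show "\<forall>\<^sub>F x in at z. (\<Sum>i\<in>UNIV. (f x $ i - f z $ i) / (x - z) * \<theta> i x) / (1 - cinner (f x) (f z))
          = (\<phi> x - \<phi> z) / (x - z)"
        using ev[OF z]
      proof eventually_elim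
        case (elim x)
        have "(\<Sum>i\<in>UNIV. (f x $ i - f z $ i) / (x - z) * \<theta> i x)
            = (\<Sum>i\<in>UNIV. (f x $ i - f z $ i) * \<theta> i x) / (x - z)"
          by (simp add: sum_divide_distrib)
        also have "\<dots> = (\<phi> x - \<phi> z) * (1 - cinner (f x) (f z)) / (x - z)"
          by (simp add: \<theta>(1)[OF elim])
        finally show ?case using nz[OF elim z] by simp
      qed
    qed
    then show ?thesis by (auto simp: has_field_derivative_iff)
  qed
  then show ?thesis
    unfolding holomorphic_on_open[OF X] by blast
qed

section \<open>Isomorphisms are composition operators\<close>

lemma kernel_f_eq_dk: "kernel_f f = dk f"
  by (intro ext) (simp add: kernel_f_def dk_def)

lemma DA_kernel_eq_dk: "DA_kernel = dk (\<lambda>z. z)"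
  by (intro ext) (simp add: DA_kernel_def dk_def)

lemma embedding_map_norm_less_1: "embedding_map V f \<Longrightarrow> z \<in> ball 0 1 \<Longrightarrow> norm (f z) < 1"
  unfolding embedding_map_def variety_def by (auto simp: set_eq_iff)

lemma psd_kernel_embedding: "embedding_map V f \<Longrightarrow> psd_kernel (ball 0 1) (dk f)"
  by (rule psd_kernel_dk) (rule embedding_map_norm_less_1)

lemma M_f_iff:
  "embedding_map V f \<Longrightarrow>
    \<phi> \<in> M_f f \<longleftrightarrow> (\<forall>z. z \<notin> ball 0 1 \<longrightarrow> \<phi> z = 0) \<and> multiplier (ball 0 1) (dk f) \<phi>"
  unfolding M_f_def kernel_f_eq_dk by (rule mult_alg_iff[OF psd_kernel_embedding])

definition alg_isomorphism :: "(('a \<Rightarrow> complex) \<Rightarrow> 'b \<Rightarrow> complex) \<Rightarrow> ('a \<Rightarrow> complex) set \<Rightarrow>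
    ('b \<Rightarrow> complex) set \<Rightarrow> bool" where
  "alg_isomorphism \<Phi> A B \<longleftrightarrow> bij_betw \<Phi> A B \<and>
     (\<forall>a\<in>A. \<forall>b\<in>A. \<Phi> (\<lambda>z. a z + b z) = (\<lambda>z. \<Phi> a z + \<Phi> b z)) \<and>
     (\<forall>a\<in>A. \<forall>b\<in>A. \<Phi> (\<lambda>z. a z * b z) = (\<lambda>z. \<Phi> a z * \<Phi> b z)) \<and>
     (\<forall>a\<in>A. \<forall>c::complex. \<Phi> (\<lambda>z. c * a z) = (\<lambda>z. c * \<Phi> a z))"

lemma alg_isomorphism_inverse:
  assumes K: "psd_kernel X K" and \<Phi>: "alg_isomorphism \<Phi> (mult_alg X K) B"
  shows "alg_isomorphism (inv_into (mult_alg X K) \<Phi>) B (mult_alg X K)"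
proof -
  define A where "A = mult_alg X K"
  define \<Psi> where "\<Psi> = inv_into A \<Phi>"
  have bij: "bij_betw \<Phi> A B"
    and hom: "\<And>a b. a \<in> A \<Longrightarrow> b \<in> A \<Longrightarrow> \<Phi> (\<lambda>z. a z + b z) = (\<lambda>z. \<Phi> a z + \<Phi> b z)"
      "\<And>a b. a \<in> A \<Longrightarrow> b \<in> A \<Longrightarrow> \<Phi> (\<lambda>z. a z * b z) = (\<lambda>z. \<Phi> a z * \<Phi> b z)"
      "\<And>a c. a \<in> A \<Longrightarrow> \<Phi> (\<lambda>z. c * a z) = (\<lambda>z. c * \<Phi> a z)"
    using \<Phi> by (auto simp: alg_isomorphism_def A_def)
  have clos: "(\<lambda>z. a z + b z) \<in> A" "(\<lambda>z. a z * b z) \<in> A" "(\<lambda>z. c * a z) \<in> A"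
    if "a \<in> A" "b \<in> A" for a b c
    using that multiplier_add[OF K] multiplier_mult[OF K] multiplier_const[OF K]
    by (auto simp: A_def mult_alg_iff[OF K])
  have \<Psi>A: "\<Psi> b \<in> A" and \<Phi>\<Psi>: "\<Phi> (\<Psi> b) = b" if "b \<in> B" for b
    using that bij unfolding \<Psi>_def
    by (metis bij_betw_imp_surj_on inv_into_into, metis bij_betw_inv_into_right)
  have \<Psi>I: "\<Psi> b = a" if "a \<in> A" "\<Phi> a = b" for a b
    using that bij unfolding \<Psi>_def by (metis bij_betw_inv_into_left)
  have "bij_betw \<Psi> B A" unfolding \<Psi>_def by (rule bij_betw_inv_into[OF bij])
  moreover have "\<Psi> (\<lambda>z. a z + b z) = (\<lambda>z. \<Psi> a z + \<Psi> b z)" if "a \<in> B" "b \<in> B" for a b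
    by (rule \<Psi>I) (simp_all add: clos hom \<Psi>A \<Phi>\<Psi> that)
  moreover have "\<Psi> (\<lambda>z. a z * b z) = (\<lambda>z. \<Psi> a z * \<Psi> b z)" if "a \<in> B" "b \<in> B" for a b
    by (rule \<Psi>I) (simp_all add: clos hom \<Psi>A \<Phi>\<Psi> that)
  moreover have "\<Psi> (\<lambda>z. c * a z) = (\<lambda>z. c * \<Psi> a z)" if "a \<in> B" for a c
    by (rule \<Psi>I) (simp_all add: clos(3)[OF \<Psi>A[OF that] \<Psi>A[OF that]] hom \<Psi>A \<Phi>\<Psi> that)
  ultimately show ?thesis unfolding alg_isomorphism_def A_def[symmetric] \<Psi>_def[symmetric] by blast
qed

text \<open>Preservation of the unit is not part of \<open>alg_isomorphism\<close>; it comes from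
  surjectivity. A preimage \<open>a\<close> of the unit satisfies \<open>a e = a\<close>, and
  applying \<open>\<Phi>\<close> gives \<open>\<Phi> e = 1\<close> on \<open>Y\<close>.\<close>

lemma alg_isomorphism_one:
  assumes K: "psd_kernel X K" and L: "psd_kernel Y L"
    and \<Phi>: "alg_isomorphism \<Phi> (mult_alg X K) (mult_alg Y L)"
  shows "\<Phi> (restrict0 X (\<lambda>_. 1)) = restrict0 Y (\<lambda>_. 1)"
proof -
  define e where "e = restrict0 X (\<lambda>_. 1)"
  have e: "e \<in> mult_alg X K" unfolding e_def by (intro restrict0_in_mult_alg K multiplier_const)
  have "restrict0 Y (\<lambda>_. 1) \<in> mult_alg Y L" by (intro restrict0_in_mult_alg L multiplier_const)
  moreover have "\<Phi> ` mult_alg X K = mult_alg Y L"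
    using \<Phi> by (simp add: alg_isomorphism_def bij_betw_def)
  ultimately have "restrict0 Y (\<lambda>_. 1) \<in> \<Phi> ` mult_alg X K" by simp
  then obtain a where "restrict0 Y (\<lambda>_. 1) = \<Phi> a" "a \<in> mult_alg X K" by (rule imageE)
  then have a: "a \<in> mult_alg X K" "\<Phi> a = restrict0 Y (\<lambda>_. 1)" by simp_all
  have "(\<lambda>z. a z * e z) = a"
    using a(1) by (auto simp: e_def restrict0_def mult_alg_iff[OF K])
  then have "\<Phi> a z = \<Phi> a z * \<Phi> e z" for z
    using \<Phi> a(1) e unfolding alg_isomorphism_def by metis
  then have "\<Phi> e z = 1" if "z \<in> Y" for z using that a(2) by (metis restrict0_def mult_1)
  moreover have "\<Phi> e \<in> mult_alg Y L" using \<Phi> e by (auto simp: alg_isomorphism_def bij_betw_def)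
  ultimately show ?thesis unfolding e_def[symmetric]
    by (auto simp: restrict0_def mult_alg_iff[OF L])
qed

lemma alg_isomorphism_character:
  assumes K: "psd_kernel X K" and L: "psd_kernel Y L"
    and \<Phi>: "alg_isomorphism \<Phi> (mult_alg X K) (mult_alg Y L)" and w: "w \<in> Y"
  shows "character X K (\<lambda>\<phi>. \<Phi> (restrict0 X \<phi>) w)"
proof -
  have one: "\<Phi> (restrict0 X (\<lambda>_. 1)) w = 1"
    unfolding alg_isomorphism_one[OF K L \<Phi>] using w by (simp add: restrict0_def)
  have in1: "restrict0 X (\<lambda>_. 1) \<in> mult_alg X K"
    by (intro restrict0_in_mult_alg K multiplier_const)
  have c: "restrict0 X (\<lambda>_. s) = (\<lambda>z. s * restrict0 X (\<lambda>_. 1) z)" for s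
    by (auto simp: restrict0_def)
  show ?thesis
    unfolding character_def
  proof (intro conjI allI impI)
    fix \<phi> \<psi> assume *: "multiplier X K \<phi>" "multiplier X K \<psi>"
    have "restrict0 X (\<lambda>x. \<phi> x + \<psi> x) = (\<lambda>z. restrict0 X \<phi> z + restrict0 X \<psi> z)"
      "restrict0 X (\<lambda>x. \<phi> x * \<psi> x) = (\<lambda>z. restrict0 X \<phi> z * restrict0 X \<psi> z)"
      by (auto simp: restrict0_def)
    then show "\<Phi> (restrict0 X (\<lambda>x. \<phi> x + \<psi> x)) w = \<Phi> (restrict0 X \<phi>) w + \<Phi> (restrict0 X \<psi>) w"
      "\<Phi> (restrict0 X (\<lambda>x. \<phi> x * \<psi> x)) w = \<Phi> (restrict0 X \<phi>) w * \<Phi> (restrict0 X \<psi>) w"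
      using \<Phi> restrict0_in_mult_alg[OF K *(1)] restrict0_in_mult_alg[OF K *(2)]
      by (simp_all add: alg_isomorphism_def)
  next
    fix s
    have "\<Phi> (restrict0 X (\<lambda>_. s)) = (\<lambda>z. s * \<Phi> (restrict0 X (\<lambda>_. 1)) z)"
      unfolding c[of s] using \<Phi> in1 by (simp add: alg_isomorphism_def)
    then show "\<Phi> (restrict0 X (\<lambda>_. s)) w = s" by (simp add: one)
  next
    fix \<phi> \<psi> :: "'a \<Rightarrow> complex" assume "\<forall>x\<in>X. \<phi> x = \<psi> x"
    then have "restrict0 X \<phi> = restrict0 X \<psi>" by (auto simp: restrict0_def)
    then show "\<Phi> (restrict0 X \<phi>) w = \<Phi> (restrict0 X \<psi>) w" by simp
  qed
qed

lemma alg_isomorphism_is_composition: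
  fixes f g :: "complex \<Rightarrow> complex ^ 'n::finite"
  assumes f: "embedding_map V f" and g: "embedding_map W g"
    and \<Phi>: "alg_isomorphism \<Phi> (M_f f) (M_f g)"
  shows "\<exists>\<nu>. \<forall>w\<in>ball 0 1. \<nu> w \<in> ball 0 1 \<and> (\<forall>\<phi>\<in>M_f f. \<Phi> \<phi> w = \<phi> (\<nu> w))"
proof -
  define D where "D = (ball 0 1 :: complex set)"
  have f1: "norm (f z) < 1" and g1: "norm (g z) < 1" if "z \<in> D" for z
    using embedding_map_norm_less_1 f g that by (auto simp: D_def)
  have K: "psd_kernel D (dk f)" and L: "psd_kernel D (dk g)"
    using psd_kernel_embedding f g by (auto simp: D_def)
  have \<Phi>': "alg_isomorphism \<Phi> (mult_alg D (dk f)) (mult_alg D (dk g))"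
    using \<Phi> by (simp add: M_f_def kernel_f_eq_dk D_def)
  define \<rho> where "\<rho> w \<phi> = \<Phi> (restrict0 D \<phi>) w" for w \<phi>
  have \<rho>: "character D (dk f) (\<rho> w)" if "w \<in> D" for w
    unfolding \<rho>_def by (rule alg_isomorphism_character[OF K L \<Phi>' that])
  define \<Lambda> where "\<Lambda> w = (\<chi> i. \<rho> w (\<lambda>x. f x $ i))" for w
  have \<Phi>_in: "\<Phi> (restrict0 D \<phi>) \<in> mult_alg D (dk g)" if "multiplier D (dk f) \<phi>" for \<phi>
    using \<Phi>' restrict0_in_mult_alg[OF K that] by (auto simp: alg_isomorphism_def bij_betw_def)
  have \<Lambda>_cinner: "\<rho> w (\<lambda>x. cinner (f x) v) = cinner (\<Lambda> w) v" if "w \<in> D" for w v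
    unfolding \<Lambda>_def by (rule character_cinner[OF f1 \<rho>[OF that]])
  have \<Lambda>_le: "norm (\<Lambda> w) \<le> 1" if "w \<in> D" for w
    unfolding \<Lambda>_def by (rule character_norm_le_1[OF f1 \<rho>[OF that]])
  \<comment> \<open>As a function of \<open>w\<close> this is the image under \<open>\<Phi>\<close>
    of one multiplier, hence a multiplier for \<open>g\<close>.\<close>
  have hol: "(\<lambda>w. cinner (\<Lambda> w) v) holomorphic_on D" for v
  proof -
    have m: "multiplier D (dk g) (\<Phi> (restrict0 D (\<lambda>x. cinner (f x) v)))"
      using \<Phi>_in[OF multiplier_cinner] f1 mult_alg_iff[OF L] by blast
    have "(\<Phi> (restrict0 D (\<lambda>x. cinner (f x) v))) holomorphic_on D"
      by (rule multiplier_holomorphic[OF g1 _ _ m]) (use g in \<open>auto simp: D_def embedding_map_def\<close>)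
    then show ?thesis
      by (rule holomorphic_transform) (simp add: \<Lambda>_cinner[symmetric] \<rho>_def)
  qed
  have \<Lambda>_less: "norm (\<Lambda> w) < 1" if w: "w \<in> D" for w
  proof (rule ccontr)
    assume "\<not> norm (\<Lambda> w) < 1"
    then have n1: "norm (\<Lambda> w) = 1" using \<Lambda>_le[OF w] by simp
    \<comment> \<open>If \<open>\<Lambda> w\<close> were on the sphere, this functional would attain
      its maximal modulus at an interior point and be constantly \<open>1\<close>; by injectivity of
      \<open>\<Phi>\<close> so would \<open>cinner (f x) v\<close>, which is impossible at
      \<open>0\<close>.\<close>
    define v where "v = \<Lambda> w"
    have self: "cinner (\<Lambda> w) v = 1" by (simp add: v_def cinner_self n1)
    have "(\<lambda>w. cinner (\<Lambda> w) v) constant_on D"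
    proof (rule maximum_modulus_principle[OF hol, where U = D and \<xi> = w])
      fix z assume "z \<in> D"
      then show "cmod (cinner (\<Lambda> z) v) \<le> cmod (cinner (\<Lambda> w) v)"
        unfolding self using cmod_cinner_le[of "\<Lambda> z" v] \<Lambda>_le[of z] n1 by (simp add: v_def)
    qed (use w in \<open>auto simp: D_def\<close>)
    then have const: "cinner (\<Lambda> z) v = 1" if "z \<in> D" for z
      using that w self unfolding constant_on_def by metis
    have mv: "multiplier D (dk f) (\<lambda>x. cinner (f x) v)" by (rule multiplier_cinner[OF f1])
    have "\<Phi> (restrict0 D (\<lambda>x. cinner (f x) v)) = restrict0 D (\<lambda>_. 1)"
    proof
      fix z
      show "\<Phi> (restrict0 D (\<lambda>x. cinner (f x) v)) z = restrict0 D (\<lambda>_. 1) z"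
        using const[of z] \<Lambda>_cinner[of z v] \<Phi>_in[OF mv]
        by (auto simp: \<rho>_def restrict0_def mult_alg_iff[OF L])
    qed
    also have "\<dots> = \<Phi> (restrict0 D (\<lambda>_. 1))" by (rule alg_isomorphism_one[OF K L \<Phi>', symmetric])
    finally have "restrict0 D (\<lambda>x. cinner (f x) v) = restrict0 D (\<lambda>_. 1)"
      using \<Phi>' restrict0_in_mult_alg[OF K mv] restrict0_in_mult_alg[OF K multiplier_const[OF K]]
      unfolding alg_isomorphism_def bij_betw_def by (auto dest: inj_onD)
    from fun_cong[OF this, of 0] have "cinner (f 0) v = 1" by (simp add: restrict0_def D_def)
    moreover have "cmod (cinner (f 0) v) < 1"
      by (rule cmod_cinner_less_1) (use f1[of 0] n1 in \<open>auto simp: D_def v_def\<close>)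
    ultimately show False by simp
  qed
  have "\<exists>z\<in>D. f z = \<Lambda> w" if w: "w \<in> D" for w
  proof -
    obtain S where S: "S \<subseteq> M_DA" "f ` D = {z \<in> ball 0 1. \<forall>\<phi>\<in>S. \<phi> z = 0}"
      using f by (auto simp: embedding_map_def variety_def D_def)
    have "\<theta> (\<Lambda> w) = 0" if "\<theta> \<in> S" for \<theta>
    proof -
      have B: "norm y < 1" if "y \<in> ball 0 1" for y :: "complex ^ 'n" using that by simp
      have "multiplier (ball 0 1) (dk (\<lambda>z :: complex ^ 'n. z)) \<theta>"
        using that S(1) mult_alg_iff[OF psd_kernel_dk[of "ball 0 1" "\<lambda>z :: complex ^ 'n. z"]]
        unfolding M_DA_def DA_kernel_eq_dk by auto
      \<comment> \<open>Evaluation on the ball with \<open>h = f\<close>, since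
        \<open>\<Lambda> w\<close> is not yet known to lie on the variety.\<close>
      then have "\<rho> w (\<lambda>x. \<theta> (f x)) = \<theta> (\<Lambda> w)"
        by (intro character_point_evaluation[OF f1 \<rho>[OF w] B]) (use f1 \<Lambda>_less[OF w] in \<open>auto simp: \<Lambda>_def\<close>)
      moreover have "\<rho> w (\<lambda>x. \<theta> (f x)) = \<rho> w (\<lambda>x. 0)"
        by (rule character_cong[OF K \<rho>[OF w]]) (use S(2) that in auto)
      ultimately show ?thesis by (simp add: character_const[OF K \<rho>[OF w]])
    qed
    then have "\<Lambda> w \<in> f ` D" unfolding S(2) using \<Lambda>_less[OF w] by simp
    then show ?thesis by force
  qed
  then obtain \<nu> where \<nu>: "\<nu> w \<in> D" "f (\<nu> w) = \<Lambda> w" if "w \<in> D" for w by metis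
  have "\<Phi> \<phi> w = \<phi> (\<nu> w)" if w: "w \<in> D" and \<phi>: "\<phi> \<in> M_f f" for w \<phi>
  proof -
    have m: "multiplier D (dk f) \<phi>" using \<phi> f M_f_iff[OF f] by (simp add: D_def)
    \<comment> \<open>Now a preimage in the disc is available, and the same lemma applies with
      \<open>h\<close> the identity.\<close>
    have "\<rho> w (\<lambda>x. \<phi> ((\<lambda>x. x) x)) = \<phi> (\<nu> w)"
      by (rule character_point_evaluation[OF f1 \<rho>[OF w] f1 _ \<nu>(1)[OF w] _ m])
        (use \<nu>(2)[OF w] in \<open>auto simp: \<Lambda>_def\<close>)
    moreover have "restrict0 D \<phi> = \<phi>"
      using restrict0_id \<phi> unfolding M_f_def kernel_f_eq_dk D_def by blast
    ultimately show ?thesis by (simp add: \<rho>_def)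
  qed
  with \<nu>(1) show ?thesis unfolding D_def by (intro exI[of _ \<nu>]) blast
qed

section \<open>Holomorphy and boundary extension of the composition symbol\<close>

lemma embedding_map_derivative:
  assumes "embedding_map V f"
  obtains Df where "\<And>x. x \<in> cball 0 1 \<Longrightarrow> (f has_derivative blinfun_apply (Df x)) (at x within cball 0 1)"
    "continuous_on (cball 0 1) Df"
proof -
  obtain Df D2f where Df: "\<forall>x\<in>cball 0 1. (f has_derivative blinfun_apply (Df x)) (at x within cball 0 1)"
    and D2f: "\<forall>x\<in>cball 0 1. (Df has_derivative blinfun_apply (D2f x)) (at x within cball 0 1)"
    using assms unfolding embedding_map_def C2_on_closed_disc_def by blast
  have "continuous_on (cball 0 1) Df"
    by (rule has_derivative_continuous_on) (use D2f in blast)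
  with Df that show thesis by blast
qed

lemma embedding_map_continuous:
  assumes "embedding_map V f"
  shows "continuous_on (cball 0 1) f"
proof -
  obtain Df where "\<And>x. x \<in> cball 0 1 \<Longrightarrow> (f has_derivative blinfun_apply (Df x)) (at x within cball 0 1)"
    using embedding_map_derivative[OF assms] by blast
  then show ?thesis by (rule has_derivative_continuous_on)
qed

text \<open>Continuity is a compactness argument: \<open>f\<close> maps the closed disc without a
  neighbourhood of \<open>\<nu> w\<close> onto a compact set missing \<open>f (\<nu> w)\<close>, as
  circle points go to the sphere and \<open>f\<close> is injective inside. The derivative then comes
  from a coordinate of \<open>f\<close> with nonvanishing derivative.\<close>

lemma holomorphic_lift_embedding:
  fixes f :: "complex \<Rightarrow> complex ^ 'n::finite"
  assumes f: "embedding_map V f" and \<nu>: "\<And>w. w \<in> ball 0 1 \<Longrightarrow> \<nu> w \<in> ball 0 1"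
    and hol: "\<And>i. (\<lambda>w. f (\<nu> w) $ i) holomorphic_on ball 0 1"
  shows "\<nu> holomorphic_on ball 0 1"
proof -
  have f1: "norm (f z) < 1" if "z \<in> ball 0 1" for z by (rule embedding_map_norm_less_1[OF f that])
  have f_hol: "(\<lambda>z. f z $ i) holomorphic_on ball 0 1" for i using f by (simp add: embedding_map_def)
  have f_cont: "continuous_on (cball 0 1) f" by (rule embedding_map_continuous[OF f])
  have lim: "((\<lambda>w'. f (\<nu> w')) \<longlongrightarrow> f (\<nu> w)) (at w)" if w: "w \<in> ball 0 1" for w
  proof (rule vec_tendstoI)
    fix i
    have "isCont (\<lambda>w'. f (\<nu> w') $ i) w"
      using holomorphic_on_imp_continuous_on[OF hol] w
      by (simp add: continuous_on_eq_continuous_at)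
    then show "((\<lambda>w'. f (\<nu> w') $ i) \<longlongrightarrow> f (\<nu> w) $ i) (at w)" by (simp add: isCont_def)
  qed
  have ev: "\<forall>\<^sub>F w' in at w. w' \<in> ball 0 1" if "w \<in> ball 0 1" for w :: complex
    using eventually_at_in_open'[OF open_ball that] .
  have cont: "(\<nu> \<longlongrightarrow> \<nu> w) (at w)" if w: "w \<in> ball 0 1" for w
  proof (rule tendstoI)
    fix \<epsilon> :: real assume \<epsilon>: "\<epsilon> > 0"
    define C where "C = cball 0 1 - ball (\<nu> w) \<epsilon>"
    have "compact C" unfolding C_def by (intro compact_diff compact_cball open_ball)
    then have "compact (f ` C)"
      by (intro compact_continuous_image continuous_on_subset[OF f_cont]) (auto simp: C_def)
    then have "open (- (f ` C))" by (simp add: compact_imp_closed open_Compl)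
    moreover have "f (\<nu> w) \<in> - (f ` C)"
    proof
      assume "f (\<nu> w) \<in> f ` C"
      then obtain x where x: "x \<in> C" "f (\<nu> w) = f x" by blast
      then have "norm (f x) < 1" using f1[OF \<nu>[OF w]] by simp
      moreover have "x \<in> cball 0 1" using x by (simp add: C_def)
      moreover have "norm (f x) = 1 \<longleftrightarrow> cmod x = 1"
        using f \<open>x \<in> cball 0 1\<close> unfolding embedding_map_def by blast
      ultimately have "x \<in> ball 0 1" by simp
      then have "x = \<nu> w"
        using f \<nu>[OF w] x(2) unfolding embedding_map_def by (metis inj_onD)
      with x(1) \<epsilon> show False by (simp add: C_def)
    qed
    ultimately have "\<forall>\<^sub>F w' in at w. f (\<nu> w') \<in> - (f ` C)" using topological_tendstoD[OF lim[OF w]] by blast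
    then show "\<forall>\<^sub>F w' in at w. dist (\<nu> w') (\<nu> w) < \<epsilon>"
      using ev[OF w]
    proof eventually_elim
      case (elim w')
      then have "\<nu> w' \<notin> C" by blast
      then show ?case using \<nu>[OF elim(2)] by (auto simp: C_def dist_commute)
    qed
  qed
  have "\<exists>D. (\<nu> has_field_derivative D) (at w)" if w: "w \<in> ball 0 1" for w
  proof -
    obtain i where i: "deriv (\<lambda>z. f z $ i) (\<nu> w) \<noteq> 0"
      using f \<nu>[OF w] unfolding embedding_map_def by blast
    define d where "d = deriv (\<lambda>z. f z $ i) (\<nu> w)"
    have "((\<lambda>z. f z $ i) has_field_derivative d) (at (\<nu> w))"
      unfolding d_def by (rule holomorphic_derivI[OF f_hol open_ball \<nu>[OF w]])
    \<comment> \<open>Caratheodory's form of the derivative avoids dividing by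
      \<open>\<nu> w' - \<nu> w\<close>, which might vanish.\<close>
    then obtain q where q: "\<And>z. f z $ i - f (\<nu> w) $ i = q z * (z - \<nu> w)" "isCont q (\<nu> w)" "q (\<nu> w) = d"
      unfolding CARAT_DERIV by blast
    have lim_q: "((\<lambda>w'. q (\<nu> w')) \<longlongrightarrow> d) (at w)"
      using isCont_tendsto_compose[OF q(2) cont[OF w]] by (simp add: q(3))
    define d' where "d' = deriv (\<lambda>w. f (\<nu> w) $ i) w"
    have "((\<lambda>w'. (f (\<nu> w') $ i - f (\<nu> w) $ i) / (w' - w)) \<longlongrightarrow> d') (at w)"
      using holomorphic_derivI[OF hol open_ball w, of i] by (simp add: has_field_derivative_iff d'_def)
    then have "((\<lambda>w'. (f (\<nu> w') $ i - f (\<nu> w) $ i) / (w' - w) / q (\<nu> w')) \<longlongrightarrow> d' / d) (at w)"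
      by (rule tendsto_divide[OF _ lim_q]) (use i in \<open>simp add: d_def\<close>)
    then have "((\<lambda>w'. (\<nu> w' - \<nu> w) / (w' - w)) \<longlongrightarrow> d' / d) (at w)"
    proof (rule Lim_transform_eventually)
      have "\<forall>\<^sub>F w' in at w. q (\<nu> w') \<noteq> 0"
        by (rule tendsto_imp_eventually_ne[OF lim_q]) (use i in \<open>simp add: d_def\<close>)
      then show "\<forall>\<^sub>F w' in at w. (f (\<nu> w') $ i - f (\<nu> w) $ i) / (w' - w) / q (\<nu> w') = (\<nu> w' - \<nu> w) / (w' - w)"
        by eventually_elim (simp add: q(1))
    qed
    then show ?thesis by (auto simp: has_field_derivative_iff)
  qed
  then show ?thesis unfolding holomorphic_on_open[OF open_ball] by blast
qed

text \<open>Moving \<open>\<nu> 0\<close> to the origin by a Moebius map and applying the Schwarz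
  lemma in both directions leaves a rotation. The resulting fractional linear formulas have their
  poles outside the closed disc.\<close>

lemma disc_biholomorphism_extension:
  fixes \<mu> \<nu> :: "complex \<Rightarrow> complex"
  assumes \<mu>: "\<mu> holomorphic_on ball 0 1" "\<And>z. z \<in> ball 0 1 \<Longrightarrow> \<mu> z \<in> ball 0 1"
    and \<nu>: "\<nu> holomorphic_on ball 0 1" "\<And>z. z \<in> ball 0 1 \<Longrightarrow> \<nu> z \<in> ball 0 1"
    and inv: "\<And>z. z \<in> ball 0 1 \<Longrightarrow> \<nu> (\<mu> z) = z" "\<And>z. z \<in> ball 0 1 \<Longrightarrow> \<mu> (\<nu> z) = z"
  obtains m n where "continuous_on (cball 0 1) m" "continuous_on (cball 0 1) n"
    "\<And>z. z \<in> ball 0 1 \<Longrightarrow> m z = \<mu> z" "\<And>z. z \<in> ball 0 1 \<Longrightarrow> n z = \<nu> z"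
    "\<And>\<xi>. cmod \<xi> = 1 \<Longrightarrow> cmod (m \<xi>) = 1" "\<And>\<xi>. cmod \<xi> = 1 \<Longrightarrow> n (m \<xi>) = \<xi>"
proof -
  define a where "a = \<nu> 0"
  have a: "cmod a < 1" using \<nu>(2)[of 0] by (simp add: a_def)
  define T where "T = Moebius_function 0 (- a)"
  define T' where "T' = Moebius_function 0 a"
  have Ta: "T 0 = a" by (simp add: T_def Moebius_function_of_zero)
  have T_ball: "T z \<in> ball 0 1" "T' z \<in> ball 0 1" if "z \<in> ball 0 1" for z
    using Moebius_function_norm_lt_1[of "-a" z] Moebius_function_norm_lt_1[of a z] a that
    by (auto simp: T_def T'_def)
  have TT': "T (T' z) = z" "T' (T z) = z" if "z \<in> ball 0 1" for z
    using Moebius_function_compose[of "- a" a z] Moebius_function_compose[of a "- a" z] a that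
    by (auto simp: T_def T'_def)
  have T_hol: "T holomorphic_on ball 0 1" "T' holomorphic_on ball 0 1"
    unfolding T_def T'_def by (rule Moebius_function_holomorphic, use a in simp)+
  define h where "h = \<mu> \<circ> T"
  define h' where "h' = T' \<circ> \<nu>"
  have h_hol: "h holomorphic_on ball 0 1" "h' holomorphic_on ball 0 1"
    unfolding h_def h'_def
    by (rule holomorphic_on_compose_gen[of _ "ball 0 1" _ "ball 0 1"], use \<mu> \<nu> T_hol T_ball in auto)+
  have h0: "h 0 = 0" "h' 0 = 0"
    using inv(2)[of 0] by (simp_all add: h_def h'_def Ta a_def[symmetric] T'_def Moebius_function_eq_zero)
  have h_ball: "norm (h z) < 1" "norm (h' z) < 1" if "norm z < 1" for z
    using that \<mu>(2)[of "T z"] T_ball[of z] T_ball[of "\<nu> z"] \<nu>(2)[of z] by (auto simp: h_def h'_def)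
  have hh': "h' (h z) = z" if "norm z < 1" for z
    using that inv(1)[of "T z"] T_ball[of z] TT'[of z] by (simp add: h_def h'_def)
  \<comment> \<open>Equality in the Schwarz lemma at one nonzero point already forces a rotation;
    \<open>1/2\<close> is an arbitrary choice.\<close>
  have "norm (h (1/2)) = norm (1/2 :: complex)"
  proof (rule antisym)
    show "norm (h (1/2)) \<le> norm (1/2 :: complex)"
      by (rule Schwarz_Lemma(1)[OF h_hol(1) h0(1) h_ball(1)]) auto
    have "norm (h' (h (1/2))) \<le> norm (h (1/2))"
      by (rule Schwarz_Lemma(1)[OF h_hol(2) h0(2) h_ball(2)]) (auto intro: h_ball)
    then show "norm (1/2 :: complex) \<le> norm (h (1/2))" by (subst (asm) hh') auto
  qed
  then have "\<exists>z. norm z < 1 \<and> z \<noteq> 0 \<and> norm (h z) = norm z" by (intro exI[of _ "1/2"]) auto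
  then obtain c where c: "\<And>z. norm z < 1 \<Longrightarrow> h z = c * z" "norm c = 1"
    using Schwarz_Lemma(3)[OF h_hol(1) h0(1) h_ball(1), of 0] by auto
  have cc: "cnj c * c = 1" using c(2) by (metis complex_norm_square mult.commute of_real_1 one_power2)
  define m where "m z = c * ((z - a) / (1 - cnj a * z))" for z
  define n where "n z = (cnj c * z + a) / (1 + cnj a * (cnj c * z))" for z
  have nz: "1 - cnj a * z \<noteq> 0" if "norm z \<le> 1" for z
  proof
    assume "1 - cnj a * z = 0"
    then have "cnj a * z = 1" by simp
    then have "norm (cnj a * z) = 1" by simp
    moreover have "norm (cnj a * z) \<le> norm a * 1"
      unfolding norm_mult complex_mod_cnj using that by (intro mult_left_mono) auto
    ultimately show False using a by simp
  qed
  have nz': "1 + cnj a * (cnj c * z) \<noteq> 0" if "norm z \<le> 1" for z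
    using nz[of "- (cnj c * z)"] that c(2) by (simp add: norm_mult)
  show thesis
  proof
    show "continuous_on (cball 0 1) m" "continuous_on (cball 0 1) n"
      unfolding m_def n_def by (intro continuous_intros; use nz nz' in simp)+
    show m_eq: "m z = \<mu> z" if "z \<in> ball 0 1" for z
    proof -
      have "\<mu> z = h (T' z)" using TT'(1)[OF that] by (simp add: h_def)
      also have "\<dots> = c * T' z" by (rule c) (use T_ball[OF that] in simp)
      finally show ?thesis by (simp add: m_def T'_def Moebius_function_simple)
    qed
    have nm: "n (m z) = z" if "norm z \<le> 1" for z
    proof -
      define w where "w = (z - a) / (1 - cnj a * z)"
      have w: "w * (1 - cnj a * z) = z - a" using nz[OF that] by (simp add: w_def)
      have "cnj c * m z = w" unfolding m_def w_def[symmetric] using cc by (simp add: mult.assoc[symmetric])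
      then have n_eq: "n (m z) = (w + a) / (1 + cnj a * w)" by (simp add: n_def)
      have e1: "(w + a) * (1 - cnj a * z) = z * ((1 + cnj a * w) * (1 - cnj a * z))"
      proof -
        have "(w + a) * (1 - cnj a * z) = w * (1 - cnj a * z) + a * (1 - cnj a * z)" by (simp add: algebra_simps)
        also have "\<dots> = z * ((1 - cnj a * z) + cnj a * (w * (1 - cnj a * z)))"
          unfolding w by (simp add: algebra_simps)
        finally show ?thesis by (simp add: algebra_simps)
      qed
      have e2: "(1 + cnj a * w) * (1 - cnj a * z) = 1 - cnj a * a"
      proof -
        have "(1 + cnj a * w) * (1 - cnj a * z) = (1 - cnj a * z) + cnj a * (w * (1 - cnj a * z))"
          by (simp add: algebra_simps)
        then show ?thesis unfolding w by (simp add: algebra_simps)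
      qed
      have "1 - cnj a * a \<noteq> 0" using nz[of a] a by simp
      then have "1 + cnj a * w \<noteq> 0" using e2 by auto
      moreover have "w + a = z * (1 + cnj a * w)" using e1 nz[OF that] by (simp add: mult.assoc[symmetric])
      ultimately show ?thesis by (simp add: n_eq)
    qed
    show "n z = \<nu> z" if "z \<in> ball 0 1" for z
      using nm[of "\<nu> z"] m_eq[of "\<nu> z"] \<nu>(2)[OF that] inv(2)[OF that] by simp
    show "n (m \<xi>) = \<xi>" if "cmod \<xi> = 1" for \<xi> by (rule nm) (use that in simp)
    show "cmod (m \<xi>) = 1" if "cmod \<xi> = 1" for \<xi>
    proof -
      have x: "\<xi> * cnj \<xi> = 1" using that by (metis complex_norm_square of_real_1 one_power2)
      have "1 - cnj a * \<xi> = \<xi> * cnj (\<xi> - a)" by (simp add: algebra_simps x)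
      then have "cmod (1 - cnj a * \<xi>) = cmod (\<xi> - a)" by (metis complex_mod_cnj mult_1 norm_mult that)
      moreover have "cmod (1 - cnj a * \<xi>) \<noteq> 0" using nz[of \<xi>] that by simp
      ultimately show ?thesis by (simp add: m_def norm_mult norm_divide c(2))
    qed
  qed
qed

section \<open>Boundary behaviour\<close>

lemma inner_eq_Re_cinner: "x \<bullet> y = Re (cinner x y)"
  by (simp add: inner_vec_def cinner_def inner_complex_def)

lemma cinner_scaleR_left: "cinner (r *\<^sub>R x) y = of_real r * cinner x y"
  and cinner_scaleR_right: "cinner x (r *\<^sub>R y) = of_real r * cinner x y"
  by (simp_all add: cinner_def sum_distrib_left scaleR_conv_of_real[where 'a = complex] mult_ac)

lemma tendsto_cinner [tendsto_intros]:
  "(u \<longlongrightarrow> a) F \<Longrightarrow> (v \<longlongrightarrow> b) F \<Longrightarrow> ((\<lambda>x. cinner (u x) (v x)) \<longlongrightarrow> cinner a b) F"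
  unfolding cinner_def by (intro tendsto_intros)

section \<open>Radial approach to the circle\<close>

lemma filterlim_radial:
  fixes \<xi> :: complex
  assumes "cmod \<xi> = 1" "c > 0"
  shows "filterlim (\<lambda>s. (1 - s * c) *\<^sub>R \<xi>) (at \<xi> within ball 0 1) (at_right 0)"
proof -
  have "((\<lambda>s. (1 - s * c) *\<^sub>R \<xi>) \<longlongrightarrow> \<xi>) (at_right 0)"
    by (rule tendsto_eq_intros refl | simp)+
  moreover have "\<forall>\<^sub>F s in at_right 0. (1 - s * c) *\<^sub>R \<xi> \<in> ball 0 1 \<and> (1 - s * c) *\<^sub>R \<xi> \<noteq> \<xi>"
  proof -
    have "\<forall>\<^sub>F s in at_right 0. s \<in> {0 <..< 1 / c}"
      by (rule eventually_at_right_real) (use assms in simp)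
    then show ?thesis
    proof eventually_elim
      case (elim s)
      then have "0 < s * c" "s * c < 1" using assms by (auto simp: field_simps)
      then have "norm ((1 - s * c) *\<^sub>R \<xi>) = 1 - s * c" using assms by simp
      with \<open>0 < s * c\<close> have "norm ((1 - s * c) *\<^sub>R \<xi>) < 1" by simp
      then show ?case using assms(1) by (metis less_irrefl mem_ball_0)
    qed
  qed
  ultimately show ?thesis by (simp add: filterlim_at)
qed

lemma radial_difference_quotient:
  fixes f :: "complex \<Rightarrow> complex ^ 'n::finite"
  assumes D: "(f has_derivative D) (at \<xi> within cball 0 1)" and \<xi>: "cmod \<xi> = 1" and c: "c > 0"
  shows "((\<lambda>s. (f ((1 - s * c) *\<^sub>R \<xi>) - f \<xi>) /\<^sub>R s) \<longlongrightarrow> - (c *\<^sub>R D \<xi>)) (at_right 0)"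
proof -
  have lin: "bounded_linear D" by (rule has_derivative_bounded_linear[OF D])
  have "filterlim (\<lambda>s. (1 - s * c) *\<^sub>R \<xi>) (at \<xi> within cball 0 1) (at_right 0)"
    by (rule filterlim_mono[OF filterlim_radial[OF \<xi> c]]) (auto intro: at_le)
  moreover have "((\<lambda>y. (1 / norm (y - \<xi>)) *\<^sub>R (f y - (f \<xi> + D (y - \<xi>)))) \<longlongrightarrow> 0) (at \<xi> within cball 0 1)"
    using D by (simp add: has_derivative_within)
  ultimately have "((\<lambda>s. (1 / norm ((1 - s * c) *\<^sub>R \<xi> - \<xi>)) *\<^sub>R
      (f ((1 - s * c) *\<^sub>R \<xi>) - (f \<xi> + D ((1 - s * c) *\<^sub>R \<xi> - \<xi>)))) \<longlongrightarrow> 0) (at_right 0)"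
    by (rule filterlim_compose[rotated])
  \<comment> \<open>The path point is at distance \<open>s c\<close> from \<open>\<xi>\<close>, so
    the factor \<open>c\<close> turns division by that distance into division by
    \<open>s\<close>.\<close>
  then have "((\<lambda>s. c *\<^sub>R ((1 / norm ((1 - s * c) *\<^sub>R \<xi> - \<xi>)) *\<^sub>R
      (f ((1 - s * c) *\<^sub>R \<xi>) - (f \<xi> + D ((1 - s * c) *\<^sub>R \<xi> - \<xi>)))) - c *\<^sub>R D \<xi>) \<longlongrightarrow> c *\<^sub>R 0 - c *\<^sub>R D \<xi>) (at_right 0)"
    by (intro tendsto_intros)
  then have "((\<lambda>s. c *\<^sub>R ((1 / norm ((1 - s * c) *\<^sub>R \<xi> - \<xi>)) *\<^sub>R
      (f ((1 - s * c) *\<^sub>R \<xi>) - (f \<xi> + D ((1 - s * c) *\<^sub>R \<xi> - \<xi>)))) - c *\<^sub>R D \<xi>) \<longlongrightarrow> - (c *\<^sub>R D \<xi>)) (at_right 0)"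
    by simp
  then show ?thesis
  proof (rule Lim_transform_eventually)
    have "\<forall>\<^sub>F s in at_right 0. (s::real) > 0" by (rule eventually_at_right_less)
    then show "\<forall>\<^sub>F s in at_right 0. c *\<^sub>R ((1 / norm ((1 - s * c) *\<^sub>R \<xi> - \<xi>)) *\<^sub>R
      (f ((1 - s * c) *\<^sub>R \<xi>) - (f \<xi> + D ((1 - s * c) *\<^sub>R \<xi> - \<xi>)))) - c *\<^sub>R D \<xi>
      = (f ((1 - s * c) *\<^sub>R \<xi>) - f \<xi>) /\<^sub>R s"
    proof eventually_elim
      case (elim s)
      have 1: "(1 - s * c) *\<^sub>R \<xi> - \<xi> = (- (s * c)) *\<^sub>R \<xi>" by (simp add: algebra_simps)
      have 2: "norm ((1 - s * c) *\<^sub>R \<xi> - \<xi>) = s * c" unfolding 1 using elim c \<xi> by simp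
      have 3: "D ((1 - s * c) *\<^sub>R \<xi> - \<xi>) = (- (s * c)) *\<^sub>R D \<xi>"
        unfolding 1 by (rule linear_scale[OF bounded_linear.linear[OF lin]])
      show ?case unfolding 2 3 using elim c by (simp add: scaleR_diff_right scaleR_add_right field_simps)
    qed
  qed
qed

text \<open>Complex linearity of the derivative holds inside the disc and passes to the circle by
  continuity of \<open>Df\<close>.\<close>

lemma boundary_cauchy_riemann:
  fixes f :: "complex \<Rightarrow> complex ^ 'n::finite"
  assumes hol: "\<And>i. (\<lambda>z. f z $ i) holomorphic_on ball 0 1"
    and Df: "\<And>x. x \<in> cball 0 1 \<Longrightarrow> (f has_derivative blinfun_apply (Df x)) (at x within cball 0 1)"
    and cont: "continuous_on (cball 0 1) Df" and \<xi>: "\<xi> \<in> cball 0 1"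
  shows "blinfun_apply (Df \<xi>) (\<i> * h) = \<i> *s blinfun_apply (Df \<xi>) h"
proof -
  have "blinfun_apply (Df \<xi>) (\<i> * h) $ i - \<i> * (blinfun_apply (Df \<xi>) h $ i) = 0" for i
  proof (rule continuous_constant_on_closure[where S = "ball 0 1" and a = 0
        and f = "\<lambda>z. blinfun_apply (Df z) (\<i> * h) $ i - \<i> * (blinfun_apply (Df z) h $ i)"])
    show "continuous_on (closure (ball 0 1)) (\<lambda>z. blinfun_apply (Df z) (\<i> * h) $ i - \<i> * (blinfun_apply (Df z) h $ i))"
      unfolding closure_ball[OF zero_less_one, of 0]
      by (intro continuous_intros bounded_linear.continuous_on[OF bounded_linear_vec_nth] cont)
    show "\<xi> \<in> closure (ball 0 1)" using \<xi> by simp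
    fix z :: complex assume z: "z \<in> ball 0 1"
    have "at z within cball 0 1 = at z"
      by (rule at_within_interior) (use z in simp)
    then have "(f has_derivative blinfun_apply (Df z)) (at z)"
      using Df[of z] z by simp
    then have 1: "((\<lambda>z. f z $ i) has_derivative (\<lambda>h. blinfun_apply (Df z) h $ i)) (at z)"
      by (rule bounded_linear.has_derivative[OF bounded_linear_vec_nth])
    have "((\<lambda>z. f z $ i) has_derivative (*) (deriv (\<lambda>z. f z $ i) z)) (at z)"
      using holomorphic_derivI[OF hol open_ball z] by (simp add: has_field_derivative_def)
    from has_derivative_unique[OF 1 this]
    have "blinfun_apply (Df z) h $ i = deriv (\<lambda>z. f z $ i) z * h" for h by metis
    then show "blinfun_apply (Df z) (\<i> * h) $ i - \<i> * (blinfun_apply (Df z) h $ i) = 0" by simp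
  qed
  then show ?thesis by (simp add: vec_eq_iff)
qed

text \<open>The values of \<open>q\<close> approach \<open>1\<close> at most linearly in the
  distance to the circle; applied to \<open>cinner (f z) (f \<xi>)\<close>, this prevents the radial
  derivative from vanishing.\<close>

lemma schwarz_pick_lower_bound:
  assumes q: "q holomorphic_on ball 0 1" and q1: "\<And>z. cmod z < 1 \<Longrightarrow> cmod (q z) < 1"
  obtains \<kappa> where "\<kappa> > 0" "\<And>z. cmod z < 1 \<Longrightarrow> \<kappa> * (1 - cmod z) \<le> 1 - Re (q z)"
proof -
  define a where "a = q 0"
  have a: "cmod a < 1" using q1[of 0] by (simp add: a_def)
  define h where "h = Moebius_function 0 a \<circ> q"
  have h: "h holomorphic_on ball 0 1" unfolding h_def
    by (rule holomorphic_on_compose_gen[OF q Moebius_function_holomorphic[OF a]]) (use q1 in auto)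
  have h0: "h 0 = 0" by (simp add: h_def a_def[symmetric] Moebius_function_eq_zero)
  have h1: "norm (h z) < 1" if "norm z < 1" for z
    using Moebius_function_norm_lt_1[OF a q1[OF that]] by (simp add: h_def)
  \<comment> \<open>The square comes from \<open>|1 - cnj a * q z| \<ge> 1 - |a|\<close>, the half
    from \<open>1 + |q z| \<le> 2\<close>.\<close>
  have "(1 - cmod a)\<^sup>2 / 2 * (1 - cmod z) \<le> 1 - Re (q z)" if z: "cmod z < 1" for z
  proof -
    have hz: "norm (h z) \<le> norm z" by (rule Schwarz_Lemma(1)[OF h h0 h1 z])
    have qz: "cmod (q z) < 1" by (rule q1[OF z])
    have den: "cmod (1 - cnj a * q z) \<ge> 1 - cmod a"
    proof -
      have "cmod (cnj a * q z) \<le> cmod a * 1" unfolding norm_mult complex_mod_cnj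
        using qz by (intro mult_left_mono) auto
      then show ?thesis using norm_triangle_ineq2[of 1 "cnj a * q z"] by simp
    qed
    then have den0: "cmod (1 - cnj a * q z) > 0" using a by linarith
    have "(cmod (q z - a))\<^sup>2 = (cmod (h z))\<^sup>2 * (cmod (1 - cnj a * q z))\<^sup>2"
      using den0 by (simp add: h_def Moebius_function_simple norm_divide power_divide)
    also have "\<dots> \<le> (cmod z)\<^sup>2 * (cmod (1 - cnj a * q z))\<^sup>2"
      using hz by (intro mult_right_mono power_mono) auto
    finally have 1: "(cmod (q z - a))\<^sup>2 \<le> (cmod z)\<^sup>2 * (cmod (1 - cnj a * q z))\<^sup>2" .
    have "(1 - (cmod a)\<^sup>2) * (1 - (cmod (q z))\<^sup>2) = (cmod (1 - cnj a * q z))\<^sup>2 - (cmod (q z - a))\<^sup>2"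
      unfolding cmod_power2 by (simp add: power2_eq_square algebra_simps)
    also have "\<dots> \<ge> (1 - (cmod z)\<^sup>2) * (cmod (1 - cnj a * q z))\<^sup>2"
      using 1 by (simp add: algebra_simps)
    also have "(1 - (cmod z)\<^sup>2) * (cmod (1 - cnj a * q z))\<^sup>2 \<ge> (1 - cmod z) * (1 - cmod a)\<^sup>2"
    proof (rule mult_mono)
      show "1 - cmod z \<le> 1 - (cmod z)\<^sup>2" using z by (simp add: power2_eq_square mult_left_le)
      show "(1 - cmod a)\<^sup>2 \<le> (cmod (1 - cnj a * q z))\<^sup>2" using den a by (intro power_mono) auto
      show "0 \<le> 1 - (cmod z)\<^sup>2" using z by (simp add: power_le_one)
    qed simp
    finally have "(1 - cmod z) * (1 - cmod a)\<^sup>2 \<le> (1 - (cmod a)\<^sup>2) * (1 - (cmod (q z))\<^sup>2)" .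
    also have "\<dots> \<le> 1 * (1 - (cmod (q z))\<^sup>2)"
      using qz by (intro mult_right_mono) (auto simp: power_le_one)
    also have "\<dots> = (1 - cmod (q z)) * (1 + cmod (q z))" by (simp add: power2_eq_square algebra_simps)
    also have "\<dots> \<le> (1 - cmod (q z)) * 2" using qz by (intro mult_left_mono) auto
    also have "\<dots> \<le> (1 - Re (q z)) * 2" using complex_Re_le_cmod[of "q z"] by simp
    finally show ?thesis by (simp add: mult.commute)
  qed
  moreover have "(1 - cmod a)\<^sup>2 / 2 > 0" using a by simp
  ultimately show thesis using that by blast
qed

text \<open>Near a boundary point the disc leaves the sphere transversally: the radial derivative has a
  positive inner product with \<open>f \<xi>\<close>, which is real by the Cauchy-Riemann equations and
  nonzero by the Schwarz-Pick inequality (a Hopf lemma). The path is reparametrised to normalise it.\<close>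
lemma embedding_radial_approach:
  fixes f :: "complex \<Rightarrow> complex ^ 'n::finite"
  assumes f: "embedding_map V f" and \<xi>: "cmod \<xi> = 1"
  obtains c u where "c > 0" "cinner u (f \<xi>) = - 1"
    "((\<lambda>s. (f ((1 - s * c) *\<^sub>R \<xi>) - f \<xi>) /\<^sub>R s) \<longlongrightarrow> u) (at_right 0)"
proof -
  have hol: "\<And>i. (\<lambda>z. f z $ i) holomorphic_on ball 0 1" using f by (simp add: embedding_map_def)
  have unit: "norm (f x) = 1" if "cmod x = 1" for x using f that by (auto simp: embedding_map_def)
  obtain Df where Df: "\<And>x. x \<in> cball 0 1 \<Longrightarrow> (f has_derivative blinfun_apply (Df x)) (at x within cball 0 1)"
    "continuous_on (cball 0 1) Df" using embedding_map_derivative[OF f] by blast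
  have \<xi>c: "\<xi> \<in> cball 0 1" using \<xi> by simp
  define p where "p = f \<xi>"
  have p: "norm p = 1" unfolding p_def by (rule unit[OF \<xi>])
  define v where "v = blinfun_apply (Df \<xi>) \<xi>"
  have D: "(f has_derivative blinfun_apply (Df \<xi>)) (at \<xi> within cball 0 1)" by (rule Df(1)[OF \<xi>c])
  have "Re (cinner (\<i> *s v) p) = 0"
  proof -
    \<comment> \<open>Along the circle \<open>f\<close> stays on the unit sphere, so its tangential
      derivative, which is \<open>\<i> *s v\<close> by the Cauchy-Riemann equations, is
      real-orthogonal to \<open>p\<close>.\<close>
    define g where "g t = cis t * \<xi>" for t
    have g: "(g has_vector_derivative \<i> * \<xi>) (at 0 within UNIV)"
      unfolding g_def cis_conv_exp
      by (rule has_vector_derivative_real_field) (auto intro!: derivative_eq_intros)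
    have "(f has_derivative blinfun_apply (Df \<xi>)) (at (g 0) within range g)"
      by (rule has_derivative_subset[where s = "cball 0 1"]) (use D \<xi> in \<open>auto simp: g_def norm_mult\<close>)
    from vector_derivative_diff_chain_within[OF g this]
    have fg: "((\<lambda>t. f (g t)) has_derivative (\<lambda>t. t *\<^sub>R blinfun_apply (Df \<xi>) (\<i> * \<xi>))) (at 0)"
      by (simp add: has_vector_derivative_def o_def)
    define L where "L t = f (g 0) \<bullet> (t *\<^sub>R blinfun_apply (Df \<xi>) (\<i> * \<xi>))
      + (t *\<^sub>R blinfun_apply (Df \<xi>) (\<i> * \<xi>)) \<bullet> f (g 0)" for t :: real
    have "((\<lambda>t. f (g t) \<bullet> f (g t)) has_derivative L) (at 0)"
      unfolding L_def by (rule has_derivative_inner[OF fg fg])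
    moreover have "(\<lambda>t. f (g t) \<bullet> f (g t)) = (\<lambda>t. 1)"
      using unit \<xi> by (simp add: g_def norm_mult flip: power2_norm_eq_inner)
    ultimately have "((\<lambda>t. 1) has_derivative L) (at 0)" by simp
    then have "L = (\<lambda>t. 0)" by (rule has_derivative_unique) (rule has_derivative_const)
    from fun_cong[OF this, of 1] have "blinfun_apply (Df \<xi>) (\<i> * \<xi>) \<bullet> p = 0"
      by (simp add: L_def g_def p_def inner_commute)
    moreover have "blinfun_apply (Df \<xi>) (\<i> * \<xi>) = \<i> *s v"
      unfolding v_def by (rule boundary_cauchy_riemann[OF hol Df \<xi>c])
    ultimately show ?thesis by (simp add: inner_eq_Re_cinner)
  qed
  then have "Im (cinner v p) = 0" by (simp add: cinner_scale_left)
  then obtain A where A: "cinner v p = of_real A" by (metis complex_is_Real_iff Reals_cases)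
  have "A > 0"
  proof -
    define q where "q z = cinner (f z) p" for z
    have "q holomorphic_on ball 0 1"
      unfolding q_def cinner_def by (intro holomorphic_intros hol)
    moreover have "cmod (q z) < 1" if "cmod z < 1" for z
      unfolding q_def using embedding_map_norm_less_1[OF f, of z] that p by (intro cmod_cinner_less_1) auto
    ultimately obtain \<kappa> where \<kappa>: "\<kappa> > 0" "\<And>z. cmod z < 1 \<Longrightarrow> \<kappa> * (1 - cmod z) \<le> 1 - Re (q z)"
      using schwarz_pick_lower_bound by blast
    have lim: "((\<lambda>s. - Re (cinner ((f ((1 - s * 1) *\<^sub>R \<xi>) - f \<xi>) /\<^sub>R s) p)) \<longlongrightarrow> - Re (cinner (- (1 *\<^sub>R v)) p)) (at_right 0)"
      unfolding v_def by (intro tendsto_intros radial_difference_quotient[OF D \<xi>]) simp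
    have "\<forall>\<^sub>F s in at_right 0. s \<in> {0 <..< (1::real)}" by (rule eventually_at_right_real) simp
    then have ev: "\<forall>\<^sub>F s in at_right 0. \<kappa> \<le> - Re (cinner ((f ((1 - s * 1) *\<^sub>R \<xi>) - f \<xi>) /\<^sub>R s) p)"
    proof eventually_elim
      case (elim s)
      define z where "z = (1 - s) *\<^sub>R \<xi>"
      have z: "cmod z = 1 - s" using elim \<xi> by (simp add: z_def)
      have "\<kappa> * s \<le> 1 - Re (q z)" using \<kappa>(2)[of z] z elim by simp
      also have "1 - Re (q z) = - Re (cinner (f z - f \<xi>) p)"
        using p by (simp add: cinner_diff_left q_def p_def[symmetric] cinner_self)
      finally have "\<kappa> \<le> - Re (cinner (f z - f \<xi>) p) / s" using elim by (subst pos_le_divide_eq) auto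
      also have "\<dots> = - Re (cinner ((f z - f \<xi>) /\<^sub>R s) p)"
      proof -
        have *: "Re (of_real (inverse s) * z) = inverse s * Re z" for z
          by (simp del: of_real_inverse)
        show ?thesis unfolding cinner_scaleR_left * by (simp add: divide_inverse mult.commute)
      qed
      finally show ?case by (simp add: z_def)
    qed
    have "\<kappa> \<le> - Re (cinner (- (1 *\<^sub>R v)) p)"
      by (rule tendsto_lowerbound[OF lim ev]) simp
    then have "\<kappa> \<le> Re (cinner v p)" using cinner_diff_left[of 0 v p] by simp
    with \<kappa>(1) show ?thesis by (simp add: A)
  qed
  show thesis
  proof
    \<comment> \<open>The speed \<open>1 / A\<close> normalises the radial velocity to inner product
      \<open>-1\<close> with \<open>f \<xi>\<close>, whatever the boundary point.\<close>
    show "1 / A > 0" using \<open>A > 0\<close> by simp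
    show "((\<lambda>s. (f ((1 - s * (1 / A)) *\<^sub>R \<xi>) - f \<xi>) /\<^sub>R s) \<longlongrightarrow> - ((1 / A) *\<^sub>R v)) (at_right 0)"
      unfolding v_def by (rule radial_difference_quotient[OF D \<xi>]) (use \<open>A > 0\<close> in simp)
    have "- ((1 / A) *\<^sub>R v) = (- (1 / A)) *\<^sub>R v" by simp
    then have "cinner (- ((1 / A) *\<^sub>R v)) p = of_real (- (1 / A)) * cinner v p"
      by (simp only: cinner_scaleR_left)
    then show "cinner (- ((1 / A) *\<^sub>R v)) (f \<xi>) = - 1" using \<open>A > 0\<close> by (simp add: A p_def[symmetric])
  qed
qed

section \<open>Kernel asymptotics at a crossing\<close>

text \<open>Expanding at \<open>p\<close>, \<open>1 - cinner (U s) (W s)\<close> is \<open>s\<close>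
  times a bracket tending to \<open>2\<close> by the normalisation. The limit does not depend on
  \<open>u\<close> and \<open>w\<close>, so all kernel values along the two paths agree
  asymptotically.\<close>

lemma dk_boundary_asymptotics:
  fixes U W :: "real \<Rightarrow> complex ^ 'n::finite"
  assumes U: "((\<lambda>s. (U s - p) /\<^sub>R s) \<longlongrightarrow> u) (at_right 0)" "cinner u p = - 1"
    and W: "((\<lambda>s. (W s - p) /\<^sub>R s) \<longlongrightarrow> w) (at_right 0)" "cinner w p = - 1"
    and p: "norm p = 1"
  shows "((\<lambda>s. of_real s * (1 / (1 - cinner (U s) (W s)))) \<longlongrightarrow> 1 / 2) (at_right 0)"
proof -
  define us where "us s = (U s - p) /\<^sub>R s" for s
  define ws where "ws s = (W s - p) /\<^sub>R s" for s
  have pw: "cinner p w = - 1" using W(2) cinner_commute[of p w] by simp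
  have us: "(us \<longlongrightarrow> u) (at_right 0)" and ws: "(ws \<longlongrightarrow> w) (at_right 0)"
    using U(1) W(1) by (simp_all add: us_def[abs_def] ws_def[abs_def])
  have "((\<lambda>s. 1 / (- (cinner (us s) p + cinner p (ws s)) - of_real s * cinner (us s) (ws s))) \<longlongrightarrow>
      1 / (- (cinner u p + cinner p w) - of_real 0 * cinner u w)) (at_right 0)"
    by (intro tendsto_intros us ws) (simp add: U(2) pw)
  then have "((\<lambda>s. 1 / (- (cinner (us s) p + cinner p (ws s)) - of_real s * cinner (us s) (ws s))) \<longlongrightarrow> 1 / 2) (at_right 0)"
    by (simp add: U(2) pw)
  then show ?thesis
  proof (rule Lim_transform_eventually)
    have "\<forall>\<^sub>F s in at_right 0. (s::real) > 0" by (rule eventually_at_right_less)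
    then show "\<forall>\<^sub>F s in at_right 0. 1 / (- (cinner (us s) p + cinner p (ws s)) - of_real s * cinner (us s) (ws s))
        = of_real s * (1 / (1 - cinner (U s) (W s)))"
    proof eventually_elim
      case (elim s)
      have "U s = p + s *\<^sub>R us s" "W s = p + s *\<^sub>R ws s" using elim by (simp_all add: us_def ws_def)
      then have "1 - cinner (U s) (W s)
          = of_real s * (- (cinner (us s) p + cinner p (ws s)) - of_real s * cinner (us s) (ws s))"
        using p by (simp add: cinner_add_left cinner_add_right cinner_scaleR_left cinner_scaleR_right
            cinner_self algebra_simps)
      then show ?case using elim by simp
    qed
  qed
qed

text \<open>The multiplier bound tested on a difference of two kernel functions.\<close>

lemma multiplier_two_points:
  assumes K: "psd_kernel X K" and \<phi>: "mult_bound X K t \<phi>" and x: "x \<in> X" and y: "y \<in> X"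
  shows "Re (\<phi> x * cnj (\<phi> x) * K x x - \<phi> x * cnj (\<phi> y) * K x y - \<phi> y * cnj (\<phi> x) * K y x + \<phi> y * cnj (\<phi> y) * K y y)
    \<le> t\<^sup>2 * Re (K x x - K x y - K y x + K y y)"
proof (cases "x = y")
  case False
  define c where "c z = (if z = x then 1 else - 1 :: complex)" for z
  have "Re (qf K {x, y} (\<lambda>z. \<phi> z * c z) (\<lambda>z. \<phi> z * c z)) \<le> t\<^sup>2 * Re (qf K {x, y} c c)"
    using \<phi> x y unfolding mult_bound_def psd_kernel_multiplier_iff[OF K] by simp
  then show ?thesis using False by (simp add: qf_def c_def algebra_simps)
qed simp

text \<open>Along suitably reparametrised radii the kernel functions at the two points become
  asymptotically parallel, so a multiplier cannot separate them in the limit.\<close>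
lemma multiplier_boundary_crossing:
  fixes f :: "complex \<Rightarrow> complex ^ 'n::finite"
  assumes f: "embedding_map V f" and \<phi>: "multiplier (ball 0 1) (dk f) \<phi>"
    and cont: "continuous_on (cball 0 1) \<phi>"
    and \<xi>: "cmod \<xi> = 1" and \<zeta>: "cmod \<zeta> = 1" and eq: "f \<xi> = f \<zeta>"
  shows "\<phi> \<xi> = \<phi> \<zeta>"
proof -
  obtain t where t: "mult_bound (ball 0 1) (dk f) t \<phi>" using \<phi> by (auto simp: multiplier_def)
  have K: "psd_kernel (ball 0 1) (dk f)" by (rule psd_kernel_embedding[OF f])
  obtain c u where c: "c > 0" "cinner u (f \<xi>) = - 1"
    "((\<lambda>s. (f ((1 - s * c) *\<^sub>R \<xi>) - f \<xi>) /\<^sub>R s) \<longlongrightarrow> u) (at_right 0)"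
    by (rule embedding_radial_approach[OF f \<xi>])
  obtain d w where d: "d > 0" "cinner w (f \<zeta>) = - 1"
    "((\<lambda>s. (f ((1 - s * d) *\<^sub>R \<zeta>) - f \<zeta>) /\<^sub>R s) \<longlongrightarrow> w) (at_right 0)"
    by (rule embedding_radial_approach[OF f \<zeta>])
  note d' = d(2,3)[folded eq]
  define x where "x s = (1 - s * c) *\<^sub>R \<xi>" for s
  define y where "y s = (1 - s * d) *\<^sub>R \<zeta>" for s
  have p: "norm (f \<xi>) = 1" using f \<xi> by (auto simp: embedding_map_def)
  \<comment> \<open>With a common limit for all four scaled kernel values, the scaled squared norm
    of the difference of the kernel functions tends to zero, while its image under the adjoint of
    \<open>\<phi>\<close> tends to half of \<open>|\<phi> \<xi> - \<phi> \<zeta>|^2\<close>.\<close>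
  have k: "((\<lambda>s. of_real s * dk f (x s) (x s)) \<longlongrightarrow> 1 / 2) (at_right 0)"
    "((\<lambda>s. of_real s * dk f (x s) (y s)) \<longlongrightarrow> 1 / 2) (at_right 0)"
    "((\<lambda>s. of_real s * dk f (y s) (x s)) \<longlongrightarrow> 1 / 2) (at_right 0)"
    "((\<lambda>s. of_real s * dk f (y s) (y s)) \<longlongrightarrow> 1 / 2) (at_right 0)"
    unfolding dk_def x_def y_def
    by (rule dk_boundary_asymptotics[OF _ _ _ _ p]; rule c d')+
  have x_lim: "filterlim x (at \<xi> within ball 0 1) (at_right 0)"
    and y_lim: "filterlim y (at \<zeta> within ball 0 1) (at_right 0)"
    unfolding x_def y_def by (rule filterlim_radial; fact)+
  have lim: "(\<phi> \<longlongrightarrow> \<phi> z) (at z within ball 0 1)" if "cmod z = 1" for z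
  proof (rule tendsto_within_subset)
    show "(\<phi> \<longlongrightarrow> \<phi> z) (at z within cball 0 1)"
      using cont that unfolding continuous_on_def by simp
  qed auto
  have \<phi>x: "((\<lambda>s. \<phi> (x s)) \<longlongrightarrow> \<phi> \<xi>) (at_right 0)" by (rule filterlim_compose[OF lim[OF \<xi>] x_lim])
  have \<phi>y: "((\<lambda>s. \<phi> (y s)) \<longlongrightarrow> \<phi> \<zeta>) (at_right 0)" by (rule filterlim_compose[OF lim[OF \<zeta>] y_lim])
  have "((\<lambda>s. Re (\<phi> (x s) * cnj (\<phi> (x s)) * (of_real s * dk f (x s) (x s))
      - \<phi> (x s) * cnj (\<phi> (y s)) * (of_real s * dk f (x s) (y s))
      - \<phi> (y s) * cnj (\<phi> (x s)) * (of_real s * dk f (y s) (x s))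
      + \<phi> (y s) * cnj (\<phi> (y s)) * (of_real s * dk f (y s) (y s)))) \<longlongrightarrow>
    Re (\<phi> \<xi> * cnj (\<phi> \<xi>) * (1 / 2) - \<phi> \<xi> * cnj (\<phi> \<zeta>) * (1 / 2)
      - \<phi> \<zeta> * cnj (\<phi> \<xi>) * (1 / 2) + \<phi> \<zeta> * cnj (\<phi> \<zeta>) * (1 / 2))) (at_right 0)"
    (is "(?L \<longlongrightarrow> ?l) _")
    by (intro tendsto_intros k \<phi>x \<phi>y)
  moreover have "((\<lambda>s. t\<^sup>2 * Re (of_real s * dk f (x s) (x s) - of_real s * dk f (x s) (y s)
      - of_real s * dk f (y s) (x s) + of_real s * dk f (y s) (y s))) \<longlongrightarrow>
      t\<^sup>2 * Re (1 / 2 - 1 / 2 - 1 / 2 + 1 / 2)) (at_right 0)" (is "(?R \<longlongrightarrow> ?r) _")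
    by (intro tendsto_intros k)
  moreover have "\<forall>\<^sub>F s in at_right 0. ?L s \<le> ?R s"
  proof -
    have "\<forall>\<^sub>F s in at_right 0. x s \<in> ball 0 1" "\<forall>\<^sub>F s in at_right 0. y s \<in> ball 0 1"
      using x_lim y_lim by (auto simp: filterlim_at elim: eventually_mono)
    moreover have "\<forall>\<^sub>F s in at_right 0. (s::real) > 0" by (rule eventually_at_right_less)
    ultimately show ?thesis
    proof eventually_elim
      case (elim s)
      have "s * Re (\<phi> (x s) * cnj (\<phi> (x s)) * dk f (x s) (x s) - \<phi> (x s) * cnj (\<phi> (y s)) * dk f (x s) (y s)
          - \<phi> (y s) * cnj (\<phi> (x s)) * dk f (y s) (x s) + \<phi> (y s) * cnj (\<phi> (y s)) * dk f (y s) (y s))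
        \<le> s * (t\<^sup>2 * Re (dk f (x s) (x s) - dk f (x s) (y s) - dk f (y s) (x s) + dk f (y s) (y s)))"
        by (intro mult_left_mono multiplier_two_points[OF K t]) (use elim in auto)
      moreover have "Re (of_real s * z) = s * Re z" for z by simp
      ultimately show ?case by (simp only: plus_complex.sel minus_complex.sel mult.left_commute[of _ "complex_of_real s"]) (simp add: algebra_simps)
    qed
  qed
  ultimately have le: "?l \<le> ?r" by (intro tendsto_le[of "at_right 0" ?R ?r ?L ?l]) auto
  have l_eq: "?l = (cmod (\<phi> \<xi> - \<phi> \<zeta>))\<^sup>2 / 2"
    unfolding cmod_power2 by (simp add: power2_eq_square field_simps)
  show ?thesis using le unfolding l_eq by simp
qed

section \<open>The symbol as a disc automorphism, and transfer of crossings\<close>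

text \<open>Used twice, with the roles of \<open>f\<close> and \<open>g\<close> exchanged.
  Everything is read off from the coordinates of \<open>f\<close>: they turn
  \<open>\<Psi> (\<Phi> \<phi>) = \<phi>\<close> into \<open>f (\<nu> (\<mu> z)) = f z\<close>, and
  injectivity of \<open>f\<close> does the rest.\<close>

lemma composition_inverse:
  fixes f g :: "complex \<Rightarrow> complex ^ 'n::finite"
  assumes f: "embedding_map V f" and g: "embedding_map W g"
    and \<Phi>: "\<And>\<phi>. \<phi> \<in> M_f f \<Longrightarrow> \<Phi> \<phi> \<in> M_f g" and \<Psi>: "\<And>\<phi>. \<phi> \<in> M_f f \<Longrightarrow> \<Psi> (\<Phi> \<phi>) = \<phi>"
    and \<nu>: "\<And>w. w \<in> ball 0 1 \<Longrightarrow> \<nu> w \<in> ball 0 1"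
      "\<And>w \<phi>. w \<in> ball 0 1 \<Longrightarrow> \<phi> \<in> M_f f \<Longrightarrow> \<Phi> \<phi> w = \<phi> (\<nu> w)"
    and \<mu>: "\<And>w. w \<in> ball 0 1 \<Longrightarrow> \<mu> w \<in> ball 0 1"
      "\<And>w \<phi>. w \<in> ball 0 1 \<Longrightarrow> \<phi> \<in> M_f g \<Longrightarrow> \<Psi> \<phi> w = \<phi> (\<mu> w)"
  shows "\<nu> holomorphic_on ball 0 1"
    and "\<And>z. z \<in> ball 0 1 \<Longrightarrow> \<nu> (\<mu> z) = z"
    and "\<And>i. multiplier (ball 0 1) (dk g) (\<lambda>w. f (\<nu> w) $ i)"
proof -
  define F where "F i = restrict0 (ball 0 1) (\<lambda>z. f z $ i)" for i
  have F: "F i \<in> M_f f" for i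
    unfolding F_def M_f_def kernel_f_eq_dk
    by (intro restrict0_in_mult_alg psd_kernel_embedding[OF f] multiplier_coordinate
        embedding_map_norm_less_1[OF f])
  have F_eq: "F i z = f z $ i" if "z \<in> ball 0 1" for i z using that by (simp add: F_def restrict0_def)
  have \<Phi>F: "\<Phi> (F i) w = f (\<nu> w) $ i" if "w \<in> ball 0 1" for i w
    using \<nu>(2)[OF that F] F_eq[OF \<nu>(1)[OF that]] by simp
  show mult: "multiplier (ball 0 1) (dk g) (\<lambda>w. f (\<nu> w) $ i)" for i
  proof -
    have "multiplier (ball 0 1) (dk g) (\<Phi> (F i))" using \<Phi>[OF F] M_f_iff[OF g] by blast
    moreover have "multiplier (ball 0 1) (dk g) (\<Phi> (F i)) \<longleftrightarrow> multiplier (ball 0 1) (dk g) (\<lambda>w. f (\<nu> w) $ i)"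
      by (rule multiplier_cong) (rule \<Phi>F)
    ultimately show ?thesis by blast
  qed
  show "\<nu> holomorphic_on ball 0 1"
  proof (rule holomorphic_lift_embedding[OF f \<nu>(1)])
    show "(\<lambda>w. f (\<nu> w) $ i) holomorphic_on ball 0 1" for i
      by (rule multiplier_holomorphic[OF embedding_map_norm_less_1[OF g] open_ball _ mult])
        (use g in \<open>simp_all add: embedding_map_def\<close>)
  qed
  show "\<nu> (\<mu> z) = z" if z: "z \<in> ball 0 1" for z
  proof -
    have "f z $ i = f (\<nu> (\<mu> z)) $ i" for i
    proof -
      have "f z $ i = \<Psi> (\<Phi> (F i)) z" using \<Psi>[OF F] F_eq[OF z] by simp
      also have "\<dots> = f (\<nu> (\<mu> z)) $ i" using \<mu>(2)[OF z \<Phi>[OF F]] \<Phi>F[OF \<mu>(1)[OF z]] by simp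
      finally show ?thesis .
    qed
    then have "f z = f (\<nu> (\<mu> z))" by (simp add: vec_eq_iff)
    moreover have "inj_on f (ball 0 1)" using f by (simp add: embedding_map_def)
    ultimately show ?thesis using \<nu>(1)[OF \<mu>(1)[OF z]] z by (auto dest: inj_onD)
  qed
qed

lemma crossing_transfer:
  fixes f g :: "complex \<Rightarrow> complex ^ 'n::finite"
  assumes f: "embedding_map V f" and g: "embedding_map W g"
    and m: "continuous_on (cball 0 1) m" "\<And>z. z \<in> ball 0 1 \<Longrightarrow> m z \<in> ball 0 1"
    and mult: "\<And>i. multiplier (ball 0 1) (dk f) (\<lambda>z. g (m z) $ i)"
    and \<xi>: "cmod \<xi> = 1" and \<zeta>: "cmod \<zeta> = 1" and eq: "f \<xi> = f \<zeta>"
  shows "g (m \<xi>) = g (m \<zeta>)"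
proof -
  have "m ` closure (ball 0 1) \<subseteq> cball 0 1"
    by (rule image_closure_subset) (use m in \<open>auto simp: less_imp_le\<close>)
  then have "continuous_on (cball 0 1) (\<lambda>z. g (m z))"
    by (intro continuous_on_compose2[OF embedding_map_continuous[OF g] m(1)]) simp
  then have "continuous_on (cball 0 1) (\<lambda>z. g (m z) $ i)" for i
    by (intro continuous_intros)
  then have "g (m \<xi>) $ i = g (m \<zeta>) $ i" for i
    by (rule multiplier_boundary_crossing[OF f mult _ \<xi> \<zeta> eq])
  then show ?thesis by (simp add: vec_eq_iff)
qed

theorem theorem1p3:
  fixes V W :: "(complex ^ 'n::finite) set" and f g :: "complex \<Rightarrow> complex ^ 'n"
  assumes "embedding_map V f" and "embedding_map W g"
    and "alg_isomorphic (M_f f) (M_f g)"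
  shows "\<exists>\<mu>. disc_automorphism \<mu> \<and>
     (\<forall>\<xi> \<zeta>. cmod \<xi> = 1 \<longrightarrow> cmod \<zeta> = 1 \<longrightarrow> (f \<xi> = f \<zeta> \<longleftrightarrow> g (\<mu> \<xi>) = g (\<mu> \<zeta>)))"
proof -
  note f = assms(1) and g = assms(2)
  obtain \<Phi> where \<Phi>: "alg_isomorphism \<Phi> (M_f f) (M_f g)"
    using assms(3) unfolding alg_isomorphic_def alg_isomorphism_def by blast
  define \<Psi> where "\<Psi> = inv_into (M_f f) \<Phi>"
  have \<Psi>: "alg_isomorphism \<Psi> (M_f g) (M_f f)"
    using alg_isomorphism_inverse[OF psd_kernel_embedding[OF f], of \<Phi> "M_f g"] \<Phi>
    unfolding \<Psi>_def M_f_def kernel_f_eq_dk by blast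
  have bij: "bij_betw \<Phi> (M_f f) (M_f g)" using \<Phi> by (simp add: alg_isomorphism_def)
  have \<Phi>_in: "\<Phi> \<phi> \<in> M_f g" if "\<phi> \<in> M_f f" for \<phi> using bij that by (auto simp: bij_betw_def)
  have \<Psi>_in: "\<Psi> \<phi> \<in> M_f f" if "\<phi> \<in> M_f g" for \<phi>
    using \<Psi> that by (auto simp: alg_isomorphism_def bij_betw_def)
  have inv: "\<Psi> (\<Phi> \<phi>) = \<phi>" if "\<phi> \<in> M_f f" for \<phi>
    unfolding \<Psi>_def by (rule bij_betw_inv_into_left[OF bij that])
  have inv': "\<Phi> (\<Psi> \<phi>) = \<phi>" if "\<phi> \<in> M_f g" for \<phi>
    unfolding \<Psi>_def by (rule bij_betw_inv_into_right[OF bij that])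
  obtain \<nu> where \<nu>: "\<And>w. w \<in> ball 0 1 \<Longrightarrow> \<nu> w \<in> ball 0 1"
      "\<And>w \<phi>. w \<in> ball 0 1 \<Longrightarrow> \<phi> \<in> M_f f \<Longrightarrow> \<Phi> \<phi> w = \<phi> (\<nu> w)"
    using alg_isomorphism_is_composition[OF f g \<Phi>] by blast
  obtain \<mu> where \<mu>: "\<And>w. w \<in> ball 0 1 \<Longrightarrow> \<mu> w \<in> ball 0 1"
      "\<And>w \<phi>. w \<in> ball 0 1 \<Longrightarrow> \<phi> \<in> M_f g \<Longrightarrow> \<Psi> \<phi> w = \<phi> (\<mu> w)"
    using alg_isomorphism_is_composition[OF g f \<Psi>] by blast
  have nu: "\<nu> holomorphic_on ball 0 1" "z \<in> ball 0 1 \<Longrightarrow> \<nu> (\<mu> z) = z"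
    "multiplier (ball 0 1) (dk g) (\<lambda>w. f (\<nu> w) $ i)" for z i
    by (rule composition_inverse[OF f g \<Phi>_in inv \<nu> \<mu>]; assumption)+
  have mu: "\<mu> holomorphic_on ball 0 1" "z \<in> ball 0 1 \<Longrightarrow> \<mu> (\<nu> z) = z"
    "multiplier (ball 0 1) (dk f) (\<lambda>w. g (\<mu> w) $ i)" for z i
    by (rule composition_inverse[OF g f \<Psi>_in inv' \<mu> \<nu>]; assumption)+
  \<comment> \<open>Outside the open disc \<open>\<mu>\<close> and \<open>\<nu>\<close> are
    unspecified; \<open>m\<close> and \<open>n\<close> are the versions that are continuous up to
    the circle.\<close>
  obtain m n where m: "continuous_on (cball 0 1) m" "\<And>z. z \<in> ball 0 1 \<Longrightarrow> m z = \<mu> z"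
    and n: "continuous_on (cball 0 1) n" "\<And>z. z \<in> ball 0 1 \<Longrightarrow> n z = \<nu> z"
    and unit: "\<And>\<xi>. cmod \<xi> = 1 \<Longrightarrow> cmod (m \<xi>) = 1" and nm: "\<And>\<xi>. cmod \<xi> = 1 \<Longrightarrow> n (m \<xi>) = \<xi>"
    by (rule disc_biholomorphism_extension[OF mu(1) \<mu>(1) nu(1) \<nu>(1) nu(2) mu(2)]) blast+
  have gm: "multiplier (ball 0 1) (dk f) (\<lambda>z. g (m z) $ i)" for i
    using mu(3)[of i] multiplier_cong[of "ball 0 1" "\<lambda>z. g (m z) $ i" "\<lambda>z. g (\<mu> z) $ i" "dk f"] m(2) by simp
  have fn: "multiplier (ball 0 1) (dk g) (\<lambda>z. f (n z) $ i)" for i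
    using nu(3)[of i] multiplier_cong[of "ball 0 1" "\<lambda>z. f (n z) $ i" "\<lambda>z. f (\<nu> z) $ i" "dk g"] n(2) by simp
  have "m holomorphic_on ball 0 1"
    by (rule holomorphic_transform[OF mu(1)]) (rule m(2)[symmetric])
  moreover have "bij_betw m (ball 0 1) (ball 0 1)"
    by (rule bij_betwI[where g = \<nu>]) (use m(2) \<mu>(1) \<nu>(1) nu(2) mu(2) in auto)
  ultimately have "disc_automorphism m" using m(1) by (simp add: disc_automorphism_def)
  moreover have "f \<xi> = f \<zeta> \<longleftrightarrow> g (m \<xi>) = g (m \<zeta>)" if \<xi>: "cmod \<xi> = 1" and \<zeta>: "cmod \<zeta> = 1" for \<xi> \<zeta>
  proof
    assume "f \<xi> = f \<zeta>"
    then show "g (m \<xi>) = g (m \<zeta>)"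
      by (intro crossing_transfer[OF f g m(1) _ gm \<xi> \<zeta>]) (use m(2) \<mu>(1) in auto)
  next
    assume "g (m \<xi>) = g (m \<zeta>)"
    \<comment> \<open>The converse is the same transfer for \<open>n\<close>, at the circle points
      \<open>m \<xi>\<close> and \<open>m \<zeta>\<close>.\<close>
    then have "f (n (m \<xi>)) = f (n (m \<zeta>))"
      by (intro crossing_transfer[OF g f n(1) _ fn unit[OF \<xi>] unit[OF \<zeta>]]) (use n(2) \<nu>(1) in auto)
    then show "f \<xi> = f \<zeta>" by (simp add: nm \<xi> \<zeta>)
  qed
  ultimately show ?thesis by blast
qed

end
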